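(* Let $\Omega\subset\mathbb{R}^n$ be a domain satisfying the cone condition with $0\in\Omega$, let $m\in\mathbb{N}_0$, $1<p<\infty$, $1\le r\le\infty$, and $\alpha_1,\alpha_2\in\mathbb{R}$ with $(\alpha_2,p,r)\in V_{\alpha_2,p,r}$, $\alpha_2\ge\alpha_1$, $\alpha_1+\frac np>0$ and $\max(\frac np+\alpha_2,\frac np+\alpha_2-\alpha_1)<m<n$. Then $\dot K_{p,m}^{\alpha_2,r}(\Omega)\hookrightarrow\dot K_p^{\alpha_1,r}(\Omega)$ (continuous embedding).
   Context: For $k\in\mathbb{Z}$ let $C_k=\{x\in\mathbb{R}^n: 2^{k-1}\le |x|<2^k\}$ and $\chi_k$ its characteristic function. For $\alpha\in\mathbb{R}$, $1\le p,q\le\infty$ and $\Omega$ open, $\|f\|_{\dot K_p^{\alpha,q}(\Omega)}=\big(\sum_{k\in\mathbb{Z}}2^{k\alpha q}\|f\chi_{C_k\cap\Omega}\|_{L^p}^q\big)^{1/q}$ (usual modification if $q=\infty$), and $\dot K_p^{\alpha,q}(\Omega)$ is the set of functions on $\Omega$ (locally $L^p$ away from $0$) with finite norm. $V_{\alpha,p,q}$ is the set of $(\alpha,p,q)\in\mathbb{R}\times[1,\infty]^2$ with either $\alpha<n-\frac np$; or $\alpha=n-\frac np$ and $q=1$; or $\alpha=0$, $p=q=\infty$. For $(\alpha,p,q)\in V_{\alpha,p,q}$ and $m\in\mathbb{N}_0$, the Herz–Sobolev space $\dot K_{p,m}^{\alpha,q}(\Omega)$ is the set of $f\in\dot K_p^{\alpha,q}(\Omega)$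 whose weak derivatives satisfy $D^\beta f\in\dot K_p^{\alpha,q}(\Omega)$ for $|\beta|\le m$, with norm $\|f\|_{\dot K_{p,m}^{\alpha,q}(\Omega)}=\big(\sum_{k\in\mathbb{Z}}2^{k\alpha q}\big(\sum_{|\beta|\le m}\|(D^\beta f)\chi_{C_k\cap\Omega}\|_{L^p}^p\big)^{q/p}\big)^{1/q}$ (sup over $k$ if $q=\infty$). A finite cone with vertex $0$ of height $\varrho>0$, axis direction $v\ne0$ and aperture $\kappa\in(0,\pi)$ is $\{x: x=0 \text{ or } 0<|x|\le\varrho,\ \angle(x,v)\le\kappa/2\}$. A domain (open connected set) $\Omega$ satisfies the cone condition if there is a finite cone $C$ such that every $x\in\Omega$ is the vertex of a finite cone $C_x\subset\Omega$ congruent to $C$ (obtained from $C$ by a rigid motion). *)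

theory Defs
  imports "HOL-Analysis.Analysis"
begin

definition annulus :: "int \<Rightarrow> 'a::euclidean_space set" where
  "annulus k = {x. 2 powr (real_of_int k - 1) \<le> norm x \<and> norm x < 2 powr (real_of_int k)}"

definition Lp_on :: "real \<Rightarrow> 'a::euclidean_space set \<Rightarrow> ('a \<Rightarrow> real) \<Rightarrow> bool" where
  "Lp_on p S f \<longleftrightarrow> f \<in> borel_measurable (lebesgue_on S)
     \<and> integrable (lebesgue_on S) (\<lambda>x. \<bar>f x\<bar> powr p)"

definition Lp_norm :: "real \<Rightarrow> 'a::euclidean_space set \<Rightarrow> ('a \<Rightarrow> real) \<Rightarrow> real" where
  "Lp_norm p S f = (integral\<^sup>L (lebesgue_on S) (\<lambda>x. \<bar>f x\<bar> powr p)) powr (1 / p)"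

definition herz_outer_finite :: "real \<Rightarrow> ennreal \<Rightarrow> (int \<Rightarrow> real) \<Rightarrow> bool" where
  "herz_outer_finite \<alpha> q a \<longleftrightarrow>
     (if q = \<infinity> then bdd_above (range (\<lambda>k. 2 powr (real_of_int k * \<alpha>) * a k))
      else (\<lambda>k. (2 powr (real_of_int k * \<alpha>) * a k) powr enn2real q) summable_on (UNIV :: int set))"

definition herz_outer :: "real \<Rightarrow> ennreal \<Rightarrow> (int \<Rightarrow> real) \<Rightarrow> real" where
  "herz_outer \<alpha> q a =
     (if q = \<infinity> then (SUP k. 2 powr (real_of_int k * \<alpha>) * a k)
      else (\<Sum>\<^sub>\<infinity>k. (2 powr (real_of_int k * \<alpha>) * a k) powr enn2real q) powr (1 / enn2real q))"

definition herz_space :: "real \<Rightarrow> real \<Rightarrow> ennreal \<Rightarrow> 'a::euclidean_space set \<Rightarrow> ('a \<Rightarrow> real) set" where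
  "herz_space \<alpha> p q \<Omega> = {f. (\<forall>k. Lp_on p (annulus k \<inter> \<Omega>) f)
       \<and> herz_outer_finite \<alpha> q (\<lambda>k. Lp_norm p (annulus k \<inter> \<Omega>) f)}"

definition herz_norm :: "real \<Rightarrow> real \<Rightarrow> ennreal \<Rightarrow> 'a::euclidean_space set \<Rightarrow> ('a \<Rightarrow> real) \<Rightarrow> real" where
  "herz_norm \<alpha> p q \<Omega> f = herz_outer \<alpha> q (\<lambda>k. Lp_norm p (annulus k \<inter> \<Omega>) f)"

definition in_V :: "nat \<Rightarrow> real \<Rightarrow> ennreal \<Rightarrow> ennreal \<Rightarrow> bool" where
  "in_V n \<alpha> p q \<longleftrightarrow> 1 \<le> p \<and> 1 \<le> q \<and>
     (let np = (if p = \<infinity> then 0 else real n / enn2real p) in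
       \<alpha> < real n - np \<or> (\<alpha> = real n - np \<and> q = 1) \<or> (\<alpha> = 0 \<and> p = \<infinity> \<and> q = \<infinity>))"

definition pdir :: "'a::euclidean_space \<Rightarrow> ('a \<Rightarrow> real) \<Rightarrow> ('a \<Rightarrow> real)" where
  "pdir b \<phi> = (\<lambda>x. frechet_derivative \<phi> (at x) b)"

fun dirderiv :: "'a::euclidean_space list \<Rightarrow> ('a \<Rightarrow> real) \<Rightarrow> ('a \<Rightarrow> real)" where
  "dirderiv [] \<phi> = \<phi>"
| "dirderiv (b # bs) \<phi> = pdir b (dirderiv bs \<phi>)"

definition smooth_fun :: "('a::euclidean_space \<Rightarrow> real) \<Rightarrow> bool" where
  "smooth_fun \<phi> \<longleftrightarrow> (\<forall>bs. set bs \<subseteq> Basis \<longrightarrow> (\<forall>x. dirderiv bs \<phi> differentiable (at x)))"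

definition test_fun :: "'a::euclidean_space set \<Rightarrow> ('a \<Rightarrow> real) \<Rightarrow> bool" where
  "test_fun \<Omega> \<phi> \<longleftrightarrow> smooth_fun \<phi> \<and> compact (closure {x. \<phi> x \<noteq> 0})
     \<and> closure {x. \<phi> x \<noteq> 0} \<subseteq> \<Omega>"

definition multi_indices :: "nat \<Rightarrow> ('a::euclidean_space \<Rightarrow> nat) set" where
  "multi_indices m = {\<beta>. (\<forall>x. x \<notin> Basis \<longrightarrow> \<beta> x = 0) \<and> sum \<beta> Basis \<le> m}"

definition mi_order :: "('a::euclidean_space \<Rightarrow> nat) \<Rightarrow> nat" where
  "mi_order \<beta> = sum \<beta> Basis"

definition Dmi :: "('a::euclidean_space \<Rightarrow> nat) \<Rightarrow> ('a \<Rightarrow> real) \<Rightarrow> ('a \<Rightarrow> real)" where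
  "Dmi \<beta> \<phi> = dirderiv (SOME bs. set bs \<subseteq> Basis \<and> (\<forall>b\<in>Basis. count_list bs b = \<beta> b)) \<phi>"

definition weak_deriv :: "'a::euclidean_space set \<Rightarrow> ('a \<Rightarrow> nat) \<Rightarrow> ('a \<Rightarrow> real) \<Rightarrow> ('a \<Rightarrow> real) \<Rightarrow> bool" where
  "weak_deriv \<Omega> \<beta> f g \<longleftrightarrow> (\<forall>\<phi>. test_fun \<Omega> \<phi> \<longrightarrow>
      integrable (lebesgue_on \<Omega>) (\<lambda>x. f x * Dmi \<beta> \<phi> x)
    \<and> integrable (lebesgue_on \<Omega>) (\<lambda>x. g x * \<phi> x)
    \<and> integral\<^sup>L (lebesgue_on \<Omega>) (\<lambda>x. f x * Dmi \<beta> \<phi> x)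
        = (-1) ^ mi_order \<beta> * integral\<^sup>L (lebesgue_on \<Omega>) (\<lambda>x. g x * \<phi> x))"

definition herz_sobolev_witness ::
  "real \<Rightarrow> real \<Rightarrow> ennreal \<Rightarrow> nat \<Rightarrow> 'a::euclidean_space set \<Rightarrow> ('a \<Rightarrow> real) \<Rightarrow> (('a \<Rightarrow> nat) \<Rightarrow> 'a \<Rightarrow> real) \<Rightarrow> bool" where
  "herz_sobolev_witness \<alpha> p q m \<Omega> f G \<longleftrightarrow> f \<in> herz_space \<alpha> p q \<Omega> \<and>
     (\<forall>\<beta>\<in>multi_indices m. weak_deriv \<Omega> \<beta> f (G \<beta>) \<and> G \<beta> \<in> herz_space \<alpha> p q \<Omega>)"

definition herz_sobolev_space :: "real \<Rightarrow> real \<Rightarrow> ennreal \<Rightarrow> nat \<Rightarrow> 'a::euclidean_space set \<Rightarrow> ('a \<Rightarrow> real) set" where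
  "herz_sobolev_space \<alpha> p q m \<Omega> = {f. \<exists>G. herz_sobolev_witness \<alpha> p q m \<Omega> f G}"

text \<open>Norm, computed from a family G of weak derivatives (independent of the choice a.e.).\<close>
definition herz_sobolev_norm ::
  "real \<Rightarrow> real \<Rightarrow> ennreal \<Rightarrow> nat \<Rightarrow> 'a::euclidean_space set \<Rightarrow> (('a \<Rightarrow> nat) \<Rightarrow> 'a \<Rightarrow> real) \<Rightarrow> real" where
  "herz_sobolev_norm \<alpha> p q m \<Omega> G = herz_outer \<alpha> q
     (\<lambda>k. (\<Sum>\<beta>\<in>multi_indices m. Lp_norm p (annulus k \<inter> \<Omega>) (G \<beta>) powr p) powr (1 / p))"

definition finite_cone :: "real \<Rightarrow> 'a::euclidean_space \<Rightarrow> real \<Rightarrow> 'a set" where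
  "finite_cone \<rho> v \<kappa> = {x. x = 0 \<or> (0 < norm x \<and> norm x \<le> \<rho>
        \<and> arccos (inner x v / (norm x * norm v)) \<le> \<kappa> / 2)}"

definition has_cone_property :: "'a::euclidean_space set \<Rightarrow> bool" where
  "has_cone_property \<Omega> \<longleftrightarrow> (\<exists>\<rho> v \<kappa>. 0 < \<rho> \<and> v \<noteq> 0 \<and> 0 < \<kappa> \<and> \<kappa> < pi \<and>
     (\<forall>x\<in>\<Omega>. \<exists>T::'a \<Rightarrow> 'a. orthogonal_transformation T \<and> (\<lambda>y. x + T y) ` finite_cone \<rho> v \<kappa> \<subseteq> \<Omega>))"

definition is_domain :: "'a::euclidean_space set \<Rightarrow> bool" where
  "is_domain \<Omega> \<longleftrightarrow> open \<Omega> \<and> connected \<Omega> \<and> \<Omega> \<noteq> {}"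

end

theory Submission
  imports Defs "HOL-Computational_Algebra.Polynomial"
begin

text \<open>For a function \<open>u\<close> with weak gradient \<open>v\<close> near the origin,
  \<open>u (2 x) - u x\<close> is an average of \<open>v (x / c) \<bullet> x / c\<^sup>2\<close> over \<open>c \<in> [1/2, 1]\<close>. Taking \<open>L\<^sup>p\<close> norms on the
  dyadic annulus \<open>C\<^sub>k\<close> gives \<open>a\<^sub>k \<le> \<theta> a\<^sub>k\<^sub>+\<^sub>1 + c 2\<^sup>k (g\<^sub>k + g\<^sub>k\<^sub>+\<^sub>1)\<close> with \<open>\<theta>\<close> as close to \<open>2\<^sup>-\<^sup>n\<^sup>/\<^sup>p\<close> as desired.
  After multiplication by \<open>2\<^sup>k\<^sup>\<gamma>\<close> with \<open>\<gamma> > - n / p\<close> this recursion contracts and can be summed in \<open>\<ell>\<^sup>r\<close>, so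
  one derivative improves the weight exponent near \<open>0\<close> by one, as long as it stays at least \<open>\<alpha>1\<close>. After \<open>m\<close> steps
  the exponent is \<open>max (\<alpha>2 - m) \<alpha>1 = \<alpha>1\<close>. Away from \<open>0\<close> only \<open>\<alpha>1 \<le> \<alpha>2\<close> matters.\<close>

subsection \<open>Smooth functions and test functions\<close>

text \<open>The limit value 2^(-n/p) is the Jacobian factor of x -> 2 x, which maps
  \<open>annulus k\<close> onto \<open>annulus (k + 1)\<close>. Comparing u x with u (2 x), and not
  with u (x / 2), makes each annulus depend on the next larger one, so the recursion runs towards 0
  and stays inside a ball contained in \<Omega>. The loss that keeps \<theta> above 2^(-n/p) comes
  from splitting a p-th power of a sum by convexity: a weight t puts (1 - t)^(1 - p) on the main
  term and t^(1 - p) on the gradient term. Two obstacles shape the preparations. Derivatives are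
  known only through test functions, so the dilation formula has to be proved in integrated form and
  then localized by the fundamental lemma of the calculus of variations. And a multi-index
  derivative of a test function is defined through a chosen order of the partial derivatives;
  relating order \<beta> to order \<beta> + e_i therefore requires that partial derivatives
  commute.\<close>

lemma pdir_eq:
  assumes "(f has_derivative f') (at x)"
  shows "pdir b f x = f' b"
  using frechet_derivative_at[OF assms] by (simp add: pdir_def)

lemma has_derivative_pdir:
  assumes "f differentiable (at x)"
  shows "(f has_derivative (\<lambda>b. pdir b f x)) (at x)"
  using assms by (simp add: pdir_def frechet_derivative_works[symmetric])

lemma dirderiv_append: "dirderiv (as @ bs) f = dirderiv as (dirderiv bs f)"
  by (induction as) auto

text \<open>Coinduction principle for smoothness. In its applications \<open>S\<close> is a family
  of functions of a fixed shape that differentiation preserves, so no formula for higher derivatives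
  is ever written down.\<close>

lemma smooth_fun_coinduct:
  assumes "f \<in> S" and diff: "\<And>g x. g \<in> S \<Longrightarrow> g differentiable (at x)"
    and pdir: "\<And>g b. g \<in> S \<Longrightarrow> b \<in> Basis \<Longrightarrow> pdir b g \<in> S"
  shows "smooth_fun f"
proof -
  have "dirderiv bs f \<in> S" if "set bs \<subseteq> Basis" for bs
    using that by (induction bs) (auto simp: assms(1) pdir)
  then show ?thesis
    unfolding smooth_fun_def using diff by blast
qed

lemma smooth_fun_differentiable: "smooth_fun f \<Longrightarrow> f differentiable (at x)"
  unfolding smooth_fun_def by (metis dirderiv.simps(1) empty_iff list.set(1) subsetI)

lemma smooth_fun_pdir: "smooth_fun f \<Longrightarrow> b \<in> Basis \<Longrightarrow> smooth_fun (pdir b f)" for f :: "'a::euclidean_space \<Rightarrow> real"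
  unfolding smooth_fun_def
proof (intro allI impI)
  fix bs :: "'a list" and x assume *: "\<forall>bs. set bs \<subseteq> Basis \<longrightarrow> (\<forall>x. dirderiv bs f differentiable at x)"
    "b \<in> Basis" "set bs \<subseteq> Basis"
  then have "dirderiv (bs @ [b]) f differentiable at x" by (auto simp del: dirderiv.simps)
  then show "dirderiv bs (pdir b f) differentiable at x" by (simp add: dirderiv_append)
qed

lemma smooth_funI:
  assumes "\<And>x. f differentiable (at x)" "\<And>b. b \<in> Basis \<Longrightarrow> smooth_fun (pdir b f)"
  shows "smooth_fun f"
  by (rule smooth_fun_coinduct[of _ "insert f {g. smooth_fun g}"])
     (auto simp: assms smooth_fun_pdir smooth_fun_differentiable)

lemma smooth_fun_continuous: "smooth_fun f \<Longrightarrow> continuous_on A f"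
  by (meson smooth_fun_differentiable continuous_at_imp_continuous_on differentiable_imp_continuous_within)

lemma smooth_fun_const: "smooth_fun (\<lambda>x. c)"
proof (rule smooth_fun_coinduct[of _ "range (\<lambda>c x. c)"])
  fix g :: "'a \<Rightarrow> real" and b assume "g \<in> range (\<lambda>c x. c)"
  then have "pdir b g = (\<lambda>x. 0)" by (auto simp: fun_eq_iff intro!: pdir_eq[THEN trans] derivative_eq_intros)
  then show "pdir b g \<in> range (\<lambda>c x. c)" by blast
qed auto

lemma smooth_fun_inner: "smooth_fun (\<lambda>x. x \<bullet> v)" for v :: "'a::euclidean_space"
proof (rule smooth_funI)
  have *: "((\<lambda>x. x \<bullet> v) has_derivative (\<lambda>h. h \<bullet> v)) (at x)" for x :: 'a
    by (auto intro!: derivative_eq_intros)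
  then show "(\<lambda>x. x \<bullet> v) differentiable at x" for x by (auto simp: differentiable_def)
  have "pdir b (\<lambda>x. x \<bullet> v) = (\<lambda>x. b \<bullet> v)" for b using pdir_eq[OF *] by auto
  then show "smooth_fun (pdir b (\<lambda>x. x \<bullet> v))" for b by (simp add: smooth_fun_const)
qed

text \<open>The product rule produces sums of products, so products of smooth functions alone are
  not stable under differentiation. The algebra generated by all smooth functions is, and
  coinduction then shows that it contains nothing but smooth functions.\<close>

inductive_set smooth_algebra :: "('a::euclidean_space \<Rightarrow> real) set" where
  base: "smooth_fun f \<Longrightarrow> f \<in> smooth_algebra"
| add: "f \<in> smooth_algebra \<Longrightarrow> g \<in> smooth_algebra \<Longrightarrow> (\<lambda>x. f x + g x) \<in> smooth_algebra"
| mult: "f \<in> smooth_algebra \<Longrightarrow> g \<in> smooth_algebra \<Longrightarrow> (\<lambda>x. f x * g x) \<in> smooth_algebra"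

lemma pdir_add:
  assumes "f differentiable (at x)" "g differentiable (at x)"
  shows "pdir b (\<lambda>x. f x + g x) x = pdir b f x + pdir b g x"
  using has_derivative_add[OF assms[THEN has_derivative_pdir]] by (rule pdir_eq)

lemma pdir_mult:
  assumes "f differentiable (at x)" "g differentiable (at x)"
  shows "pdir b (\<lambda>x. f x * g x) x = f x * pdir b g x + pdir b f x * g x"
  using has_derivative_mult[OF assms[THEN has_derivative_pdir]] by (rule pdir_eq)

lemma smooth_algebra_differentiable: "f \<in> smooth_algebra \<Longrightarrow> f differentiable (at x)"
  by (induction rule: smooth_algebra.induct) (auto intro: smooth_fun_differentiable)

lemma smooth_algebra_pdir: "f \<in> smooth_algebra \<Longrightarrow> b \<in> Basis \<Longrightarrow> pdir b f \<in> smooth_algebra"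
proof (induction rule: smooth_algebra.induct)
  case (base f)
  then show ?case by (simp add: smooth_algebra.base smooth_fun_pdir)
next
  case (add f g)
  then have "pdir b (\<lambda>x. f x + g x) = (\<lambda>x. pdir b f x + pdir b g x)"
    by (auto simp: pdir_add smooth_algebra_differentiable)
  with add show ?case by (auto intro: smooth_algebra.intros)
next
  case (mult f g)
  then have "pdir b (\<lambda>x. f x * g x) = (\<lambda>x. f x * pdir b g x + pdir b f x * g x)"
    by (auto simp: pdir_mult smooth_algebra_differentiable)
  with mult show ?case by (auto intro: smooth_algebra.intros)
qed

lemma smooth_algebra_smooth: "f \<in> smooth_algebra \<Longrightarrow> smooth_fun f"
  by (erule smooth_fun_coinduct) (auto intro: smooth_algebra_differentiable smooth_algebra_pdir)

lemma smooth_fun_mult: "smooth_fun f \<Longrightarrow> smooth_fun g \<Longrightarrow> smooth_fun (\<lambda>x. f x * g x)"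
  by (simp add: smooth_algebra_smooth smooth_algebra.base smooth_algebra.mult)

lemma smooth_fun_prod:
  assumes "finite I" "\<And>i. i \<in> I \<Longrightarrow> smooth_fun (f i)"
  shows "smooth_fun (\<lambda>x. \<Prod>i\<in>I. f i x)"
  using assms by (induction I rule: finite_induct) (auto simp: smooth_fun_const smooth_fun_mult)

lemma has_derivative_scaleR_arg:
  assumes "f differentiable (at (c *\<^sub>R x))"
  shows "((\<lambda>x. f (c *\<^sub>R x)) has_derivative (\<lambda>b. c * pdir b f (c *\<^sub>R x))) (at x)"
proof -
  have f: "(f has_derivative (\<lambda>b. pdir b f (c *\<^sub>R x))) (at (c *\<^sub>R x))"
    by (rule has_derivative_pdir[OF assms])
  have "((\<lambda>x. f (c *\<^sub>R x)) has_derivative (\<lambda>b. pdir (c *\<^sub>R b) f (c *\<^sub>R x))) (at x)"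
    by (rule has_derivative_compose[of "\<lambda>x. c *\<^sub>R x", OF _ f]) (auto intro!: derivative_eq_intros)
  moreover have "pdir (c *\<^sub>R b) f (c *\<^sub>R x) = c * pdir b f (c *\<^sub>R x)" for b
    using linear_scale[OF has_derivative_linear[OF f]] by simp
  ultimately show ?thesis by simp
qed

lemma smooth_fun_scaleR_arg:
  fixes f :: "'a::euclidean_space \<Rightarrow> real"
  assumes "smooth_fun f"
  shows "smooth_fun (\<lambda>x. f (c *\<^sub>R x))"
\<comment> \<open>The coefficient \<open>a\<close> absorbs the factor \<open>c\<close> that each
  application of the chain rule contributes.\<close>
proof (rule smooth_fun_coinduct[of _ "{\<lambda>x. a * g (c *\<^sub>R x) | a g. smooth_fun g}"])
  show "(\<lambda>x. f (c *\<^sub>R x)) \<in> {\<lambda>x. a * g (c *\<^sub>R x) | a g. smooth_fun g}"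
    using assms by (auto intro!: exI[of _ 1] exI[of _ f])
next
  fix h :: "'a \<Rightarrow> real" assume "h \<in> {\<lambda>x. a * g (c *\<^sub>R x) | a g. smooth_fun g}"
  then obtain a g where h: "h = (\<lambda>x. a * g (c *\<^sub>R x))" and g: "smooth_fun g" by blast
  have *: "(h has_derivative (\<lambda>b. a * (c * pdir b g (c *\<^sub>R x)))) (at x)" for x
    unfolding h by (intro has_derivative_mult_right has_derivative_scaleR_arg smooth_fun_differentiable g)
  then show "h differentiable at x" for x by (auto simp: differentiable_def)
  fix b :: 'a assume "b \<in> Basis"
  have "pdir b h = (\<lambda>x. (a * c) * pdir b g (c *\<^sub>R x))"
    using pdir_eq[OF *] by (auto simp: fun_eq_iff)
  then show "pdir b h \<in> {\<lambda>x. a * g (c *\<^sub>R x) | a g. smooth_fun g}"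
    using smooth_fun_pdir[OF g \<open>b \<in> Basis\<close>] by blast
qed

subsection \<open>Symmetry of mixed derivatives\<close>

text \<open>Two applications of the mean value theorem turn the second difference quotient into the
  mixed derivative at a point near x; continuity at x then gives the limit. The quotient is
  symmetric in \<open>a\<close> and \<open>b\<close>, whereas the limit shows the order of
  differentiation.\<close>

lemma second_difference_tendsto:
  fixes f :: "'a::euclidean_space \<Rightarrow> real"
  assumes f: "\<And>x. f differentiable (at x)" and fa: "\<And>x. pdir a f differentiable (at x)"
    and cont: "isCont (pdir b (pdir a f)) x"
  shows "((\<lambda>h. (f (x + h *\<^sub>R a + h *\<^sub>R b) - f (x + h *\<^sub>R a) - f (x + h *\<^sub>R b) + f x) / h\<^sup>2)
           \<longlongrightarrow> pdir b (pdir a f) x) (at_right 0)"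
proof -
  have line: "((\<lambda>s. g (y + s *\<^sub>R v)) has_real_derivative pdir v g (y + s *\<^sub>R v)) (at s)"
    if g: "\<And>x. g differentiable (at x)" for g :: "'a \<Rightarrow> real" and y v s
  proof -
    have 1: "(g has_derivative (\<lambda>b. pdir b g (y + s *\<^sub>R v))) (at (y + s *\<^sub>R v))"
      by (rule has_derivative_pdir[OF g])
    have "((\<lambda>s. g (y + s *\<^sub>R v)) has_derivative (\<lambda>r. pdir (r *\<^sub>R v) g (y + s *\<^sub>R v))) (at s)"
      by (rule has_derivative_compose[of "\<lambda>s. y + s *\<^sub>R v", OF _ 1]) (auto intro!: derivative_eq_intros)
    moreover have "pdir (r *\<^sub>R v) g (y + s *\<^sub>R v) = pdir v g (y + s *\<^sub>R v) * r" for r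
      using linear_scale[OF has_derivative_linear[OF 1]] by simp
    ultimately show ?thesis by (simp add: has_field_derivative_def mult_commute_abs)
  qed
  define D where "D h = f (x + h *\<^sub>R a + h *\<^sub>R b) - f (x + h *\<^sub>R a) - f (x + h *\<^sub>R b) + f x" for h
  have ex: "\<exists>s t. 0 < s \<and> s < h \<and> 0 < t \<and> t < h \<and> D h / h\<^sup>2 = pdir b (pdir a f) (x + s *\<^sub>R a + t *\<^sub>R b)"
    if h: "h > 0" for h
  proof -
    \<comment> \<open>The difference in direction \<open>b\<close> as a function of the parameter
      along \<open>a\<close>: the mean value theorem is used along \<open>a\<close> for
      \<open>g\<close>, then along \<open>b\<close> for \<open>pdir a f\<close>.\<close>
    define g where "g s = f (x + h *\<^sub>R b + s *\<^sub>R a) - f (x + s *\<^sub>R a)" for s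
    have g': "(g has_real_derivative pdir a f (x + h *\<^sub>R b + s *\<^sub>R a) - pdir a f (x + s *\<^sub>R a)) (at s)" for s
      unfolding g_def by (intro DERIV_diff line f)
    obtain s where s: "0 < s" "s < h"
      "g h - g 0 = h * (pdir a f (x + h *\<^sub>R b + s *\<^sub>R a) - pdir a f (x + s *\<^sub>R a))"
      using MVT2[OF h, of g "\<lambda>s. pdir a f (x + h *\<^sub>R b + s *\<^sub>R a) - pdir a f (x + s *\<^sub>R a)"] g' by auto
    obtain t where t: "0 < t" "t < h"
      "pdir a f ((x + s *\<^sub>R a) + h *\<^sub>R b) - pdir a f ((x + s *\<^sub>R a) + 0 *\<^sub>R b) = h * pdir b (pdir a f) ((x + s *\<^sub>R a) + t *\<^sub>R b)"
      using MVT2[OF h, of "\<lambda>t. pdir a f ((x + s *\<^sub>R a) + t *\<^sub>R b)" "\<lambda>t. pdir b (pdir a f) ((x + s *\<^sub>R a) + t *\<^sub>R b)"]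
        line[OF fa] by auto
    have "D h = g h - g 0" by (simp add: D_def g_def algebra_simps)
    also have "\<dots> = h * (h * pdir b (pdir a f) ((x + s *\<^sub>R a) + t *\<^sub>R b))"
      using s(3) t(3) by (simp add: algebra_simps)
    finally show ?thesis using s t h
      by (intro exI[of _ s] exI[of _ t]) (simp add: power2_eq_square)
  qed
  have "((\<lambda>h. D h / h\<^sup>2) \<longlongrightarrow> pdir b (pdir a f) x) (at_right 0)"
  proof (rule tendstoI)
    fix e :: real assume "e > 0"
    then obtain d where d: "d > 0" "\<And>y. dist y x < d \<Longrightarrow> dist (pdir b (pdir a f) y) (pdir b (pdir a f) x) < e"
      using cont by (auto simp: continuous_at_eps_delta)
    \<comment> \<open>The summand 1 keeps \<open>N\<close> positive even for zero directions and
      makes the bound h * N strict.\<close>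
    define N where "N = norm a + norm b + 1"
    have N: "N > 0" by (simp add: N_def add_nonneg_pos)
    have "dist (D h / h\<^sup>2) (pdir b (pdir a f) x) < e" if h: "0 < h" "h < d / N" for h
    proof -
      obtain s t where st: "0 < s" "s < h" "0 < t" "t < h"
        and eq: "D h / h\<^sup>2 = pdir b (pdir a f) (x + s *\<^sub>R a + t *\<^sub>R b)" using ex[OF h(1)] by blast
      have "dist (x + s *\<^sub>R a + t *\<^sub>R b) x = norm (s *\<^sub>R a + t *\<^sub>R b)" by (simp add: dist_norm algebra_simps)
      also have "\<dots> \<le> s * norm a + t * norm b" using st by (intro norm_triangle_le) auto
      also have "\<dots> \<le> h * norm a + h * norm b" using st by (intro add_mono mult_right_mono) auto
      also have "\<dots> < h * N" using h(1) by (simp add: N_def algebra_simps)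
      also have "\<dots> < d" using h N by (simp add: field_simps)
      finally show ?thesis unfolding eq by (rule d(2))
    qed
    moreover have "eventually (\<lambda>h. h \<in> {0<..<d / N}) (at_right 0)"
      using d N by (intro eventually_at_right_real) auto
    ultimately show "eventually (\<lambda>h. dist (D h / h\<^sup>2) (pdir b (pdir a f) x) < e) (at_right 0)"
      by (auto elim: eventually_mono)
  qed
  then show ?thesis by (simp add: D_def)
qed

text \<open>Schwarz's theorem: both mixed derivatives are limits of one and the same second
  difference quotient.\<close>

lemma pdir_commute:
  fixes f :: "'a::euclidean_space \<Rightarrow> real"
  assumes f: "smooth_fun f" and ab: "a \<in> Basis" "b \<in> Basis"
  shows "pdir a (pdir b f) = pdir b (pdir a f)"
proof
  fix x
  have cont: "isCont (pdir c (pdir d f)) x" if "c \<in> Basis" "d \<in> Basis" for c d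
    using smooth_fun_continuous[OF smooth_fun_pdir[OF smooth_fun_pdir[OF f that(2)] that(1)], of UNIV]
    by (simp add: continuous_on_eq_continuous_at)
  have 1: "((\<lambda>h. (f (x + h *\<^sub>R a + h *\<^sub>R b) - f (x + h *\<^sub>R a) - f (x + h *\<^sub>R b) + f x) / h\<^sup>2)
           \<longlongrightarrow> pdir b (pdir a f) x) (at_right 0)"
    by (intro second_difference_tendsto smooth_fun_differentiable smooth_fun_pdir f ab cont)
  have 2: "((\<lambda>h. (f (x + h *\<^sub>R b + h *\<^sub>R a) - f (x + h *\<^sub>R b) - f (x + h *\<^sub>R a) + f x) / h\<^sup>2)
           \<longlongrightarrow> pdir a (pdir b f) x) (at_right 0)"
    by (intro second_difference_tendsto smooth_fun_differentiable smooth_fun_pdir f ab cont)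
  have "(\<lambda>h. (f (x + h *\<^sub>R b + h *\<^sub>R a) - f (x + h *\<^sub>R b) - f (x + h *\<^sub>R a) + f x) / h\<^sup>2)
     = (\<lambda>h. (f (x + h *\<^sub>R a + h *\<^sub>R b) - f (x + h *\<^sub>R a) - f (x + h *\<^sub>R b) + f x) / h\<^sup>2)"
    by (simp add: algebra_simps)
  with 2 show "pdir a (pdir b f) x = pdir b (pdir a f) x"
    using tendsto_unique[OF _ _ 1] by simp
qed

lemma smooth_fun_dirderiv: "smooth_fun f \<Longrightarrow> set bs \<subseteq> Basis \<Longrightarrow> smooth_fun (dirderiv bs f)"
  by (induction bs) (auto intro: smooth_fun_pdir)

lemma dirderiv_pdir_commute:
  assumes "smooth_fun f" "b \<in> Basis" "set bs \<subseteq> Basis"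
  shows "dirderiv bs (pdir b f) = pdir b (dirderiv bs f)"
  using assms(3)
proof (induction bs)
  case (Cons a bs)
  then show ?case using pdir_commute[OF smooth_fun_dirderiv[OF assms(1), of bs], of a b] assms by simp
qed simp

text \<open>In the induction the head \<open>b\<close> of the first list is located inside
  \<open>cs\<close> and commuted outwards past the entries \<open>xs\<close> in front of it.\<close>

lemma dirderiv_mset_cong:
  assumes "smooth_fun f" "set bs \<subseteq> Basis" "mset bs = mset cs"
  shows "dirderiv bs f = dirderiv cs f"
  using assms(2,3)
proof (induction bs arbitrary: cs)
  case (Cons b bs)
  then have "b \<in> set cs" by (metis list.set_intros(1) set_mset_mset)
  then obtain xs ys where cs: "cs = xs @ b # ys" by (meson split_list)
  then have "mset bs = mset (xs @ ys)" using Cons.prems by simp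
  then have IH: "dirderiv bs f = dirderiv (xs @ ys) f" using Cons by auto
  have sub: "set cs \<subseteq> Basis" using Cons.prems by (metis set_mset_mset)
  have "dirderiv cs f = dirderiv xs (pdir b (dirderiv ys f))" by (simp add: cs dirderiv_append)
  also have "\<dots> = pdir b (dirderiv xs (dirderiv ys f))"
    using sub cs by (intro dirderiv_pdir_commute smooth_fun_dirderiv assms) auto
  finally show ?case using IH by (simp add: dirderiv_append)
qed simp

section \<open>Multi-index derivatives as iterated partial derivatives\<close>

text \<open>Removes the choice hidden in \<open>Dmi\<close>: two lists of basis vectors with the
  same counts have the same multiset, and the order of differentiation is immaterial for smooth
  functions.\<close>

lemma Dmi_eq_dirderiv:
  fixes f :: "'a::euclidean_space \<Rightarrow> real"
  assumes "smooth_fun f" "set bs \<subseteq> Basis" "\<And>b. b \<in> Basis \<Longrightarrow> count_list bs b = \<beta> b"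
  shows "Dmi \<beta> f = dirderiv bs f"
proof -
  define cs where "cs = (SOME bs. set bs \<subseteq> Basis \<and> (\<forall>b\<in>Basis. count_list bs b = \<beta> b))"
  have cs: "set cs \<subseteq> Basis \<and> (\<forall>b\<in>Basis. count_list cs b = \<beta> b)"
    unfolding cs_def by (rule someI[of _ bs]) (use assms in auto)
  have "mset cs = mset bs"
  proof (rule multiset_eqI)
    fix x show "count (mset cs) x = count (mset bs) x"
    proof (cases "x \<in> Basis")
      case True
      then show ?thesis using cs assms(3) by (simp add: count_mset)
    next
      case False
      then show ?thesis using cs assms(2) by (metis count_mset_0_iff subsetD)
    qed
  qed
  then show ?thesis
    unfolding Dmi_def cs_def[symmetric] using dirderiv_mset_cong[OF assms(1)] cs by blast
qed

lemma ex_list_count: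
  obtains bs :: "'a::euclidean_space list" where "set bs \<subseteq> Basis" "\<And>b. b \<in> Basis \<Longrightarrow> count_list bs b = \<beta> b"
proof -
  define M where "M = (\<Sum>b\<in>(Basis::'a set). replicate_mset (\<beta> b) b)"
  obtain bs where bs: "mset bs = M" using ex_mset by blast
  have c: "count_list bs b = (\<Sum>c\<in>Basis. if c = b then \<beta> c else 0)" for b
    by (simp add: count_mset[symmetric] bs M_def count_sum)
  then have "count_list bs b = (if b \<in> Basis then \<beta> b else 0)" for b by simp
  then show ?thesis using that[of bs] by (metis count_list_0_iff subsetI)
qed

lemma Dmi_zero: "Dmi (\<lambda>_. 0) f = f"
proof -
  have "bs = []" if "set bs \<subseteq> Basis \<and> (\<forall>b\<in>Basis. count_list bs b = 0)" for bs :: "'a list"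
    using that by (cases bs) auto
  then have "(SOME bs::'a list. set bs \<subseteq> Basis \<and> (\<forall>b\<in>Basis. count_list bs b = 0)) = []"
    by (intro some_equality) auto
  then show ?thesis by (simp add: Dmi_def)
qed

text \<open>Testing with a partial derivative raises the multi-index by one. This is what makes the
  members of a family of weak derivatives of f weak derivatives of each other.\<close>

lemma Dmi_pdir:
  assumes "smooth_fun f" "i \<in> Basis"
  shows "Dmi \<beta> (pdir i f) = Dmi (\<beta>(i := Suc (\<beta> i))) f"
proof -
  obtain bs :: "'a list" where bs: "set bs \<subseteq> Basis" "\<And>b. b \<in> Basis \<Longrightarrow> count_list bs b = \<beta> b"
    using ex_list_count by blast
  have "Dmi \<beta> (pdir i f) = dirderiv bs (pdir i f)"
    by (rule Dmi_eq_dirderiv) (auto intro: bs(2) smooth_fun_pdir assms bs(1)[THEN subsetD])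
  also have "\<dots> = dirderiv (bs @ [i]) f" by (simp add: dirderiv_append)
  also have "\<dots> = Dmi (\<beta>(i := Suc (\<beta> i))) f"
    by (rule Dmi_eq_dirderiv[symmetric]) (use bs assms in auto)
  finally show ?thesis .
qed

section \<open>Supports, derivatives and bounds of test functions\<close>

lemma closure_support_pdir:
  "closure {x. pdir b f x \<noteq> 0} \<subseteq> closure {x. f x \<noteq> 0}"
proof (rule closure_minimal)
  show "{x. pdir b f x \<noteq> 0} \<subseteq> closure {x. f x \<noteq> 0}"
  proof (rule ccontr)
    assume "\<not> {x. pdir b f x \<noteq> 0} \<subseteq> closure {x. f x \<noteq> 0}"
    then obtain x where x: "pdir b f x \<noteq> 0" "x \<in> - closure {x. f x \<noteq> 0}" by auto
    have "(f has_derivative (\<lambda>_. 0)) (at x)"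
    proof (rule has_derivative_transform_within_open)
      show "((\<lambda>_. 0) has_derivative (\<lambda>_. 0)) (at x)" by simp
      show "0 = f y" if "y \<in> - closure {x. f x \<noteq> 0}" for y
        using that closure_subset[of "{x. f x \<noteq> 0}"] by auto
    qed (use x in auto)
    then show False using pdir_eq[of f "\<lambda>_. 0" x b] x(1) by simp
  qed
qed simp

lemma test_funI:
  assumes "smooth_fun f" "compact K" "\<And>x. f x \<noteq> 0 \<Longrightarrow> x \<in> K" "K \<subseteq> U"
  shows "test_fun U f"
proof -
  have "closure {x. f x \<noteq> 0} \<subseteq> K"
    using assms by (intro closure_minimal) (auto intro: compact_imp_closed)
  moreover from this have "compact (K \<inter> closure {x. f x \<noteq> 0})"
    using assms by (intro compact_Int_closed) auto
  ultimately show ?thesis using assms unfolding test_fun_def by (auto simp: inf.absorb2)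
qed

lemma test_fun_pdir:
  assumes "test_fun U f" "b \<in> Basis"
  shows "test_fun U (pdir b f)"
proof (rule test_funI)
  show "smooth_fun (pdir b f)" using assms by (simp add: test_fun_def smooth_fun_pdir)
  show "x \<in> closure {x. f x \<noteq> 0}" if "pdir b f x \<noteq> 0" for x
    using that closure_support_pdir[of b f] closure_subset[of "{x. pdir b f x \<noteq> 0}"] by auto
qed (use assms in \<open>auto simp: test_fun_def\<close>)

lemma test_fun_mono: "test_fun U f \<Longrightarrow> U \<subseteq> V \<Longrightarrow> test_fun V f"
  by (auto simp: test_fun_def)

lemma test_fun_eq_0: "test_fun U f \<Longrightarrow> x \<notin> U \<Longrightarrow> f x = 0"
  using closure_subset[of "{x. f x \<noteq> 0}"] by (auto simp: test_fun_def)

lemma test_fun_bounded: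
  assumes "test_fun U f" obtains C where "\<And>x. \<bar>f x\<bar> \<le> C" "C \<ge> 0"
proof -
  let ?K = "closure {x. f x \<noteq> 0}"
  have "compact (f ` ?K)"
    using assms by (intro compact_continuous_image smooth_fun_continuous) (auto simp: test_fun_def)
  then obtain C where C: "\<And>y. y \<in> f ` ?K \<Longrightarrow> \<bar>y\<bar> \<le> C"
    by (meson compact_imp_bounded bounded_real)
  have "\<bar>f x\<bar> \<le> max C 0" for x
  proof (cases "f x = 0")
    case False
    then have "x \<in> ?K" using closure_subset[of "{x. f x \<noteq> 0}"] by auto
    then show ?thesis using C by fastforce
  qed auto
  then show ?thesis using that[of "max C 0"] by simp
qed

lemma test_fun_borel: "test_fun U f \<Longrightarrow> f \<in> borel_measurable borel"
  by (intro borel_measurable_continuous_onI smooth_fun_continuous) (simp add: test_fun_def)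

subsection \<open>Bump functions and the fundamental lemma\<close>

text \<open>The classical flat function exp (-1/s), continued by 0, with a polynomial in 1/s as an
  extra factor. The polynomial makes the family closed under differentiation; the bump functions
  only use \<open>flat 1\<close>.\<close>

definition flat :: "real poly \<Rightarrow> real \<Rightarrow> real" where
  "flat P s = (if s > 0 then poly P (1 / s) * exp (- (1 / s)) else 0)"

lemma poly_div_exp_tendsto_0: "((\<lambda>x. poly P x * exp (- x)) \<longlongrightarrow> 0) at_top" for P :: "real poly"
proof -
  have "((\<lambda>x. \<Sum>i\<le>degree P. coeff P i * (x ^ i / exp x)) \<longlongrightarrow> (\<Sum>i\<le>degree P. coeff P i * 0)) at_top"
    by (intro tendsto_sum tendsto_mult tendsto_const tendsto_power_div_exp_0)
  moreover have "(\<Sum>i\<le>degree P. coeff P i * (x ^ i / exp x)) = poly P x * exp (- x)" for x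
    by (simp add: poly_altdef sum_distrib_right exp_minus divide_inverse mult.assoc)
  ultimately show ?thesis by simp
qed

text \<open>With y = 1/s the derivative for s > 0 is y^2 (P y - P' y) exp (-y), which explains the
  factor \<open>[:0, 0, 1:]\<close>. At 0 the difference quotient has the same form with y P y in
  place of P y, and the exponential beats every polynomial.\<close>

lemma flat_has_derivative:
  "(flat P has_real_derivative flat ([:0, 0, 1:] * (P - pderiv P)) s) (at s)"
proof -
  consider "s > 0" | "s < 0" | "s = 0" by linarith
  then show ?thesis
  proof cases
    case 1
    have "((\<lambda>s. poly P (1 / s) * exp (- (1 / s))) has_real_derivative
        poly P (1 / s) * (exp (- (1 / s)) * (1 / s\<^sup>2)) + poly (pderiv P) (1 / s) * (- 1 / s\<^sup>2) * exp (- (1 / s))) (at s)"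
      using 1 by (auto intro!: derivative_eq_intros DERIV_chain2[OF poly_DERIV] simp: power2_eq_square field_simps)
    also have "poly P (1 / s) * (exp (- (1 / s)) * (1 / s\<^sup>2)) + poly (pderiv P) (1 / s) * (- 1 / s\<^sup>2) * exp (- (1 / s))
        = flat ([:0, 0, 1:] * (P - pderiv P)) s"
      using 1 by (simp add: flat_def power2_eq_square field_simps)
    finally show ?thesis
      by (rule has_field_derivative_transform_within_open[of _ _ _ "{0<..}"]) (use 1 in \<open>auto simp: flat_def\<close>)
  next
    case 2
    have "((\<lambda>_. 0) has_real_derivative 0) (at s)" by simp
    then have "(flat P has_real_derivative 0) (at s)"
      by (rule has_field_derivative_transform_within_open[of _ _ _ "{..<0}"]) (use 2 in \<open>auto simp: flat_def\<close>)
    then show ?thesis using 2 by (simp add: flat_def)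
  next
    case 3
    have "((\<lambda>h. poly ([:0, 1:] * P) (1 / h) * exp (- (1 / h))) \<longlongrightarrow> 0) (at_right 0)"
      using filterlim_compose[OF poly_div_exp_tendsto_0 filterlim_inverse_at_top_right, of "[:0, 1:] * P"]
      by (simp add: divide_inverse)
    then have R: "((\<lambda>h. flat P h / h) \<longlongrightarrow> 0) (at_right 0)"
      by (rule Lim_transform_eventually)
        (auto intro!: eventually_mono[OF eventually_at_right_less] simp: flat_def field_simps)
    have L: "((\<lambda>h. flat P h / h) \<longlongrightarrow> 0) (at_left 0)"
      by (rule Lim_transform_eventually[of "\<lambda>_. 0"])
        (auto simp: flat_def eventually_at_filter)
    have "((\<lambda>h. flat P h / h) \<longlongrightarrow> 0) (at 0)"
      using L R by (simp add: filterlim_split_at)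
    then show ?thesis using 3 by (simp add: DERIV_def flat_def)
  qed
qed

lemma smooth_fun_flat: "smooth_fun (\<lambda>x. flat P (x \<bullet> v + e))" for v :: "'a::euclidean_space"
proof (rule smooth_fun_coinduct[of _ "{\<lambda>x. a * flat P (x \<bullet> v + e) | a P. True}"])
  show "(\<lambda>x. flat P (x \<bullet> v + e)) \<in> {\<lambda>x. a * flat P (x \<bullet> v + e) | a P. True}"
    by (auto intro!: exI[of _ 1] exI[of _ P])
next
  fix h :: "'a \<Rightarrow> real" assume "h \<in> {\<lambda>x. a * flat P (x \<bullet> v + e) | a P. True}"
  then obtain a P where h: "h = (\<lambda>x. a * flat P (x \<bullet> v + e))" by blast
  let ?Q = "[:0, 0, 1:] * (P - pderiv P)"
  have *: "(h has_derivative (\<lambda>b. a * (b \<bullet> v) * flat ?Q (x \<bullet> v + e))) (at x)" for x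
  proof -
    have 1: "((\<lambda>x. x \<bullet> v + e) has_derivative (\<lambda>b. b \<bullet> v)) (at x)"
      by (auto intro!: derivative_eq_intros)
    have "((\<lambda>x. flat P (x \<bullet> v + e)) has_derivative (\<lambda>b. (b \<bullet> v) * flat ?Q (x \<bullet> v + e))) (at x)"
      by (rule DERIV_compose_FDERIV[OF flat_has_derivative 1])
    then have "(h has_derivative (\<lambda>b. a * ((b \<bullet> v) * flat ?Q (x \<bullet> v + e)))) (at x)"
      unfolding h by (rule has_derivative_mult_right)
    then show ?thesis by (simp add: mult.assoc)
  qed
  then show "h differentiable at x" for x by (auto simp: differentiable_def)
  fix b :: 'a
  have "pdir b h = (\<lambda>x. (a * (b \<bullet> v)) * flat ?Q (x \<bullet> v + e))"
    using pdir_eq[OF *] by (auto simp: fun_eq_iff)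
  then show "pdir b h \<in> {\<lambda>x. a * flat P (x \<bullet> v + e) | a P. True}" by blast
qed

text \<open>The factor \<open>Suc j\<close> drives each \<open>flat 1\<close> to 1 at points inside
  the box and leaves the value 0 outside. This gives smooth functions between 0 and 1 that converge
  pointwise to the indicator of the open box.\<close>

definition box_bump :: "'a::euclidean_space \<Rightarrow> 'a \<Rightarrow> nat \<Rightarrow> 'a \<Rightarrow> real" where
  "box_bump a b j x = (\<Prod>i\<in>Basis. flat 1 (real (Suc j) * ((x - a) \<bullet> i)) * flat 1 (real (Suc j) * ((b - x) \<bullet> i)))"

lemma flat_1_bounds: "0 \<le> flat 1 s" "flat 1 s \<le> 1"
  by (auto simp: flat_def)

lemma box_bump_bounds: "0 \<le> box_bump a b j x" "box_bump a b j x \<le> 1"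
  unfolding box_bump_def
  by (auto intro!: prod_nonneg prod_le_1 mult_nonneg_nonneg mult_le_one flat_1_bounds)

lemma box_bump_eq_0: "x \<notin> box a b \<Longrightarrow> box_bump a b j x = 0"
proof -
  assume "x \<notin> box a b"
  then obtain i where i: "i \<in> Basis" "\<not> (a \<bullet> i < x \<bullet> i \<and> x \<bullet> i < b \<bullet> i)" by (auto simp: mem_box)
  then have "flat 1 (real (Suc j) * ((x - a) \<bullet> i)) * flat 1 (real (Suc j) * ((b - x) \<bullet> i)) = 0"
    by (auto simp: flat_def inner_diff_left zero_less_mult_iff)
  then show ?thesis unfolding box_bump_def using i(1) by (auto intro!: prod_zero)
qed

lemma box_bump_tendsto: "(\<lambda>j. box_bump a b j x) \<longlonglongrightarrow> indicator (box a b) x"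
proof (cases "x \<in> box a b")
  case True
  have 1: "(\<lambda>j. flat 1 (real (Suc j) * s)) \<longlonglongrightarrow> 1" if "s > 0" for s
  proof -
    have "(\<lambda>j. exp (- (inverse (real (Suc j)) * (1 / s)))) \<longlonglongrightarrow> exp (- (0 * (1 / s)))"
      by (intro tendsto_intros LIMSEQ_inverse_real_of_nat)
    then show ?thesis using that by (simp add: flat_def divide_inverse mult.commute)
  qed
  have "(\<lambda>j. box_bump a b j x) \<longlonglongrightarrow> (\<Prod>i\<in>(Basis::'a set). 1 * 1)"
    unfolding box_bump_def using True
    by (intro tendsto_prod tendsto_mult 1) (auto simp: mem_box inner_diff_left)
  then show ?thesis using True by simp
qed (simp add: box_bump_eq_0)

lemma smooth_fun_box_bump: "smooth_fun (box_bump a b j)"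
proof -
  have "box_bump a b j = (\<lambda>x. \<Prod>i\<in>Basis. flat 1 (x \<bullet> (real (Suc j) *\<^sub>R i) + (- real (Suc j) * (a \<bullet> i))) *
     flat 1 (x \<bullet> (- real (Suc j) *\<^sub>R i) + real (Suc j) * (b \<bullet> i)))"
    unfolding box_bump_def fun_eq_iff
    by (intro allI prod.cong refl arg_cong2[of _ _ _ _ "(*)"] arg_cong[of _ _ "flat 1"]) (simp_all add: algebra_simps)
  then show ?thesis by (auto intro!: smooth_fun_prod smooth_fun_mult smooth_fun_flat simp del: inner_scaleR_right)
qed

lemma test_fun_box_bump: "cbox a b \<subseteq> U \<Longrightarrow> test_fun U (box_bump a b j)"
  by (rule test_funI[OF smooth_fun_box_bump compact_cbox[of a b]])
     (use box_bump_eq_0 box_subset_cbox in blast)+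

section \<open>Functions that vanish because their integrals do\<close>

text \<open>Dynkin argument: the Borel sets over which w integrates to 0 are closed under
  complements, by \<open>total\<close>, and under countable disjoint unions, by integrability. They
  contain the boxes, an intersection-stable generator.\<close>

lemma AE_eq_0_if_box_integrals_eq_0:
  fixes w :: "'a::euclidean_space \<Rightarrow> real"
  assumes w: "integrable lborel w" and zero: "\<And>a b. (\<integral>x. indicator (box a b) x * w x \<partial>lborel) = 0"
    and total: "(\<integral>x. w x \<partial>lborel) = 0"
  shows "AE x in lborel. w x = 0"
proof -
  have [measurable]: "w \<in> borel_measurable borel" using w by auto
  have wi: "integrable lborel (\<lambda>x. indicator A x * w x)" if "A \<in> sets borel" for A
    using integrable_mult_indicator[OF _ w, of A] that by (simp)
  have *: "(\<integral>x. indicator A x * w x \<partial>lborel) = 0" if "A \<in> sets borel" for A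
  proof -
    have A: "A \<in> sigma_sets UNIV (range (\<lambda>(a, b). box a b))"
      using that by (simp add: borel_eq_box)
    have I: "Int_stable (range (\<lambda>(a, b). box a b :: 'a set))"
      by (auto simp: Int_stable_def box_Int_box)
    have S: "range (\<lambda>(a, b). box a b :: 'a set) \<subseteq> Pow UNIV" by simp
    from I S A show ?thesis
    proof (induction A rule: sigma_sets_induct_disjoint)
      fix A assume "A \<in> range (\<lambda>(a, b). box a b :: 'a set)"
      then show "(\<integral>x. indicator A x * w x \<partial>lborel) = 0" using zero by auto
    next
      show "(\<integral>x. indicator {} x * w x \<partial>lborel) = 0" by simp
    next
      fix A :: "'a set" assume A: "A \<in> sigma_sets UNIV (range (\<lambda>(a, b). box a b))"
        "(\<integral>x. indicator A x * w x \<partial>lborel) = 0"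
      then have "A \<in> sets borel" by (simp add: borel_eq_box)
      moreover have "(\<integral>x. indicator (UNIV - A) x * w x \<partial>lborel) = (\<integral>x. w x - indicator A x * w x \<partial>lborel)"
        by (intro Bochner_Integration.integral_cong) (auto simp: indicator_def)
      ultimately show "(\<integral>x. indicator (UNIV - A) x * w x \<partial>lborel) = 0"
        using w wi A(2) total by simp
    next
      fix A :: "nat \<Rightarrow> 'a set"
      assume A: "disjoint_family A" "range A \<subseteq> sigma_sets UNIV (range (\<lambda>(a, b). box a b))"
        "\<And>i. (\<integral>x. indicator (A i) x * w x \<partial>lborel) = 0"
      have [measurable]: "A i \<in> sets borel" for i using A(2) by (auto simp: borel_eq_box)
      have "set_lebesgue_integral lborel (\<Union>i. A i) w = (\<Sum>i. set_lebesgue_integral lborel (A i) w)"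
      proof (rule lebesgue_integral_countable_add)
        show "A i \<inter> A j = {}" if "i \<noteq> j" for i j using A(1) that by (auto simp: disjoint_family_on_def)
        show "set_integrable lborel (\<Union> (range A)) w"
          unfolding set_integrable_def using wi[of "\<Union> (range A)"] by simp
      qed auto
      then show "(\<integral>x. indicator (\<Union>i. A i) x * w x \<partial>lborel) = 0"
        using A(3) by (simp add: set_lebesgue_integral_def)
    qed
  qed
  show ?thesis
    by (rule sigma_finite_measure.density_zero[OF sigma_finite_lborel w])
       (use * in \<open>auto simp: set_lebesgue_integral_def\<close>)
qed

text \<open>Dominated convergence along \<open>box_bump\<close> gives zero integrals over boxes
  whose closed box lies in U. Restricting w to one such box makes the Dynkin argument applicable,
  and countably many such boxes cover U.\<close>

lemma fundamental_lemma:
  fixes w :: "'a::euclidean_space \<Rightarrow> real"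
  assumes w: "integrable lborel w" and "open U"
    and zero: "\<And>\<phi>. test_fun U \<phi> \<Longrightarrow> (\<integral>x. w x * \<phi> x \<partial>lborel) = 0"
  shows "AE x in lborel. x \<in> U \<longrightarrow> w x = 0"
proof -
  have [measurable]: "w \<in> borel_measurable borel" using w by auto
  have box: "(\<integral>x. indicator (box a b) x * w x \<partial>lborel) = 0" if "cbox a b \<subseteq> U" for a b
  proof -
    have [measurable]: "box_bump a b j \<in> borel_measurable borel" for j
      by (intro borel_measurable_continuous_onI smooth_fun_continuous smooth_fun_box_bump)
    have "(\<lambda>j. \<integral>x. w x * box_bump a b j x \<partial>lborel) \<longlonglongrightarrow> (\<integral>x. indicator (box a b) x * w x \<partial>lborel)"
    proof (rule integral_dominated_convergence[where w="\<lambda>x. \<bar>w x\<bar>"])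
      show "AE x in lborel. (\<lambda>j. w x * box_bump a b j x) \<longlonglongrightarrow> indicator (box a b) x * w x"
        by (intro AE_I2) (simp add: mult.commute[of "indicator (box a b) _"] tendsto_mult box_bump_tendsto)
      show "AE x in lborel. norm (w x * box_bump a b j x) \<le> \<bar>w x\<bar>" for j
        by (intro AE_I2) (simp add: abs_mult box_bump_bounds mult_left_le)
    qed (use w in auto)
    moreover have "(\<integral>x. w x * box_bump a b j x \<partial>lborel) = 0" for j
      by (rule zero[OF test_fun_box_bump[OF that]])
    ultimately show ?thesis by (simp add: LIMSEQ_const_iff)
  qed
  have local: "AE x in lborel. x \<in> box a b \<longrightarrow> w x = 0" if "cbox a b \<subseteq> U" for a b
  proof -
    have "AE x in lborel. indicator (box a b) x * w x = 0"
    proof (rule AE_eq_0_if_box_integrals_eq_0)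
      show "integrable lborel (\<lambda>x. indicator (box a b) x * w x)"
        using integrable_mult_indicator[OF _ w, of "box a b"] by simp
      show "(\<integral>x. indicator (box a b) x * w x \<partial>lborel) = 0" by (rule box[OF that])
      fix c d
      obtain e f where ef: "box c d \<inter> box a b = box e f" by (auto simp: box_Int_box)
      have "(\<integral>x. indicator (box c d) x * (indicator (box a b) x * w x) \<partial>lborel) = (\<integral>x. indicator (box e f) x * w x \<partial>lborel)"
        unfolding ef[symmetric] by (simp add: indicator_inter_arith mult.assoc)
      also have "\<dots> = 0"
      \<comment> \<open>A degenerate closed box can be nonempty although the open box is empty, so
        the inclusion of closed boxes is obtained from closures in the nonempty case only.\<close>
      proof (cases "box e f = {}")
        case False
        moreover have sub: "box e f \<subseteq> box a b" using ef by auto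
        ultimately have "box a b \<noteq> {}" by blast
        with False closure_mono[OF sub] have "cbox e f \<subseteq> cbox a b" by (simp add: closure_box)
        then show ?thesis using that by (intro box) auto
      qed simp
      finally show "(\<integral>x. indicator (box c d) x * (indicator (box a b) x * w x) \<partial>lborel) = 0" .
    qed
    then show ?thesis by eventually_elim (auto simp: indicator_def split: if_splits)
  qed
  obtain D :: "'a set set" where D: "countable D" "\<Union>D = U" "\<And>X. X \<in> D \<Longrightarrow> \<exists>a b. X = box a b \<and> cbox a b \<subseteq> U"
  proof -
    have eq: "\<Union>{box a b | a b. cbox a b \<subseteq> U} = U"
    proof safe
      fix x assume "x \<in> U"
      then obtain a b where "cbox a b \<subseteq> U" "x \<in> box a b"
        using open_contains_cbox[OF \<open>open U\<close>] by metis
      then show "x \<in> \<Union>{box a b | a b. cbox a b \<subseteq> U}" by blast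
    qed (use box_subset_cbox in blast)
    obtain D where D: "D \<subseteq> {box a b | a b. cbox a b \<subseteq> U}" "countable D"
      "\<Union>D = \<Union>{box a b | a b. cbox a b \<subseteq> U}"
      by (rule Lindelof[of "{box a b | a b. cbox a b \<subseteq> U}"]) auto
    show thesis
    proof (rule that[of D])
      show "\<exists>a b. X = box a b \<and> cbox a b \<subseteq> U" if "X \<in> D" for X using D(1) that by auto
    qed (use D(2,3) eq in simp_all)
  qed
  have "AE x in lborel. \<forall>X\<in>D. x \<in> X \<longrightarrow> w x = 0"
  proof (subst AE_ball_countable[OF D(1)], intro ballI)
    fix X assume "X \<in> D"
    then show "AE x in lborel. x \<in> X \<longrightarrow> w x = 0" using D(3) local by blast
  qed
  then show ?thesis by eventually_elim (use D(2) in auto)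
qed

subsection \<open>Differences along dilations\<close>

lemma nn_integral_lborel_scaleR:
  fixes f :: "'a::euclidean_space \<Rightarrow> ennreal"
  assumes "c > 0" and [measurable]: "f \<in> borel_measurable borel"
  shows "(\<integral>\<^sup>+x. f x \<partial>lborel) = ennreal (c ^ DIM('a)) * (\<integral>\<^sup>+x. f (c *\<^sub>R x) \<partial>lborel)"
  using assms(1)
  by (subst lborel_affine[of c 0]) (auto simp: nn_integral_density nn_integral_distr nn_integral_cmult ennreal_power)

lemma integral_lborel_scaleR:
  fixes f :: "'a::euclidean_space \<Rightarrow> real"
  assumes "c > 0" and [measurable]: "f \<in> borel_measurable borel"
  shows "(\<integral>x. f x \<partial>lborel) = c ^ DIM('a) * (\<integral>x. f (c *\<^sub>R x) \<partial>lborel)"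
  using assms(1)
  by (subst lborel_affine[of c 0]) (auto simp: integral_density integral_distr ennreal_power)

lemma integrable_lborel_scaleR:
  fixes f :: "'a::euclidean_space \<Rightarrow> real"
  assumes "c > 0" and f: "integrable lborel f"
  shows "integrable lborel (\<lambda>x. f (c *\<^sub>R x))"
proof -
  have [measurable]: "f \<in> borel_measurable borel" using f by auto
  have "integrable (density (distr lborel borel (\<lambda>x::'a. 0 + c *\<^sub>R x)) (\<lambda>_. ennreal (c ^ DIM('a)))) f"
    using lborel_affine[of c "0::'a"] f assms(1) by (simp add: ennreal_power)
  then have "integrable lborel (\<lambda>x. c ^ DIM('a) * f (c *\<^sub>R x))"
    using assms(1) by (subst (asm) integrable_density) (auto simp: integrable_distr_eq)
  then show ?thesis using assms(1) by simp
qed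

text \<open>The parameter interval has finite length, so a bound on the L^1 norms that is uniform in
  the parameter c makes the integrand jointly integrable.\<close>

lemma slab_Fubini:
  fixes F :: "real \<Rightarrow> 'a::euclidean_space \<Rightarrow> real"
  assumes [measurable]: "(\<lambda>(c, x). F c x) \<in> borel_measurable (borel \<Otimes>\<^sub>M borel)"
    and F: "\<And>c. c \<in> {a..b} \<Longrightarrow> integrable lborel (F c)"
    and M: "\<And>c. c \<in> {a..b} \<Longrightarrow> (\<integral>x. \<bar>F c x\<bar> \<partial>lborel) \<le> M"
  shows "integrable lborel (\<lambda>x. \<integral>c. indicator {a..b} c * F c x \<partial>lborel)"
    and "(\<integral>c. indicator {a..b} c * (\<integral>x. F c x \<partial>lborel) \<partial>lborel)
       = (\<integral>x. \<integral>c. indicator {a..b} c * F c x \<partial>lborel \<partial>lborel)"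
proof -
  let ?G = "\<lambda>c x. indicator {a..b} c * F c x :: real"
  have meas: "(\<lambda>(c, x). ?G c x) \<in> borel_measurable (lborel \<Otimes>\<^sub>M lborel)"
    by measurable
  have G: "integrable (lborel \<Otimes>\<^sub>M lborel) (\<lambda>(c, x). ?G c x)"
  proof (rule lborel_pair.Fubini_integrable[OF meas])
    show "AE c in lborel. integrable lborel (\<lambda>x. (\<lambda>(c, x). ?G c x) (c, x))"
      by (intro AE_I2) (auto simp: indicator_def F)
    show "integrable lborel (\<lambda>c. \<integral>x. norm ((\<lambda>(c, x). ?G c x) (c, x)) \<partial>lborel)"
    proof (rule Bochner_Integration.integrable_bound)
      show "integrable lborel (\<lambda>c. M * indicator {a..b} c :: real)"
        by (intro integrable_mult_right integrable_real_indicator) (auto simp: emeasure_lborel_Icc_eq)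
      show "(\<lambda>c. \<integral>x. norm ((\<lambda>(c, x). ?G c x) (c, x)) \<partial>lborel) \<in> borel_measurable lborel"
        by measurable
      show "AE c in lborel. norm (\<integral>x. norm ((\<lambda>(c, x). ?G c x) (c, x)) \<partial>lborel) \<le> norm (M * indicator {a..b} c)"
      proof (intro AE_I2)
        fix c
        show "norm (\<integral>x. norm ((\<lambda>(c, x). ?G c x) (c, x)) \<partial>lborel) \<le> norm (M * indicator {a..b} c)"
          using M[of c] by (auto simp: indicator_def intro: order_trans[OF _ abs_ge_self])
      qed
    qed
  qed
  show "integrable lborel (\<lambda>x. \<integral>c. ?G c x \<partial>lborel)"
    using lborel_pair.integrable_snd[OF G] by simp
  have "(\<integral>c. indicator {a..b} c * (\<integral>x. F c x \<partial>lborel) \<partial>lborel) = (\<integral>c. \<integral>x. ?G c x \<partial>lborel \<partial>lborel)"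
    by simp
  also have "\<dots> = (\<integral>x. \<integral>c. ?G c x \<partial>lborel \<partial>lborel)"
    by (rule lborel_pair.Fubini_integral[OF G, symmetric])
  finally show "(\<integral>c. indicator {a..b} c * (\<integral>x. F c x \<partial>lborel) \<partial>lborel) = (\<integral>x. \<integral>c. ?G c x \<partial>lborel \<partial>lborel)" .
qed

lemma open_shell: "open {x::'a::euclidean_space. s < norm x \<and> norm x < R}"
  by (intro open_Collect_conj open_Collect_less continuous_intros)

text \<open>A factor c between 1/2 and 1 moves a support upwards in norm, and at most by a factor 2.
  Hence the shell for \<phi> ends at R/2 while the weak derivative is available up to R.\<close>

lemma test_fun_scaled:
  fixes \<phi> :: "'a::euclidean_space \<Rightarrow> real"
  assumes \<phi>: "test_fun {x. s < norm x \<and> norm x < R / 2} \<phi>" and c: "1/2 \<le> c" "c \<le> 1" and "s > 0"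
    and g: "smooth_fun g"
  shows "test_fun {x. s < norm x \<and> norm x < R} (\<lambda>x. g x * \<phi> (c *\<^sub>R x))"
proof -
  let ?K = "closure {x. \<phi> x \<noteq> 0}"
  have K: "compact ?K" "?K \<subseteq> {x. s < norm x \<and> norm x < R / 2}" and sm: "smooth_fun \<phi>"
    using \<phi> by (auto simp: test_fun_def)
  show ?thesis
  proof (rule test_funI)
    show "smooth_fun (\<lambda>x. g x * \<phi> (c *\<^sub>R x))" by (intro smooth_fun_mult g smooth_fun_scaleR_arg sm)
    show "compact ((\<lambda>x. (1/c) *\<^sub>R x) ` ?K)" by (intro compact_scaling K)
    show "x \<in> (\<lambda>x. (1/c) *\<^sub>R x) ` ?K" if "g x * \<phi> (c *\<^sub>R x) \<noteq> 0" for x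
    proof (rule image_eqI)
      show "x = (1/c) *\<^sub>R (c *\<^sub>R x)" using c by simp
      show "c *\<^sub>R x \<in> ?K" using that closure_subset[of "{x. \<phi> x \<noteq> 0}"] by auto
    qed
    show "(\<lambda>x. (1/c) *\<^sub>R x) ` ?K \<subseteq> {x. s < norm x \<and> norm x < R}"
    proof safe
      fix x assume "x \<in> ?K"
      then have x: "s < norm x" "norm x < R / 2" using K(2) by auto
      have "s * c \<le> s" using c \<open>s > 0\<close> by (simp add: mult_left_le)
      then show "s < norm ((1/c) *\<^sub>R x)" using x c by (simp add: field_simps)
      have "R / 2 \<le> R * c" using c x \<open>s > 0\<close> mult_left_mono[of "1/2" c R] by auto
      then show "norm ((1/c) *\<^sub>R x) < R" using x c by (simp add: field_simps)
    qed
  qed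
qed

text \<open>For smooth u with gradient v the integrand is the negative c-derivative of u (x / c), so
  the integral over [1/2, 1] equals u (2 x) - u x. Dilating by 1/c on this side corresponds to
  dilating a test function by c on the other.\<close>

definition dilation_mean :: "('a::euclidean_space \<Rightarrow> 'a \<Rightarrow> real) \<Rightarrow> 'a \<Rightarrow> real" where
  "dilation_mean v x = (\<integral>c. indicator {1/2..1} c * ((1 / c\<^sup>2) * (\<Sum>i\<in>Basis. v i ((1/c) *\<^sub>R x) * (x \<bullet> i))) \<partial>lborel)"

text \<open>Both sides are tested against \<open>\<phi>\<close>: since
  \<open>d/dc (c\<^sup>n \<phi> (c x)) = \<Sum>\<^sub>i \<partial>\<^sub>i (x\<^sub>i c\<^sup>n\<^sup>-\<^sup>1 \<phi> (c x))\<close>, integrating over \<open>c \<in> [1/2, 1]\<close> and moving the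
  derivatives onto \<open>u\<close> gives the identity without mollifying \<open>u\<close>.\<close>

lemma dilation_difference:
  fixes u :: "'a::euclidean_space \<Rightarrow> real" and v :: "'a \<Rightarrow> 'a \<Rightarrow> real"
  assumes s: "0 < s" and u: "integrable lborel u" and v: "\<And>i. i \<in> Basis \<Longrightarrow> integrable lborel (v i)"
    and weak: "\<And>i \<phi>. i \<in> Basis \<Longrightarrow> test_fun {x. s < norm x \<and> norm x < R} \<phi> \<Longrightarrow>
       (\<integral>x. u x * pdir i \<phi> x \<partial>lborel) = - (\<integral>x. v i x * \<phi> x \<partial>lborel)"
  shows "AE x in lborel. s < norm x \<and> norm x < R / 2 \<longrightarrow> u (2 *\<^sub>R x) - u x = dilation_mean v x"
proof -
  let ?n = "DIM('a)" and ?I = "{1/2..1::real}"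
  have [measurable]: "u \<in> borel_measurable borel" using u by auto
  have [measurable]: "i \<in> Basis \<Longrightarrow> v i \<in> borel_measurable borel" for i using v by auto
  define B where "B = {x::'a. norm x < R}"
  have [measurable]: "B \<in> sets borel" unfolding B_def by measurable
  \<comment> \<open>The cutoff to \<open>B\<close> bounds the factors x \<bullet> i and thereby
    makes every slice integrable. It is invisible to the test functions used below, whose supports
    lie in \<open>B\<close>.\<close>
  define F where "F c x = (1 / c\<^sup>2) * (\<Sum>i\<in>Basis. v i ((1/c) *\<^sub>R x) * (x \<bullet> i)) * indicator B x" for c x
  have F_meas [measurable]: "(\<lambda>(c, x). F c x) \<in> borel_measurable (borel \<Otimes>\<^sub>M borel)"
    unfolding F_def by measurable
  \<comment> \<open>The dilation multiplies the L^1 norm by c^n, which is at most 1; this yields a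
    bound uniform in c.\<close>
  have v_sc: "integrable lborel (\<lambda>x. v i ((1/c) *\<^sub>R x))"
    "(\<integral>x. \<bar>v i ((1/c) *\<^sub>R x)\<bar> \<partial>lborel) \<le> (\<integral>x. \<bar>v i x\<bar> \<partial>lborel)" if "c \<in> ?I" "i \<in> Basis" for c i
  proof -
    have c: "0 < 1 / c" "1 \<le> 1 / c" using that by (auto simp: field_simps)
    show "integrable lborel (\<lambda>x. v i ((1/c) *\<^sub>R x))" using integrable_lborel_scaleR[OF c(1) v] that by simp
    have "(\<integral>x. \<bar>v i x\<bar> \<partial>lborel) = (1/c) ^ ?n * (\<integral>x. \<bar>v i ((1/c) *\<^sub>R x)\<bar> \<partial>lborel)"
      by (rule integral_lborel_scaleR[OF c(1)]) (use that in measurable)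
    moreover have "1 \<le> (1/c) ^ ?n" by (rule one_le_power[OF c(2)])
    ultimately show "(\<integral>x. \<bar>v i ((1/c) *\<^sub>R x)\<bar> \<partial>lborel) \<le> (\<integral>x. \<bar>v i x\<bar> \<partial>lborel)"
      using mult_right_mono[of 1 "(1/c) ^ ?n" "\<integral>x. \<bar>v i ((1/c) *\<^sub>R x)\<bar> \<partial>lborel"] by simp
  qed
  \<comment> \<open>No sign of R is assumed; the maximum keeps the bounds nonnegative.\<close>
  define R' where "R' = max R 0"
  have F_bd: "\<bar>F c x\<bar> \<le> 4 * (\<Sum>i\<in>Basis. \<bar>v i ((1/c) *\<^sub>R x)\<bar> * R')" if "c \<in> ?I" for c x
  proof (cases "x \<in> B")
    case True
    have "\<bar>\<Sum>i\<in>Basis. v i ((1/c) *\<^sub>R x) * (x \<bullet> i)\<bar> \<le> (\<Sum>i\<in>Basis. \<bar>v i ((1/c) *\<^sub>R x)\<bar> * R')"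
      using True by (intro sum_abs[THEN order_trans] sum_mono)
        (auto simp: abs_mult B_def R'_def intro!: mult_left_mono Basis_le_norm[THEN order_trans])
    moreover have "1 / c\<^sup>2 \<le> 4"
      using that power_mono[of "1/2" c 2] by (auto simp: field_simps power2_eq_square)
    ultimately have "\<bar>1 / c\<^sup>2\<bar> * \<bar>\<Sum>i\<in>Basis. v i ((1/c) *\<^sub>R x) * (x \<bullet> i)\<bar> \<le> 4 * (\<Sum>i\<in>Basis. \<bar>v i ((1/c) *\<^sub>R x)\<bar> * R')"
      by (intro mult_mono) auto
    then show ?thesis using True unfolding F_def abs_mult by simp
  qed (auto simp: F_def R'_def intro!: sum_nonneg)
  have dom: "integrable lborel (\<lambda>x. 4 * (\<Sum>i\<in>Basis. \<bar>v i ((1/c) *\<^sub>R x)\<bar> * R'))" if "c \<in> ?I" for c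
    using v_sc(1)[OF that] by (intro integrable_mult_right Bochner_Integration.integrable_sum integrable_mult_left integrable_abs)
  have F_int: "integrable lborel (F c)" if "c \<in> ?I" for c
  proof (rule Bochner_Integration.integrable_bound[OF dom[OF that]])
    show "F c \<in> borel_measurable lborel" unfolding F_def by measurable
    show "AE x in lborel. norm (F c x) \<le> norm (4 * (\<Sum>i\<in>Basis. \<bar>v i ((1/c) *\<^sub>R x)\<bar> * R'))"
      using F_bd[OF that] by (intro AE_I2) (auto intro: order_trans[OF _ abs_ge_self])
  qed
  define M where "M = 4 * (\<Sum>i\<in>Basis. (\<integral>x. \<bar>v i x\<bar> \<partial>lborel) * R')"
  have F_M: "(\<integral>x. \<bar>F c x\<bar> \<partial>lborel) \<le> M" if "c \<in> ?I" for c
  proof -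
    have "(\<integral>x. \<bar>F c x\<bar> \<partial>lborel) \<le> (\<integral>x. 4 * (\<Sum>i\<in>Basis. \<bar>v i ((1/c) *\<^sub>R x)\<bar> * R') \<partial>lborel)"
      by (intro integral_mono integrable_abs F_int dom F_bd that)
    also have "\<dots> = 4 * (\<Sum>i\<in>Basis. (\<integral>x. \<bar>v i ((1/c) *\<^sub>R x)\<bar> \<partial>lborel) * R')"
      using v_sc(1)[OF that] by (subst integral_mult_right_zero, subst Bochner_Integration.integral_sum) auto
    also have "\<dots> \<le> M"
      unfolding M_def using v_sc(2)[OF that] by (intro mult_left_mono sum_mono mult_right_mono) (auto simp: R'_def)
    finally show ?thesis .
  qed
  define H where "H x = (\<integral>c. indicator ?I c * F c x \<partial>lborel)" for x
  have H_eq: "H x = dilation_mean v x" if "x \<in> B" for x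
    using that by (simp add: H_def F_def dilation_mean_def)
  have H_int: "integrable lborel H"
    unfolding H_def by (rule slab_Fubini(1)[OF F_meas F_int F_M])
  have u2: "integrable lborel (\<lambda>x. u (2 *\<^sub>R x))" by (rule integrable_lborel_scaleR[OF _ u]) simp
  have "AE x in lborel. x \<in> {x. s < norm x \<and> norm x < R / 2} \<longrightarrow> u (2 *\<^sub>R x) - u x - H x = 0"
  proof (rule fundamental_lemma)
    show "integrable lborel (\<lambda>x. u (2 *\<^sub>R x) - u x - H x)" using u u2 H_int by auto
    show "open {x::'a. s < norm x \<and> norm x < R / 2}" by (rule open_shell)
    fix \<phi> :: "'a \<Rightarrow> real" assume \<phi>: "test_fun {x. s < norm x \<and> norm x < R / 2} \<phi>"
    have sm: "smooth_fun \<phi>" using \<phi> by (simp add: test_fun_def)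
    have [measurable]: "\<phi> \<in> borel_measurable borel" by (rule test_fun_borel[OF \<phi>])
    have d\<phi>: "test_fun {x. s < norm x \<and> norm x < R / 2} (pdir i \<phi>)" if "i \<in> Basis" for i
      by (rule test_fun_pdir[OF \<phi> that])
    have d\<phi>_meas [measurable]: "i \<in> Basis \<Longrightarrow> pdir i \<phi> \<in> borel_measurable borel" for i
      by (rule test_fun_borel[OF d\<phi>])
    obtain C0 where C0: "\<And>x. \<bar>\<phi> x\<bar> \<le> C0" "C0 \<ge> 0" using test_fun_bounded[OF \<phi>] by blast
    have "\<exists>C. \<forall>x. \<bar>pdir i \<phi> x\<bar> \<le> C" if "i \<in> Basis" for i using test_fun_bounded[OF d\<phi>[OF that]] by metis
    then obtain C1 where C1: "\<And>i x. i \<in> Basis \<Longrightarrow> \<bar>pdir i \<phi> x\<bar> \<le> C1 i" by metis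
    \<comment> \<open>\<open>K\<close> is the c-derivative of c^n \<phi> (c x) and the
      \<open>\<psi> c i\<close> are the components of a vector field with divergence
      \<open>K\<close>. Without the Jacobian c^n the derivative would not be a divergence.\<close>
    define K where "K c x = real ?n * c ^ (?n - 1) * \<phi> (c *\<^sub>R x) + c ^ ?n * (\<Sum>i\<in>Basis. (x \<bullet> i) * pdir i \<phi> (c *\<^sub>R x))" for c x
    define \<psi> where "\<psi> c i x = (c ^ (?n - 1) * (x \<bullet> i)) * \<phi> (c *\<^sub>R x)" for c i x
    have K_meas [measurable]: "(\<lambda>(c, x). K c x) \<in> borel_measurable (borel \<Otimes>\<^sub>M borel)"
      unfolding K_def by measurable
    have K_deriv: "((\<lambda>c. c ^ ?n * \<phi> (c *\<^sub>R x)) has_real_derivative K c x) (at c)" for c x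
    proof -
      have 1: "(\<phi> has_derivative (\<lambda>b. pdir b \<phi> (c *\<^sub>R x))) (at (c *\<^sub>R x))"
        by (rule has_derivative_pdir[OF smooth_fun_differentiable[OF sm]])
      have "((\<lambda>c. \<phi> (c *\<^sub>R x)) has_derivative (\<lambda>h. pdir (h *\<^sub>R x) \<phi> (c *\<^sub>R x))) (at c)"
        by (rule has_derivative_compose[of "\<lambda>c. c *\<^sub>R x", OF _ 1]) (auto intro!: derivative_eq_intros)
      moreover have "pdir (h *\<^sub>R x) \<phi> (c *\<^sub>R x) = (\<Sum>i\<in>Basis. (x \<bullet> i) * pdir i \<phi> (c *\<^sub>R x)) * h" for h
      proof -
        have lin: "linear (\<lambda>b. pdir b \<phi> (c *\<^sub>R x))" by (rule has_derivative_linear[OF 1])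
        have "pdir x \<phi> (c *\<^sub>R x) = pdir (\<Sum>i\<in>Basis. (x \<bullet> i) *\<^sub>R i) \<phi> (c *\<^sub>R x)"
          by (simp add: euclidean_representation)
        also have "\<dots> = (\<Sum>i\<in>Basis. (x \<bullet> i) * pdir i \<phi> (c *\<^sub>R x))"
          unfolding linear_sum[OF lin] using linear_scale[OF lin] by simp
        finally show ?thesis using linear_scale[OF lin, of h x] by simp
      qed
      ultimately have "((\<lambda>c. \<phi> (c *\<^sub>R x)) has_real_derivative (\<Sum>i\<in>Basis. (x \<bullet> i) * pdir i \<phi> (c *\<^sub>R x))) (at c)"
        by (simp add: has_field_derivative_def mult_commute_abs)
      from DERIV_mult[OF DERIV_pow[of ?n c] this] show ?thesis
        by (simp add: K_def algebra_simps)
    qed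
    have K_cont: "isCont (\<lambda>c. K c x) c" for c x
      unfolding K_def
      by (intro continuous_intros isCont_o2[of _ "\<lambda>c. c *\<^sub>R x"])
        (auto intro!: differentiable_imp_continuous_within smooth_fun_differentiable sm smooth_fun_pdir)
    \<comment> \<open>The fundamental theorem of calculus in c alone; the two end points give the
      values at x and x / 2.\<close>
    have K_int: "(\<integral>c. indicator ?I c * K c x \<partial>lborel) = \<phi> x - (1/2) ^ ?n * \<phi> ((1/2) *\<^sub>R x)" for x
      using integral_FTC_Icc_real[of "1/2" 1 "\<lambda>c. c ^ ?n * \<phi> (c *\<^sub>R x)" "\<lambda>c. K c x"] K_deriv K_cont
      by (simp add: mult.commute)
    have \<psi>: "test_fun {x. s < norm x \<and> norm x < R} (\<psi> c i)" if "c \<in> ?I" "i \<in> Basis" for c i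
      unfolding \<psi>_def using that s
      by (intro test_fun_scaled[OF \<phi>] smooth_fun_mult smooth_fun_const smooth_fun_inner) auto
    have K_\<psi>: "K c x = (\<Sum>i\<in>Basis. pdir i (\<psi> c i) x)" for c x
    proof -
      have "pdir i (\<psi> c i) x = c ^ (?n - 1) * \<phi> (c *\<^sub>R x) + c ^ ?n * ((x \<bullet> i) * pdir i \<phi> (c *\<^sub>R x))"
        if i: "i \<in> Basis" for i
      proof -
        have "(\<psi> c i has_derivative (\<lambda>b. (c ^ (?n - 1) * (x \<bullet> i)) * (c * pdir b \<phi> (c *\<^sub>R x)) + (c ^ (?n - 1) * (b \<bullet> i)) * \<phi> (c *\<^sub>R x))) (at x)"
          unfolding \<psi>_def
          by (intro has_derivative_mult has_derivative_mult_right has_derivative_scaleR_arg smooth_fun_differentiable sm has_derivative_inner_left has_derivative_ident)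
        from pdir_eq[OF this, of i] show ?thesis
          using i by (simp add: inner_same_Basis power_eq_if[of c ?n] algebra_simps)
      qed
      then show ?thesis by (simp add: K_def sum.distrib sum_distrib_left mult.assoc)
    qed
    have d\<psi>_bd: "\<exists>C. \<forall>x. \<bar>pdir i (\<psi> c i) x\<bar> \<le> C" if "c \<in> ?I" "i \<in> Basis" for c i
      using test_fun_bounded[OF test_fun_pdir[OF \<psi>[OF that] that(2)]] by metis
    have mult_bdd: "integrable lborel (\<lambda>x. g x * h x)"
      if "integrable lborel g" "h \<in> borel_measurable borel" "\<And>x. \<bar>h x\<bar> \<le> C" for g h :: "'a \<Rightarrow> real" and C
    proof (rule Bochner_Integration.integrable_bound[of _ "\<lambda>x. g x * C"])
      show "AE x in lborel. norm (g x * h x) \<le> norm (g x * C)"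
        using that(3) by (intro AE_I2) (auto simp: abs_mult intro!: mult_left_mono intro: order_trans[OF _ abs_ge_self])
    qed (use that in auto)
    have u_d\<psi>: "integrable lborel (\<lambda>x. u x * pdir i (\<psi> c i) x)" if "c \<in> ?I" "i \<in> Basis" for c i
      using d\<psi>_bd[OF that] test_fun_borel[OF test_fun_pdir[OF \<psi>[OF that] that(2)]] mult_bdd[OF u] by metis
    have uK: "integrable lborel (\<lambda>x. u x * K c x)" if "c \<in> ?I" for c
      unfolding K_\<psi> sum_distrib_left using u_d\<psi>[OF that] by (intro Bochner_Integration.integrable_sum)
    \<comment> \<open>Substituting x / c for x transfers the dilation from \<phi> to v. The Jacobian
      c^(-n), the power c^(n - 1) in \<psi> and the coordinate x \<bullet> i / c combine to the
      factor 1 / c^2.\<close>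
    have v_\<psi>: "(\<integral>x. v i x * \<psi> c i x \<partial>lborel) = (\<integral>x. (1 / c\<^sup>2) * (v i ((1/c) *\<^sub>R x) * (x \<bullet> i)) * \<phi> x \<partial>lborel)"
      if c: "c \<in> ?I" and i: "i \<in> Basis" for c i
    proof -
      have c0: "c > 0" using c by auto
      have [measurable]: "\<psi> c i \<in> borel_measurable borel" by (rule test_fun_borel[OF \<psi>[OF that]])
      have "(\<integral>x. v i x * \<psi> c i x \<partial>lborel) = (1/c) ^ ?n * (\<integral>x. v i ((1/c) *\<^sub>R x) * \<psi> c i ((1/c) *\<^sub>R x) \<partial>lborel)"
        by (rule integral_lborel_scaleR) (use c0 i in auto)
      also have "\<dots> = (\<integral>x. (1/c) ^ ?n * (v i ((1/c) *\<^sub>R x) * \<psi> c i ((1/c) *\<^sub>R x)) \<partial>lborel)" by simp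
      also have "\<dots> = (\<integral>x. (1 / c\<^sup>2) * (v i ((1/c) *\<^sub>R x) * (x \<bullet> i)) * \<phi> x \<partial>lborel)"
      proof (intro Bochner_Integration.integral_cong refl)
        fix x
        have "(1/c) ^ ?n * (c ^ (?n - 1) * (1 / c)) = 1 / c\<^sup>2"
          using c0 by (simp add: power_eq_if[of c ?n] power_one_over power2_eq_square)
        then have "((1/c) ^ ?n * (c ^ (?n - 1) * (1 / c))) * (v i ((1/c) *\<^sub>R x) * (x \<bullet> i) * \<phi> x) = (1 / c\<^sup>2) * (v i ((1/c) *\<^sub>R x) * (x \<bullet> i) * \<phi> x)"
          by simp
        then show "(1/c) ^ ?n * (v i ((1/c) *\<^sub>R x) * \<psi> c i ((1/c) *\<^sub>R x)) = (1 / c\<^sup>2) * (v i ((1/c) *\<^sub>R x) * (x \<bullet> i)) * \<phi> x"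
          using c0 by (simp add: \<psi>_def mult_ac)
      qed
      finally show ?thesis .
    qed
    have F\<phi>: "(\<Sum>i\<in>Basis. (1 / c\<^sup>2) * (v i ((1/c) *\<^sub>R x) * (x \<bullet> i)) * \<phi> x) = F c x * \<phi> x" for c x
    proof (cases "\<phi> x = 0")
      case False
      then have "norm x < R / 2" "s < norm x" using test_fun_eq_0[OF \<phi>, of x] by auto
      then have "x \<in> B" using s by (auto simp: B_def)
      then show ?thesis by (simp add: F_def sum_distrib_left sum_distrib_right)
    qed simp
    have v\<phi>_int: "integrable lborel (\<lambda>x. (1 / c\<^sup>2) * (v i ((1/c) *\<^sub>R x) * (x \<bullet> i)) * \<phi> x)" if c: "c \<in> ?I" and i: "i \<in> Basis" for c i
    proof -
      have "integrable lborel (\<lambda>x. v i ((1/c) *\<^sub>R x) * ((1 / c\<^sup>2) * ((x \<bullet> i) * \<phi> x)))"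
      proof (rule mult_bdd[OF v_sc(1)[OF that]])
        show "\<bar>(1 / c\<^sup>2) * ((x \<bullet> i) * \<phi> x)\<bar> \<le> (1 / c\<^sup>2) * (R' * C0)" for x
        proof (cases "\<phi> x = 0")
          case True
          then show ?thesis using C0 by (simp add: R'_def)
        next
          case False
          then have "norm x < R / 2" "s < norm x" using test_fun_eq_0[OF \<phi>, of x] by auto
          then have "\<bar>x \<bullet> i\<bar> \<le> R'" using Basis_le_norm[OF i, of x] s by (auto simp: R'_def)
          then show ?thesis using C0 by (auto simp: abs_mult R'_def intro!: divide_right_mono mult_mono)
        qed
      qed measurable
      then show ?thesis by (simp add: mult_ac)
    qed
    \<comment> \<open>For each fixed c the weak derivative is used with the test functions
      \<open>\<psi> c i\<close>; only afterwards is the identity integrated over c.\<close>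
    have slice: "(\<integral>x. u x * K c x \<partial>lborel) = - (\<integral>x. F c x * \<phi> x \<partial>lborel)" if c: "c \<in> ?I" for c
    proof -
      have "(\<integral>x. u x * K c x \<partial>lborel) = (\<Sum>i\<in>Basis. \<integral>x. u x * pdir i (\<psi> c i) x \<partial>lborel)"
        unfolding K_\<psi> sum_distrib_left using u_d\<psi>[OF c] by (rule Bochner_Integration.integral_sum)
      also have "\<dots> = (\<Sum>i\<in>Basis. - (\<integral>x. v i x * \<psi> c i x \<partial>lborel))"
        using weak \<psi>[OF c] by (intro sum.cong) auto
      also have "\<dots> = - (\<Sum>i\<in>Basis. \<integral>x. (1 / c\<^sup>2) * (v i ((1/c) *\<^sub>R x) * (x \<bullet> i)) * \<phi> x \<partial>lborel)"
        unfolding sum_negf using v_\<psi>[OF c] by simp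
      also have "\<dots> = - (\<integral>x. F c x * \<phi> x \<partial>lborel)"
        unfolding F\<phi>[symmetric] using v\<phi>_int[OF c] by (subst Bochner_Integration.integral_sum) auto
      finally show ?thesis .
    qed
    \<comment> \<open>Where \<phi> (c x) or its derivatives do not vanish, |x| is bounded by R
      because c is at least 1/2. So one bound for \<open>K\<close> serves all c and x, as the
      interchange of integrals requires.\<close>
    have Kb: "\<exists>C. \<forall>c\<in>?I. \<forall>x. \<bar>K c x\<bar> \<le> C"
    proof (intro exI ballI allI)
      fix c x assume c: "c \<in> ?I"
      have pw: "c ^ k \<le> 1" "0 \<le> c ^ k" for k using c by (auto intro: power_le_one)
      have "\<bar>(x \<bullet> i) * pdir i \<phi> (c *\<^sub>R x)\<bar> \<le> R' * C1 i" if i: "i \<in> Basis" for i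
      proof (cases "pdir i \<phi> (c *\<^sub>R x) = 0")
        case True
        then show ?thesis using C1[OF i, of 0] by (auto simp: R'_def)
      next
        case False
        then have "norm (c *\<^sub>R x) < R / 2" using test_fun_eq_0[OF d\<phi>[OF i], of "c *\<^sub>R x"] by auto
        moreover have "1/2 * norm x \<le> c * norm x" using c by (intro mult_right_mono) auto
        ultimately have "norm x \<le> R'" using c by (auto simp: R'_def)
        then have "\<bar>x \<bullet> i\<bar> \<le> R'" using Basis_le_norm[OF i, of x] by auto
        then show ?thesis using C1[OF i] by (auto simp: abs_mult R'_def intro!: mult_mono)
      qed
      then have "\<bar>\<Sum>i\<in>Basis. (x \<bullet> i) * pdir i \<phi> (c *\<^sub>R x)\<bar> \<le> (\<Sum>i\<in>Basis. R' * C1 i)"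
        by (intro sum_abs[THEN order_trans] sum_mono)
      then have 1: "\<bar>c ^ ?n * (\<Sum>i\<in>Basis. (x \<bullet> i) * pdir i \<phi> (c *\<^sub>R x))\<bar> \<le> 1 * (\<Sum>i\<in>Basis. R' * C1 i)"
        unfolding abs_mult using pw[of ?n] by (intro mult_mono) auto
      have 2: "\<bar>(real ?n * c ^ (?n - 1)) * \<phi> (c *\<^sub>R x)\<bar> \<le> (real ?n * 1) * C0"
        unfolding abs_mult using pw[of "?n - 1"] C0 by (intro mult_mono) auto
      show "\<bar>K c x\<bar> \<le> (real ?n * 1) * C0 + 1 * (\<Sum>i\<in>Basis. R' * C1 i)"
        unfolding K_def using 1 2 by (intro abs_triangle_ineq[THEN order_trans] add_mono) auto
    qed
    then obtain CK where CK: "\<And>c x. c \<in> ?I \<Longrightarrow> \<bar>K c x\<bar> \<le> CK" by blast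
    have Fub1: "(\<integral>c. indicator ?I c * (\<integral>x. u x * K c x \<partial>lborel) \<partial>lborel) = (\<integral>x. \<integral>c. indicator ?I c * (u x * K c x) \<partial>lborel \<partial>lborel)"
    proof (rule slab_Fubini(2))
      show "(\<integral>x. \<bar>u x * K c x\<bar> \<partial>lborel) \<le> (\<integral>x. \<bar>u x\<bar> * CK \<partial>lborel)" if "c \<in> ?I" for c
        using u uK[OF that] CK[OF that] by (intro integral_mono integrable_abs) (auto simp: abs_mult intro!: mult_left_mono)
    qed (use uK in measurable)
    have Fub2: "(\<integral>c. indicator ?I c * (\<integral>x. F c x * \<phi> x \<partial>lborel) \<partial>lborel) = (\<integral>x. \<integral>c. indicator ?I c * (F c x * \<phi> x) \<partial>lborel \<partial>lborel)"
    proof (rule slab_Fubini(2))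
      show int: "integrable lborel (\<lambda>x. F c x * \<phi> x)" if "c \<in> ?I" for c
        by (rule mult_bdd[OF F_int[OF that] _ C0(1)]) measurable
      show "(\<integral>x. \<bar>F c x * \<phi> x\<bar> \<partial>lborel) \<le> M * C0" if "c \<in> ?I" for c
      proof -
        have "(\<integral>x. \<bar>F c x * \<phi> x\<bar> \<partial>lborel) \<le> (\<integral>x. \<bar>F c x\<bar> * C0 \<partial>lborel)"
          using int[OF that] F_int[OF that] C0 by (intro integral_mono integrable_abs) (auto simp: abs_mult intro!: mult_left_mono)
        also have "\<dots> \<le> M * C0" using F_M[OF that] C0(2) by (simp add: mult_right_mono)
        finally show ?thesis .
      qed
    qed measurable
    have "(\<integral>x. u x * (\<phi> x - (1/2) ^ ?n * \<phi> ((1/2) *\<^sub>R x)) \<partial>lborel) = (\<integral>x. \<integral>c. indicator ?I c * (u x * K c x) \<partial>lborel \<partial>lborel)"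
      unfolding K_int[symmetric] by (simp add: mult.left_commute[of "indicator _ _"])
    also have "\<dots> = (\<integral>c. indicator ?I c * - (\<integral>x. F c x * \<phi> x \<partial>lborel) \<partial>lborel)"
      unfolding Fub1[symmetric] by (intro Bochner_Integration.integral_cong) (auto simp: slice indicator_def)
    also have "\<dots> = - (\<integral>x. H x * \<phi> x \<partial>lborel)"
      using Fub2 by (simp add: H_def mult.assoc[symmetric])
    finally have main: "(\<integral>x. u x * (\<phi> x - (1/2) ^ ?n * \<phi> ((1/2) *\<^sub>R x)) \<partial>lborel) = - (\<integral>x. H x * \<phi> x \<partial>lborel)" .
    have i1: "integrable lborel (\<lambda>x. u x * \<phi> x)" by (rule mult_bdd[OF u _ C0(1)]) measurable
    have i2: "integrable lborel (\<lambda>x. u x * \<phi> ((1/2) *\<^sub>R x))" by (rule mult_bdd[OF u _ C0(1)]) measurable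
    have i3: "integrable lborel (\<lambda>x. u (2 *\<^sub>R x) * \<phi> x)" by (rule mult_bdd[OF u2 _ C0(1)]) measurable
    have i4: "integrable lborel (\<lambda>x. H x * \<phi> x)" by (rule mult_bdd[OF H_int _ C0(1)]) measurable
    \<comment> \<open>Doubling the variable turns the contribution of the end point c = 1/2 into u
      (2 x) tested with \<phi> itself; its factor 2^n cancels the (1/2)^n.\<close>
    have sc: "(\<integral>x. u x * \<phi> ((1/2) *\<^sub>R x) \<partial>lborel) = 2 ^ ?n * (\<integral>x. u (2 *\<^sub>R x) * \<phi> x \<partial>lborel)"
      by (subst integral_lborel_scaleR[of 2]) auto
    have "(\<integral>x. u x * (\<phi> x - (1/2) ^ ?n * \<phi> ((1/2) *\<^sub>R x)) \<partial>lborel) = (\<integral>x. u x * \<phi> x - (1/2) ^ ?n * (u x * \<phi> ((1/2) *\<^sub>R x)) \<partial>lborel)"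
      by (intro Bochner_Integration.integral_cong) (auto simp: algebra_simps)
    also have "\<dots> = (\<integral>x. u x * \<phi> x \<partial>lborel) - (1/2) ^ ?n * (\<integral>x. u x * \<phi> ((1/2) *\<^sub>R x) \<partial>lborel)"
      using i1 i2 by (subst Bochner_Integration.integral_diff) auto
    also have "\<dots> = (\<integral>x. u x * \<phi> x \<partial>lborel) - (\<integral>x. u (2 *\<^sub>R x) * \<phi> x \<partial>lborel)"
      unfolding sc by (simp add: power_one_over)
    finally have e: "(\<integral>x. u x * (\<phi> x - (1/2) ^ ?n * \<phi> ((1/2) *\<^sub>R x)) \<partial>lborel) = (\<integral>x. u x * \<phi> x \<partial>lborel) - (\<integral>x. u (2 *\<^sub>R x) * \<phi> x \<partial>lborel)" .
    have "(\<integral>x. (u (2 *\<^sub>R x) - u x - H x) * \<phi> x \<partial>lborel) = (\<integral>x. u (2 *\<^sub>R x) * \<phi> x - u x * \<phi> x - H x * \<phi> x \<partial>lborel)"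
      by (simp add: algebra_simps)
    also have "\<dots> = (\<integral>x. u (2 *\<^sub>R x) * \<phi> x \<partial>lborel) - (\<integral>x. u x * \<phi> x \<partial>lborel) - (\<integral>x. H x * \<phi> x \<partial>lborel)"
      using i1 i3 i4 by simp
    also have "\<dots> = 0" using main e by simp
    finally show "(\<integral>x. (u (2 *\<^sub>R x) - u x - H x) * \<phi> x \<partial>lborel) = 0" .
  qed
  then show ?thesis
  proof eventually_elim
    case (elim x)
    show ?case
    proof
      assume x: "s < norm x \<and> norm x < R / 2"
      then have "x \<in> B" using s by (auto simp: B_def)
      then show "u (2 *\<^sub>R x) - u x = dilation_mean v x" using elim x H_eq by simp
    qed
  qed
qed

subsection \<open>The one-derivative estimate on dyadic annuli\<close>

text \<open>The graph of the convex function a -> a^p lies above its tangent at m. For p > 1 this is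
  Young's inequality for a and m^(p - 1) with exponents p and p / (p - 1).\<close>

lemma powr_tangent:
  fixes a m p :: real
  assumes "p \<ge> 1" "a \<ge> 0" "m \<ge> 0"
  shows "m powr p + p * m powr (p - 1) * (a - m) \<le> a powr p"
proof -
  consider "m = 0" | "p = 1" "m > 0" | "p > 1" "m > 0" using assms by linarith
  then show ?thesis
  proof cases
    case 3
    define q where "q = p / (p - 1)"
    have q: "q > 1" "1 / p + 1 / q = 1" "(p - 1) * q = p" "p / q = p - 1"
      using 3 by (auto simp: q_def field_simps)
    have "a * m powr (p - 1) \<le> a powr p / p + (m powr (p - 1)) powr q / q"
      using 3 q assms by (intro Youngs_inequality) auto
    also have "(m powr (p - 1)) powr q = m powr p" by (simp add: powr_powr q)
    finally have "p * (a * m powr (p - 1)) \<le> p * (a powr p / p + m powr p / q)"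
      using 3 by (intro mult_left_mono) auto
    also have "\<dots> = a powr p + (p / q) * m powr p" using 3 by (simp add: distrib_left)
    also have "\<dots> = a powr p + (p - 1) * m powr p" by (simp only: q(4))
    finally have 1: "p * (a * m powr (p - 1)) \<le> a powr p + (p - 1) * m powr p" .
    have "m powr (p - 1) * m = m powr p" using 3 powr_mult_base[of m "p - 1"] by (simp add: mult.commute)
    then have "p * m powr (p - 1) * (a - m) = p * (a * m powr (p - 1)) - p * m powr p"
      by (simp add: algebra_simps)
    moreover have "(p - 1) * m powr p = p * m powr p - m powr p" by (simp add: algebra_simps)
    ultimately show ?thesis using 1 by linarith
  qed (use assms in auto)
qed

text \<open>Convexity applied to a + b = (1 - t) (a / (1 - t)) + t (b / t), in the form of two
  tangent inequalities at a + b. Small t brings the factor of the first term close to 1 at the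
  expense of the second; \<theta> owes its flexibility to this.\<close>

lemma powr_add_weighted:
  fixes a b p t :: real
  assumes "p \<ge> 1" "a \<ge> 0" "b \<ge> 0" "0 < t" "t < 1"
  shows "(a + b) powr p \<le> (1 - t) powr (1 - p) * a powr p + t powr (1 - p) * b powr p"
proof -
  let ?m = "a + b"
  have scale: "c * (x / c) powr p = c powr (1 - p) * x powr p" if "c > 0" "x \<ge> 0" for c x
    using that by (simp add: powr_divide powr_diff)
  have 1: "?m powr p + p * ?m powr (p - 1) * (a / (1 - t) - ?m) \<le> (a / (1 - t)) powr p"
    and 2: "?m powr p + p * ?m powr (p - 1) * (b / t - ?m) \<le> (b / t) powr p"
    using assms by (auto intro!: powr_tangent)
  have "(1 - t) * (?m powr p + p * ?m powr (p - 1) * (a / (1 - t) - ?m)) + t * (?m powr p + p * ?m powr (p - 1) * (b / t - ?m))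
     \<le> (1 - t) * (a / (1 - t)) powr p + t * (b / t) powr p"
    using assms by (intro add_mono mult_left_mono 1 2) auto
  also have "(1 - t) * (?m powr p + p * ?m powr (p - 1) * (a / (1 - t) - ?m)) + t * (?m powr p + p * ?m powr (p - 1) * (b / t - ?m))
     = ?m powr p + p * ?m powr (p - 1) * ((1 - t) * (a / (1 - t)) + t * (b / t) - ?m)"
    by (simp add: algebra_simps)
  also have "(1 - t) * (a / (1 - t)) + t * (b / t) - ?m = 0" using assms by simp
  finally show ?thesis using scale[of "1 - t" a] scale[of t b] assms by simp
qed

text \<open>Every term is at most the maximum, and the maximum is one of the terms. The constant is
  not sharp; it only has to depend on nothing but p and the number of terms.\<close>

lemma powr_sum_le:
  fixes f :: "'b \<Rightarrow> real"
  assumes "finite I" "p > 0" "\<And>i. i \<in> I \<Longrightarrow> 0 \<le> f i"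
  shows "(\<Sum>i\<in>I. f i) powr p \<le> real (card I) powr p * (\<Sum>i\<in>I. f i powr p)"
proof (cases "I = {}")
  case False
  define M where "M = Max (f ` I)"
  have M: "M \<in> f ` I" "\<And>i. i \<in> I \<Longrightarrow> f i \<le> M" using assms(1) False by (auto simp: M_def)
  then obtain j where j: "j \<in> I" "M = f j" by auto
  have "(\<Sum>i\<in>I. f i) \<le> real (card I) * M" using sum_bounded_above[of I f M] M by simp
  then have "(\<Sum>i\<in>I. f i) powr p \<le> (real (card I) * M) powr p"
    using assms by (intro powr_mono2 sum_nonneg) auto
  also have "\<dots> = real (card I) powr p * f j powr p" using j assms by (simp add: powr_mult)
  also have "\<dots> \<le> real (card I) powr p * (\<Sum>i\<in>I. f i powr p)"
    using assms j by (intro mult_left_mono member_le_sum) auto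
  finally show ?thesis .
qed (use assms in auto)

text \<open>Jensen's inequality through the tangent at the integral m of g. As the interval has
  length 1/2, integrating the tangent gives m^p (1 + p) / 2, which is at least m^p because p is at
  least 1.\<close>

lemma integral_powr_le:
  fixes g :: "real \<Rightarrow> real"
  assumes p: "p \<ge> 1" and g: "\<And>c. g c \<ge> 0" and [measurable]: "g \<in> borel_measurable borel"
  shows "ennreal ((\<integral>c. indicator {1/2..1} c * g c \<partial>lborel) powr p) \<le> (\<integral>\<^sup>+c. indicator {1/2..1} c * ennreal (g c powr p) \<partial>lborel)"
proof (cases "(\<integral>\<^sup>+c. indicator {1/2..1} c * ennreal (g c powr p) \<partial>lborel) = \<infinity>")
  case False
  let ?I = "{1/2..1::real}"
  have eq: "indicator ?I c * ennreal (g c powr p) = ennreal (indicator ?I c * g c powr p)" for c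
    by (auto simp: indicator_def)
  have int: "integrable lborel (\<lambda>c. indicator ?I c * g c powr p)"
    using False unfolding eq by (intro integrableI_nonneg) (auto simp: less_top)
  have int1: "integrable lborel (indicator ?I :: real \<Rightarrow> real)"
    by (intro integrable_real_indicator emeasure_bounded_finite) auto
  have int2: "integrable lborel (\<lambda>c. indicator ?I c * g c)"
  proof (rule Bochner_Integration.integrable_bound)
    show "integrable lborel (\<lambda>c. indicator ?I c + indicator ?I c * g c powr p)" using int int1 by simp
    have "g c \<le> 1 + g c powr p" for c
    proof (cases "g c \<le> 1")
      case False
      then have "g c powr 1 \<le> g c powr p" using p by (intro powr_mono) auto
      then show ?thesis using False by simp
    qed (simp add: add_increasing2)
    then show "AE c in lborel. norm (indicator ?I c * g c) \<le> norm (indicator ?I c + indicator ?I c * g c powr p)"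
      by (intro AE_I2) (auto simp: indicator_def g)
  qed measurable
  define m where "m = (\<integral>c. indicator ?I c * g c \<partial>lborel)"
  have m: "m \<ge> 0" unfolding m_def by (intro integral_nonneg_AE) (simp add: g)
  have mm: "m powr (p - 1) * m = m powr p" using m powr_mult_base[of m "p - 1"] by (simp add: mult.commute)
  have vol: "(\<integral>c. indicator ?I c \<partial>lborel) = (1/2::real)" by simp
  have "(\<integral>c. (m powr p - p * m powr (p - 1) * m) * indicator ?I c + p * m powr (p - 1) * (indicator ?I c * g c) \<partial>lborel)
      = (m powr p - p * m powr (p - 1) * m) * (1/2) + p * m powr (p - 1) * m"
    using int1 int2 by (simp add: m_def)
  also have "\<dots> = m powr p * ((1 + p) / 2)" using mm by (simp add: field_simps)
  finally have e: "(\<integral>c. (m powr p - p * m powr (p - 1) * m) * indicator ?I c + p * m powr (p - 1) * (indicator ?I c * g c) \<partial>lborel)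
      = m powr p * ((1 + p) / 2)" .
  have "m powr p * 1 \<le> m powr p * ((1 + p) / 2)" using p by (intro mult_left_mono) auto
  also have "\<dots> \<le> (\<integral>c. indicator ?I c * g c powr p \<partial>lborel)"
    unfolding e[symmetric]
  proof (rule integral_mono)
    fix c
    show "(m powr p - p * m powr (p - 1) * m) * indicator ?I c + p * m powr (p - 1) * (indicator ?I c * g c) \<le> indicator ?I c * g c powr p"
      using powr_tangent[OF p g[of c] m] by (auto simp: indicator_def algebra_simps)
  qed (use int int1 int2 in auto)
  finally have "m powr p \<le> (\<integral>c. indicator ?I c * g c powr p \<partial>lborel)" by simp
  then have "ennreal (m powr p) \<le> ennreal (\<integral>c. indicator ?I c * g c powr p \<partial>lborel)" by (rule ennreal_leI)
  also have "\<dots> = (\<integral>\<^sup>+c. ennreal (indicator ?I c * g c powr p) \<partial>lborel)"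
    by (rule nn_integral_eq_integral[OF int, symmetric]) auto
  finally show ?thesis unfolding eq m_def .
qed simp

section \<open>Dilations acting on dyadic annuli\<close>

lemma annulus_borel [measurable]: "annulus k \<in> sets borel"
  unfolding annulus_def by measurable

lemma scaleR_two_annulus: "2 *\<^sub>R x \<in> annulus (k + 1) \<longleftrightarrow> x \<in> annulus k"
proof -
  have "2 powr (real_of_int (k + 1) - 1) = 2 * 2 powr (real_of_int k - 1)" "2 powr real_of_int (k + 1) = 2 * 2 powr real_of_int k"
    using powr_add[of 2 1 "real_of_int k - 1"] powr_add[of 2 1 "real_of_int k"] by (auto simp: algebra_simps)
  then show ?thesis by (simp add: annulus_def)
qed

text \<open>Dilating \<open>annulus k\<close> by 1/c with c in [1/2, 1] reaches at most one annulus
  further out, which is why two neighbouring gradient terms enter the recursion.\<close>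

lemma annulus_scaleR_subset:
  assumes "c *\<^sub>R y \<in> annulus k" "1/2 \<le> c" "c \<le> 1"
  shows "y \<in> annulus k \<union> annulus (k + 1)"
proof -
  have 1: "2 powr (real_of_int k - 1) \<le> c * norm y" "c * norm y < 2 powr real_of_int k"
    using assms by (auto simp: annulus_def)
  have 2: "c * norm y \<le> norm y" "1/2 * norm y \<le> c * norm y"
    using assms mult_right_mono[of "1/2" c "norm y"] by (auto intro!: mult_left_le_one_le)
  have "2 powr real_of_int (k + 1) = 2 * 2 powr real_of_int k"
    using powr_add[of 2 1 "real_of_int k"] by (auto simp: algebra_simps)
  then show ?thesis using 1 2 by (auto simp: annulus_def)
qed

text \<open>In the constant, 4 bounds 1 / c^2, r bounds the coordinates of x, and the dimension is
  the cost of taking a p-th power of a sum over the basis.\<close>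

lemma dilation_mean_powr_le:
  fixes v :: "'a::euclidean_space \<Rightarrow> 'a \<Rightarrow> real"
  assumes p: "p \<ge> 1" and v: "\<And>i. i \<in> Basis \<Longrightarrow> v i \<in> borel_measurable borel" and x: "norm x \<le> r"
  shows "ennreal (\<bar>dilation_mean v x\<bar> powr p) \<le> ennreal ((4 * r * DIM('a)) powr p) *
    (\<integral>\<^sup>+c. indicator {1/2..1} c * (\<Sum>i\<in>Basis. ennreal (\<bar>v i ((1/c) *\<^sub>R x)\<bar> powr p)) \<partial>lborel)"
proof -
  let ?I = "{1/2..1::real}"
  have [measurable]: "i \<in> Basis \<Longrightarrow> v i \<in> borel_measurable borel" for i by (rule v)
  have r: "r \<ge> 0" using x norm_ge_zero[of x] by linarith
  define g where "g c = (1 / c\<^sup>2) * \<bar>\<Sum>i\<in>Basis. v i ((1/c) *\<^sub>R x) * (x \<bullet> i)\<bar>" for c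
  have [measurable]: "g \<in> borel_measurable borel" unfolding g_def by measurable
  have "\<bar>dilation_mean v x\<bar> \<le> (\<integral>c. indicator ?I c * g c \<partial>lborel)"
    unfolding dilation_mean_def by (rule order_trans[OF integral_abs_bound]) (simp add: abs_mult g_def)
  then have "\<bar>dilation_mean v x\<bar> powr p \<le> (\<integral>c. indicator ?I c * g c \<partial>lborel) powr p"
    using p by (intro powr_mono2) auto
  then have "ennreal (\<bar>dilation_mean v x\<bar> powr p) \<le> ennreal ((\<integral>c. indicator ?I c * g c \<partial>lborel) powr p)"
    by (rule ennreal_leI)
  also have "\<dots> \<le> (\<integral>\<^sup>+c. indicator ?I c * ennreal (g c powr p) \<partial>lborel)"
    by (rule integral_powr_le[OF p]) (auto simp: g_def)
  also have "\<dots> \<le> (\<integral>\<^sup>+c. ennreal ((4 * r * DIM('a)) powr p) * (indicator ?I c * (\<Sum>i\<in>Basis. ennreal (\<bar>v i ((1/c) *\<^sub>R x)\<bar> powr p))) \<partial>lborel)"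
  proof (rule nn_integral_mono)
    fix c :: real
    show "indicator ?I c * ennreal (g c powr p) \<le> ennreal ((4 * r * DIM('a)) powr p) * (indicator ?I c * (\<Sum>i\<in>Basis. ennreal (\<bar>v i ((1/c) *\<^sub>R x)\<bar> powr p)))"
    proof (cases "c \<in> ?I")
      case True
      have "1 / c\<^sup>2 \<le> 4"
        using True power_mono[of "1/2" c 2] by (auto simp: field_simps power2_eq_square)
      moreover have "\<bar>\<Sum>i\<in>Basis. v i ((1/c) *\<^sub>R x) * (x \<bullet> i)\<bar> \<le> (\<Sum>i\<in>Basis. \<bar>v i ((1/c) *\<^sub>R x)\<bar> * r)"
        by (intro sum_abs[THEN order_trans] sum_mono)
          (auto simp: abs_mult intro!: mult_left_mono order_trans[OF Basis_le_norm x])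
      ultimately have "g c \<le> 4 * (\<Sum>i\<in>Basis. \<bar>v i ((1/c) *\<^sub>R x)\<bar> * r)"
        unfolding g_def by (intro mult_mono) auto
      also have "\<dots> = 4 * r * (\<Sum>i\<in>Basis. \<bar>v i ((1/c) *\<^sub>R x)\<bar>)"
        by (simp add: sum_distrib_right[symmetric])
      finally have "g c powr p \<le> (4 * r * (\<Sum>i\<in>Basis. \<bar>v i ((1/c) *\<^sub>R x)\<bar>)) powr p"
        using p by (intro powr_mono2) (auto simp: g_def)
      also have "\<dots> = (4 * r) powr p * (\<Sum>i\<in>Basis. \<bar>v i ((1/c) *\<^sub>R x)\<bar>) powr p"
        by (rule powr_mult)
      also have "\<dots> \<le> (4 * r) powr p * (real DIM('a) powr p * (\<Sum>i\<in>Basis. \<bar>v i ((1/c) *\<^sub>R x)\<bar> powr p))"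
        using p by (intro mult_left_mono powr_sum_le) auto
      also have "\<dots> = (4 * r * DIM('a)) powr p * (\<Sum>i\<in>Basis. \<bar>v i ((1/c) *\<^sub>R x)\<bar> powr p)"
        using r by (simp add: powr_mult)
      finally have "ennreal (g c powr p) \<le> ennreal ((4 * r * DIM('a)) powr p * (\<Sum>i\<in>Basis. \<bar>v i ((1/c) *\<^sub>R x)\<bar> powr p))"
        by (rule ennreal_leI)
      then show ?thesis using True by (simp add: ennreal_mult sum_nonneg)
    qed simp
  qed
  also have "\<dots> = ennreal ((4 * r * DIM('a)) powr p) * (\<integral>\<^sup>+c. indicator ?I c * (\<Sum>i\<in>Basis. ennreal (\<bar>v i ((1/c) *\<^sub>R x)\<bar> powr p)) \<partial>lborel)"
    by (rule nn_integral_cmult) measurable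
  finally show ?thesis .
qed

text \<open>The pointwise bound is used with r = 2^k, which is where the recursion gains the power
  2^k. After Tonelli, the substitution x -> c x costs c^n, at most 1, and the interval of c has
  measure at most 1.\<close>

lemma dilation_mean_annulus_le:
  fixes v :: "'a::euclidean_space \<Rightarrow> 'a \<Rightarrow> real"
  assumes p: "p \<ge> 1" and v: "\<And>i. i \<in> Basis \<Longrightarrow> v i \<in> borel_measurable borel"
  shows "(\<integral>\<^sup>+x. indicator (annulus k) x * ennreal (\<bar>dilation_mean v x\<bar> powr p) \<partial>lborel) \<le>
    ennreal ((4 * 2 powr k * DIM('a)) powr p) *
    (\<Sum>i\<in>Basis. \<integral>\<^sup>+x. indicator (annulus k \<union> annulus (k + 1)) x * ennreal (\<bar>v i x\<bar> powr p) \<partial>lborel)"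
proof -
  let ?I = "{1/2..1::real}" and ?A = "annulus k :: 'a set" and ?B = "annulus k \<union> annulus (k + 1) :: 'a set"
    and ?C = "ennreal ((4 * 2 powr k * DIM('a)) powr p)"
  have [measurable]: "i \<in> Basis \<Longrightarrow> v i \<in> borel_measurable borel" for i by (rule v)
  let ?S = "\<lambda>x c. indicator ?A x * (indicator ?I c * (\<Sum>i\<in>Basis. ennreal (\<bar>v i ((1/c) *\<^sub>R x)\<bar> powr p)))"
  have "(\<integral>\<^sup>+x. indicator ?A x * ennreal (\<bar>dilation_mean v x\<bar> powr p) \<partial>lborel)
     \<le> (\<integral>\<^sup>+x. ?C * (\<integral>\<^sup>+c. ?S x c \<partial>lborel) \<partial>lborel)"
  proof (rule nn_integral_mono)
    fix x :: 'a
    show "indicator ?A x * ennreal (\<bar>dilation_mean v x\<bar> powr p) \<le> ?C * (\<integral>\<^sup>+c. ?S x c \<partial>lborel)"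
    proof (cases "x \<in> ?A")
      case True
      then have "norm x \<le> 2 powr k" by (auto simp: annulus_def)
      from dilation_mean_powr_le[OF p v this] show ?thesis using True by simp
    qed simp
  qed
  also have "\<dots> = ?C * (\<integral>\<^sup>+x. \<integral>\<^sup>+c. ?S x c \<partial>lborel \<partial>lborel)"
    by (rule nn_integral_cmult) measurable
  also have "(\<integral>\<^sup>+x. \<integral>\<^sup>+c. ?S x c \<partial>lborel \<partial>lborel) = (\<integral>\<^sup>+c. \<integral>\<^sup>+x. ?S x c \<partial>lborel \<partial>lborel)"
    by (rule lborel_pair.Fubini'[symmetric]) measurable
  also have "\<dots> \<le> (\<integral>\<^sup>+c. (\<Sum>i\<in>Basis. \<integral>\<^sup>+x. indicator ?B x * ennreal (\<bar>v i x\<bar> powr p) \<partial>lborel) * indicator ?I c \<partial>lborel)"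
  proof (rule nn_integral_mono)
    fix c :: real
    show "(\<integral>\<^sup>+x. ?S x c \<partial>lborel) \<le> (\<Sum>i\<in>Basis. \<integral>\<^sup>+x. indicator ?B x * ennreal (\<bar>v i x\<bar> powr p) \<partial>lborel) * indicator ?I c"
    proof (cases "c \<in> ?I")
      case True
      then have c: "c > 0" by auto
      have "(\<integral>\<^sup>+x. ?S x c \<partial>lborel) = (\<integral>\<^sup>+x. (\<Sum>i\<in>Basis. indicator ?A x * ennreal (\<bar>v i ((1/c) *\<^sub>R x)\<bar> powr p)) \<partial>lborel)"
        using True by (simp only: sum_distrib_left indicator_simps(1) mult_1)
      also have "\<dots> = (\<Sum>i\<in>Basis. \<integral>\<^sup>+x. indicator ?A x * ennreal (\<bar>v i ((1/c) *\<^sub>R x)\<bar> powr p) \<partial>lborel)"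
        by (rule nn_integral_sum) measurable
      also have "\<dots> \<le> (\<Sum>i\<in>Basis. \<integral>\<^sup>+x. indicator ?B x * ennreal (\<bar>v i x\<bar> powr p) \<partial>lborel)"
      proof (rule sum_mono)
        fix i :: 'a assume i: "i \<in> Basis"
        have "(\<integral>\<^sup>+x. indicator ?A x * ennreal (\<bar>v i ((1/c) *\<^sub>R x)\<bar> powr p) \<partial>lborel)
          = ennreal (c ^ DIM('a)) * (\<integral>\<^sup>+x. indicator ?A (c *\<^sub>R x) * ennreal (\<bar>v i ((1/c) *\<^sub>R (c *\<^sub>R x))\<bar> powr p) \<partial>lborel)"
          by (rule nn_integral_lborel_scaleR[OF c]) (use i in measurable)
        also have "\<dots> \<le> 1 * (\<integral>\<^sup>+x. indicator ?B x * ennreal (\<bar>v i x\<bar> powr p) \<partial>lborel)"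
        proof (rule mult_mono)
          show "ennreal (c ^ DIM('a)) \<le> 1" using True c by (simp add: power_le_one ennreal_le_1)
          show "(\<integral>\<^sup>+x. indicator ?A (c *\<^sub>R x) * ennreal (\<bar>v i ((1/c) *\<^sub>R (c *\<^sub>R x))\<bar> powr p) \<partial>lborel) \<le> (\<integral>\<^sup>+x. indicator ?B x * ennreal (\<bar>v i x\<bar> powr p) \<partial>lborel)"
            using True c annulus_scaleR_subset[of c _ k] by (intro nn_integral_mono) (auto simp: indicator_def)
        qed auto
        finally show "(\<integral>\<^sup>+x. indicator ?A x * ennreal (\<bar>v i ((1/c) *\<^sub>R x)\<bar> powr p) \<partial>lborel) \<le> (\<integral>\<^sup>+x. indicator ?B x * ennreal (\<bar>v i x\<bar> powr p) \<partial>lborel)" by simp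
      qed
      finally show ?thesis using True by simp
    qed simp
  qed
  also have "\<dots> \<le> (\<Sum>i\<in>Basis. \<integral>\<^sup>+x. indicator ?B x * ennreal (\<bar>v i x\<bar> powr p) \<partial>lborel) * 1"
  proof -
    have "emeasure lborel ?I = ennreal (1 - 1/2)" by (subst emeasure_lborel_Icc_eq) simp
    also have "\<dots> \<le> ennreal 1" by (intro ennreal_leI) simp
    finally have "emeasure lborel ?I \<le> 1" by simp
    then show ?thesis by (subst nn_integral_cmult_indicator, simp) (rule mult_left_mono, assumption, simp)
  qed
  finally show ?thesis by (simp add: mult_left_mono)
qed

text \<open>The recursion for p-th powers, in extended nonnegative reals so that no integrability
  has to be known. The term u (2 x) on \<open>annulus k\<close> becomes u on
  \<open>annulus (k + 1)\<close> with Jacobian factor 2^(-n).\<close>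

lemma annulus_step:
  fixes u :: "'a::euclidean_space \<Rightarrow> real" and v :: "'a \<Rightarrow> 'a \<Rightarrow> real"
  assumes p: "p \<ge> 1" and t: "0 < t" "t < 1"
    and [measurable]: "u \<in> borel_measurable borel" and v: "\<And>i. i \<in> Basis \<Longrightarrow> v i \<in> borel_measurable borel"
    and ae: "AE x in lborel. x \<in> annulus k \<longrightarrow> u (2 *\<^sub>R x) - u x = dilation_mean v x"
  shows "(\<integral>\<^sup>+x. indicator (annulus k) x * ennreal (\<bar>u x\<bar> powr p) \<partial>lborel) \<le>
    ennreal ((1 - t) powr (1 - p) / 2 ^ DIM('a)) * (\<integral>\<^sup>+x. indicator (annulus (k + 1)) x * ennreal (\<bar>u x\<bar> powr p) \<partial>lborel) +
    ennreal (t powr (1 - p) * (4 * 2 powr k * DIM('a)) powr p) *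
    (\<Sum>i\<in>Basis. \<integral>\<^sup>+x. indicator (annulus k \<union> annulus (k + 1)) x * ennreal (\<bar>v i x\<bar> powr p) \<partial>lborel)"
proof -
  let ?A = "annulus k :: 'a set"
  have [measurable]: "i \<in> Basis \<Longrightarrow> v i \<in> borel_measurable borel" for i by (rule v)
  have [measurable]: "dilation_mean v \<in> borel_measurable borel"
    unfolding dilation_mean_def by measurable
  have "(\<integral>\<^sup>+x. indicator ?A x * ennreal (\<bar>u x\<bar> powr p) \<partial>lborel) \<le>
    (\<integral>\<^sup>+x. ennreal ((1 - t) powr (1 - p)) * (indicator ?A x * ennreal (\<bar>u (2 *\<^sub>R x)\<bar> powr p)) +
          ennreal (t powr (1 - p)) * (indicator ?A x * ennreal (\<bar>dilation_mean v x\<bar> powr p)) \<partial>lborel)"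
    using ae
  proof (intro nn_integral_mono_AE, eventually_elim)
    fix x assume x: "x \<in> ?A \<longrightarrow> u (2 *\<^sub>R x) - u x = dilation_mean v x"
    show "indicator ?A x * ennreal (\<bar>u x\<bar> powr p) \<le>
      ennreal ((1 - t) powr (1 - p)) * (indicator ?A x * ennreal (\<bar>u (2 *\<^sub>R x)\<bar> powr p)) +
          ennreal (t powr (1 - p)) * (indicator ?A x * ennreal (\<bar>dilation_mean v x\<bar> powr p))"
    proof (cases "x \<in> ?A")
      case True
      then have "\<bar>u x\<bar> \<le> \<bar>u (2 *\<^sub>R x)\<bar> + \<bar>dilation_mean v x\<bar>" using x by linarith
      then have "\<bar>u x\<bar> powr p \<le> (\<bar>u (2 *\<^sub>R x)\<bar> + \<bar>dilation_mean v x\<bar>) powr p" using p by (intro powr_mono2) auto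
      also have "\<dots> \<le> (1 - t) powr (1 - p) * \<bar>u (2 *\<^sub>R x)\<bar> powr p + t powr (1 - p) * \<bar>dilation_mean v x\<bar> powr p"
        by (rule powr_add_weighted) (use p t in auto)
      finally have "ennreal (\<bar>u x\<bar> powr p) \<le> ennreal ((1 - t) powr (1 - p) * \<bar>u (2 *\<^sub>R x)\<bar> powr p + t powr (1 - p) * \<bar>dilation_mean v x\<bar> powr p)"
        by (rule ennreal_leI)
      then show ?thesis using True by (simp add: ennreal_mult)
    qed simp
  qed
  also have "\<dots> = ennreal ((1 - t) powr (1 - p)) * (\<integral>\<^sup>+x. indicator ?A x * ennreal (\<bar>u (2 *\<^sub>R x)\<bar> powr p) \<partial>lborel) +
          ennreal (t powr (1 - p)) * (\<integral>\<^sup>+x. indicator ?A x * ennreal (\<bar>dilation_mean v x\<bar> powr p) \<partial>lborel)"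
    by (subst nn_integral_add) (auto simp: nn_integral_cmult)
  also have "(\<integral>\<^sup>+x. indicator ?A x * ennreal (\<bar>u (2 *\<^sub>R x)\<bar> powr p) \<partial>lborel) =
      ennreal (1 / 2 ^ DIM('a)) * (\<integral>\<^sup>+x. indicator (annulus (k + 1)) x * ennreal (\<bar>u x\<bar> powr p) \<partial>lborel)"
  proof -
    have "(\<integral>\<^sup>+x. indicator (annulus (k + 1)) x * ennreal (\<bar>u x\<bar> powr p) \<partial>lborel) =
      ennreal (2 ^ DIM('a)) * (\<integral>\<^sup>+x. indicator (annulus (k + 1)) (2 *\<^sub>R x) * ennreal (\<bar>u (2 *\<^sub>R x)\<bar> powr p) \<partial>lborel)"
      by (rule nn_integral_lborel_scaleR) auto
    also have "(\<lambda>x. indicator (annulus (k + 1)) (2 *\<^sub>R x) :: ennreal) = indicator ?A"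
      by (auto simp: fun_eq_iff indicator_def scaleR_two_annulus)
    finally have e: "(\<integral>\<^sup>+x. indicator (annulus (k + 1)) x * ennreal (\<bar>u x\<bar> powr p) \<partial>lborel) =
      ennreal (2 ^ DIM('a)) * (\<integral>\<^sup>+x. indicator ?A x * ennreal (\<bar>u (2 *\<^sub>R x)\<bar> powr p) \<partial>lborel)" .
    have "ennreal (1 / 2 ^ DIM('a)) * ennreal (2 ^ DIM('a)) = 1"
      by (simp add: ennreal_mult[symmetric])
    then show ?thesis unfolding e by (simp add: mult.assoc[symmetric])
  qed
  also have "ennreal ((1 - t) powr (1 - p)) * (ennreal (1 / 2 ^ DIM('a)) * (\<integral>\<^sup>+x. indicator (annulus (k + 1)) x * ennreal (\<bar>u x\<bar> powr p) \<partial>lborel))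
     = ennreal ((1 - t) powr (1 - p) / 2 ^ DIM('a)) * (\<integral>\<^sup>+x. indicator (annulus (k + 1)) x * ennreal (\<bar>u x\<bar> powr p) \<partial>lborel)"
    by (simp add: mult.assoc[symmetric] ennreal_mult[symmetric])
  also have "ennreal (t powr (1 - p)) * (\<integral>\<^sup>+x. indicator ?A x * ennreal (\<bar>dilation_mean v x\<bar> powr p) \<partial>lborel)
    \<le> ennreal (t powr (1 - p)) * (ennreal ((4 * 2 powr k * DIM('a)) powr p) *
    (\<Sum>i\<in>Basis. \<integral>\<^sup>+x. indicator (annulus k \<union> annulus (k + 1)) x * ennreal (\<bar>v i x\<bar> powr p) \<partial>lborel))"
    by (intro mult_left_mono dilation_mean_annulus_le p v) auto
  also have "\<dots> = ennreal (t powr (1 - p) * (4 * 2 powr k * DIM('a)) powr p) *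
    (\<Sum>i\<in>Basis. \<integral>\<^sup>+x. indicator (annulus k \<union> annulus (k + 1)) x * ennreal (\<bar>v i x\<bar> powr p) \<partial>lborel)"
    by (simp add: ennreal_mult mult.assoc)
  finally show ?thesis by (simp add: add_left_mono)
qed

subsection \<open>Weighted sequence norms\<close>

text \<open>The l^r norm of a nonnegative sequence is at most M. Testing finite partial sums avoids
  separate summability conditions in every estimate.\<close>

definition lr_bound :: "ennreal \<Rightarrow> (int \<Rightarrow> real) \<Rightarrow> real \<Rightarrow> bool" where
  "lr_bound r b M \<longleftrightarrow> 0 \<le> M \<and> (\<forall>k. 0 \<le> b k) \<and>
     (if r = \<infinity> then \<forall>k. b k \<le> M
      else \<forall>F. finite F \<longrightarrow> (\<Sum>k\<in>F. b k powr enn2real r) \<le> M powr enn2real r)"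

lemma enn2real_ge_1: "1 \<le> r \<Longrightarrow> r \<noteq> \<infinity> \<Longrightarrow> 1 \<le> enn2real r"
  using enn2real_mono[of 1 r] by (simp add: less_top)

lemma lr_bound_mono:
  assumes "lr_bound r b M" "\<And>k. 0 \<le> b' k" "\<And>k. b' k \<le> b k"
  shows "lr_bound r b' M"
proof (cases "r = \<infinity>")
  case True
  then have "b' k \<le> M" for k using assms(1) assms(3)[of k] order_trans[of "b' k" "b k" M] by (simp add: lr_bound_def)
  then show ?thesis using assms(1,2) True by (simp add: lr_bound_def)
next
  case False
  have le: "(\<Sum>k\<in>F. b' k powr enn2real r) \<le> (\<Sum>k\<in>F. b k powr enn2real r)" for F
    using assms by (intro sum_mono powr_mono2) auto
  have "(\<Sum>k\<in>F. b' k powr enn2real r) \<le> M powr enn2real r" if "finite F" for F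
    using order_trans[OF le] assms(1) False that by (simp add: lr_bound_def)
  then show ?thesis using assms(1,2) False by (simp add: lr_bound_def)
qed

lemma lr_bound_cmult:
  assumes "lr_bound r b M" "0 \<le> c"
  shows "lr_bound r (\<lambda>k. c * b k) (c * M)"
proof (cases "r = \<infinity>")
  case True
  then show ?thesis using assms by (auto simp: lr_bound_def intro: mult_left_mono)
next
  case False
  have "(\<Sum>k\<in>F. (c * b k) powr enn2real r) = c powr enn2real r * (\<Sum>k\<in>F. b k powr enn2real r)" for F
    using assms by (simp add: powr_mult sum_distrib_left lr_bound_def)
  then show ?thesis using assms False by (auto simp: lr_bound_def powr_mult intro!: mult_left_mono)
qed

text \<open>A crude triangle inequality: one factor 2 splits the sum inside the power, the other
  merges M^q and M'^q into (M + M')^q, using q at least 1.\<close>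

lemma lr_bound_add:
  assumes b: "lr_bound r b M" "lr_bound r b' M'" and r: "1 \<le> r"
  shows "lr_bound r (\<lambda>k. b k + b' k) (4 * (M + M'))"
proof (cases "r = \<infinity>")
  case True
  have "b k + b' k \<le> M + M'" "0 \<le> M + M'" for k using b True by (auto simp: lr_bound_def intro: add_mono)
  then have "b k + b' k \<le> 4 * (M + M')" for k by (smt (verit))
  then show ?thesis using b True by (auto simp: lr_bound_def)
next
  case False
  define q where "q = enn2real r"
  have q: "q \<ge> 1" using enn2real_ge_1[OF r False] by (simp add: q_def)
  have nn: "0 \<le> M" "0 \<le> M'" "\<And>k. 0 \<le> b k" "\<And>k. 0 \<le> b' k" using b by (auto simp: lr_bound_def)
  have two: "(x + y) powr q \<le> 2 powr q * (x powr q + y powr q)" if "x \<ge> 0" "y \<ge> 0" for x y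
    using powr_sum_le[of "{True, False}" q "\<lambda>t. if t then x else y"] q that by auto
  have "(\<Sum>k\<in>F. (b k + b' k) powr q) \<le> (4 * (M + M')) powr q" if "finite F" for F
  proof -
    have "(\<Sum>k\<in>F. (b k + b' k) powr q) \<le> (\<Sum>k\<in>F. 2 powr q * (b k powr q + b' k powr q))"
      by (intro sum_mono two nn)
    also have "\<dots> = 2 powr q * ((\<Sum>k\<in>F. b k powr q) + (\<Sum>k\<in>F. b' k powr q))"
      by (simp only: sum_distrib_left[symmetric] sum.distrib)
    also have "\<dots> \<le> 2 powr q * (M powr q + M' powr q)"
      using b that False by (intro mult_left_mono add_mono) (auto simp: lr_bound_def q_def)
    also have "\<dots> \<le> 2 powr q * ((M + M') powr q + (M + M') powr q)"
      using nn q by (intro mult_left_mono add_mono powr_mono2) auto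
    also have "\<dots> = 2 powr 1 * (2 powr q * (M + M') powr q)" by simp
    also have "\<dots> \<le> 2 powr q * (2 powr q * (M + M') powr q)"
      using q by (intro mult_right_mono powr_mono) auto
    also have "\<dots> = (2 * (2 * (M + M'))) powr q" by (simp only: powr_mult)
    finally show ?thesis by simp
  qed
  then show ?thesis using b False nn by (auto simp: lr_bound_def q_def)
qed

lemma lr_bound_shift:
  assumes "lr_bound r b M"
  shows "lr_bound r (\<lambda>k. b (k + 1)) M"
proof (cases "r = \<infinity>")
  case False
  have "(\<Sum>k\<in>F. b (k + 1) powr enn2real r) = (\<Sum>k\<in>(\<lambda>k. k + 1) ` F. b k powr enn2real r)" for F
    by (simp add: sum.reindex)
  then show ?thesis using assms False by (auto simp: lr_bound_def)
qed (use assms in \<open>auto simp: lr_bound_def\<close>)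

lemma lr_bound_sum:
  assumes "finite I" "1 \<le> r" "\<And>i. i \<in> I \<Longrightarrow> \<exists>M. lr_bound r (b i) M"
  shows "\<exists>M. lr_bound r (\<lambda>k. \<Sum>i\<in>I. b i k) M"
  using assms
proof (induction I rule: finite_induct)
  case empty
  show ?case by (intro exI[of _ 0]) (simp add: lr_bound_def)
next
  case (insert i I)
  obtain M where "lr_bound r (\<lambda>k. \<Sum>i\<in>I. b i k) M" using insert by blast
  moreover obtain M' where "lr_bound r (b i) M'" using insert.prems(2)[of i] by blast
  ultimately show ?case using lr_bound_add[of r "b i" M' "\<lambda>k. \<Sum>i\<in>I. b i k" M] insert by auto
qed

text \<open>The tail from K upwards is controlled by M0, and below K the recursion contracts. For
  infinite r this is a downward induction from K. For finite r one sums q-th powers over a finite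
  window below K and absorbs the shifted sum into the left side, which is legitimate because the
  window is finite. The constant is fixed before the sequences, so that it does not depend on the
  function.\<close>

lemma lr_bound_recursion:
  fixes \<theta> :: real and K :: int
  assumes r: "1 \<le> r" and \<theta>: "0 < \<theta>" "\<theta> < 1"
  obtains C where "C > 0"
    "\<And>b h M0 M1. \<lbrakk>\<And>k. 0 \<le> b k; \<And>k. k < K \<Longrightarrow> b k \<le> \<theta> * b (k + 1) + h k; lr_bound r h M1;
        lr_bound r (\<lambda>k. if K \<le> k then b k else 0) M0\<rbrakk> \<Longrightarrow> lr_bound r b (C * (M0 + M1))"
proof (cases "r = \<infinity>")
  case True
  show ?thesis
  proof (rule that[of "1 / (1 - \<theta>)"])
    fix b h M0 M1
    assume b: "\<And>k. 0 \<le> b k" and rec: "\<And>k. k < K \<Longrightarrow> b k \<le> \<theta> * b (k + 1) + h k"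
      and h: "lr_bound r h M1" and b0: "lr_bound r (\<lambda>k. if K \<le> k then b k else 0) M0"
    have nn: "0 \<le> M0" "0 \<le> M1" and hM: "\<And>k. h k \<le> M1" using h b0 True by (auto simp: lr_bound_def)
    have "(if K \<le> k then b k else 0) \<le> M0" for k using b0 True by (simp add: lr_bound_def)
    then have bM: "b k \<le> M0" if "K \<le> k" for k using that by (metis (full_types))
    \<comment> \<open>The fixed point of y -> \<theta> y + M0 + M1, hence an invariant bound for the
      recursion.\<close>
    define C where "C = 1 / (1 - \<theta>) * (M0 + M1)"
    have C: "\<theta> * C + (M0 + M1) = C" using \<theta> by (simp add: C_def field_simps)
    have "C \<ge> 0" using nn \<theta> by (auto simp: C_def)
    then have C0: "M0 \<le> C" using C nn \<theta> mult_nonneg_nonneg[of \<theta> C] by linarith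
    have "b (K - int j) \<le> C" for j
    proof (induction j)
      case 0
      then show ?case using bM[of K] C0 by simp
    next
      case (Suc j)
      have "b (K - int (Suc j)) \<le> \<theta> * b (K - int (Suc j) + 1) + h (K - int (Suc j))" by (rule rec) simp
      also have "\<dots> \<le> \<theta> * C + M1" using Suc \<theta> hM by (intro add_mono mult_left_mono) auto
      also have "\<dots> \<le> C" using C nn by linarith
      finally show ?case .
    qed
    from this[of "nat (K - k)" for k] have "b k \<le> C" for k
      using bM[of k] C0 by (cases "K \<le> k") (auto, smt (verit))
    then show "lr_bound r b (1 / (1 - \<theta>) * (M0 + M1))"
      using b True \<open>C \<ge> 0\<close> by (auto simp: lr_bound_def C_def)
  qed (use \<theta> in auto)
next
  case False
  define q where "q = enn2real r"
  have q: "q \<ge> 1" using enn2real_ge_1[OF r False] by (simp add: q_def)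
  define c where "c = (1 - \<theta>) powr (1 - q)"
  have c: "c \<ge> 0" by (simp add: c_def)
  \<comment> \<open>The 1 accounts for the part at and above K; the quotient is what the absorption
    argument yields for the part below K.\<close>
  define D where "D = 1 + (\<theta> + c) / (1 - \<theta>)"
  have D: "D > 0" using \<theta> c by (auto simp: D_def intro!: add_pos_nonneg)
  show ?thesis
  proof (rule that[of "D powr (1 / q)"])
    fix b h M0 M1
    assume b: "\<And>k. 0 \<le> b k" and rec: "\<And>k. k < K \<Longrightarrow> b k \<le> \<theta> * b (k + 1) + h k"
      and h: "lr_bound r h M1" and b0: "lr_bound r (\<lambda>k. if K \<le> k then b k else 0) M0"
    have nn: "0 \<le> M0" "0 \<le> M1" "\<And>k. 0 \<le> h k" using h b0 by (auto simp: lr_bound_def)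
    have hF: "(\<Sum>k\<in>F. h k powr q) \<le> M1 powr q" if "finite F" for F
      using h that False by (auto simp: lr_bound_def q_def)
    have bF: "(\<Sum>k\<in>F. b k powr q) \<le> M0 powr q" if "finite F" "F \<subseteq> {K..}" for F
    proof -
      have "(\<Sum>k\<in>F. b k powr q) = (\<Sum>k\<in>F. (if K \<le> k then b k else 0) powr q)"
        using that by (intro sum.cong) auto
      also have "\<dots> \<le> M0 powr q" using b0 that False by (auto simp: lr_bound_def q_def)
      finally show ?thesis .
    qed
    have recq: "b k powr q \<le> \<theta> * b (k + 1) powr q + c * h k powr q" if "k < K" for k
    proof -
      have "b k powr q \<le> (\<theta> * b (k + 1) + h k) powr q" using rec[OF that] b q by (intro powr_mono2) auto
      \<comment> \<open>The weight t = 1 - \<theta> is chosen so that \<theta>^(1 - q) \<theta>^q =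
        \<theta>: the contraction factor survives the passage to q-th powers unchanged.\<close>
      also have "\<dots> \<le> (1 - (1 - \<theta>)) powr (1 - q) * (\<theta> * b (k + 1)) powr q + (1 - \<theta>) powr (1 - q) * h k powr q"
        using q \<theta> b nn by (intro powr_add_weighted) auto
      also have "(1 - (1 - \<theta>)) powr (1 - q) * (\<theta> * b (k + 1)) powr q = (\<theta> powr (1 - q) * \<theta> powr q) * b (k + 1) powr q"
        by (simp add: powr_mult mult_ac)
      also have "\<theta> powr (1 - q) * \<theta> powr q = \<theta>" using \<theta> by (simp add: powr_add[symmetric])
      finally show ?thesis by (simp add: c_def)
    qed
    have low: "(\<Sum>k\<in>{K - int j..<K}. b k powr q) \<le> (\<theta> * M0 powr q + c * M1 powr q) / (1 - \<theta>)" for j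
    proof -
      let ?S = "\<Sum>k\<in>{K - int j..<K}. b k powr q"
      have "?S \<le> (\<Sum>k\<in>{K - int j..<K}. \<theta> * b (k + 1) powr q + c * h k powr q)"
        by (intro sum_mono recq) auto
      also have "\<dots> = \<theta> * (\<Sum>k\<in>{K - int j..<K}. b (k + 1) powr q) + c * (\<Sum>k\<in>{K - int j..<K}. h k powr q)"
        by (simp add: sum.distrib sum_distrib_left)
      \<comment> \<open>Shifting the window by one adds at most the index K, whose term is already
        bounded by M0.\<close>
      also have "\<dots> \<le> \<theta> * (?S + M0 powr q) + c * M1 powr q"
      proof (intro add_mono mult_left_mono hF)
        have "(\<Sum>k\<in>{K - int j..<K}. b (k + 1) powr q) = (\<Sum>k\<in>(\<lambda>k. k + 1) ` {K - int j..<K}. b k powr q)"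
          by (subst sum.reindex) auto
        also have "\<dots> \<le> (\<Sum>k\<in>{K - int j..<K} \<union> {K}. b k powr q)"
          by (intro sum_mono2) auto
        also have "\<dots> = ?S + b K powr q" by (subst sum.union_disjoint) auto
        also have "b K powr q \<le> M0 powr q" using bF[of "{K}"] by simp
        finally show "(\<Sum>k\<in>{K - int j..<K}. b (k + 1) powr q) \<le> ?S + M0 powr q" by simp
      qed (use \<theta> c in auto)
      finally have "?S * (1 - \<theta>) \<le> \<theta> * M0 powr q + c * M1 powr q" by (simp add: algebra_simps)
      then show ?thesis using \<theta> by (simp add: pos_le_divide_eq)
    qed
    have "(\<Sum>k\<in>F. b k powr q) \<le> (D powr (1 / q) * (M0 + M1)) powr q" if F: "finite F" for F
    proof -
      have "(\<Sum>k\<in>F. b k powr q) = (\<Sum>k\<in>F \<inter> {K..}. b k powr q) + (\<Sum>k\<in>F \<inter> {..<K}. b k powr q)"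
        using F by (subst sum.union_disjoint[symmetric]) (auto intro!: sum.cong)
      also have "\<dots> \<le> M0 powr q + (\<theta> * M0 powr q + c * M1 powr q) / (1 - \<theta>)"
      proof (rule add_mono)
        show "(\<Sum>k\<in>F \<inter> {K..}. b k powr q) \<le> M0 powr q" using F by (intro bF) auto
        have "\<exists>j. F \<inter> {..<K} \<subseteq> {K - int j..<K}"
        proof (cases "F = {}")
          case False
          have "K - int (nat (K - Min F)) \<le> k" if "k \<in> F" "k < K" for k
            using Min_le[OF F that(1)] that by simp
          then show ?thesis by (intro exI[of _ "nat (K - Min F)"]) auto
        qed auto
        then obtain j where "F \<inter> {..<K} \<subseteq> {K - int j..<K}" by blast
        then have "(\<Sum>k\<in>F \<inter> {..<K}. b k powr q) \<le> (\<Sum>k\<in>{K - int j..<K}. b k powr q)"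
          by (intro sum_mono2) auto
        also note low[of j]
        finally show "(\<Sum>k\<in>F \<inter> {..<K}. b k powr q) \<le> (\<theta> * M0 powr q + c * M1 powr q) / (1 - \<theta>)" .
      qed
      also have "\<dots> \<le> (M0 + M1) powr q + (\<theta> * (M0 + M1) powr q + c * (M0 + M1) powr q) / (1 - \<theta>)"
        using nn \<theta> c q by (intro add_mono divide_right_mono mult_left_mono powr_mono2) auto
      also have "\<dots> = D * (M0 + M1) powr q" using \<theta> by (simp add: D_def field_simps)
      also have "\<dots> = (D powr (1 / q) * (M0 + M1)) powr q" using D q by (simp add: powr_mult powr_powr)
      finally show ?thesis .
    qed
    then show "lr_bound r b (D powr (1 / q) * (M0 + M1))"
      using b nn False by (auto simp: lr_bound_def q_def)
  qed (use D in auto)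
qed

section \<open>Sequence bounds versus Herz norms\<close>

text \<open>Without finiteness the supremum or infinite sum in \<open>herz_outer\<close> may be a
  default value that says nothing about the sequence; this is why \<open>fin\<close>
  appears.\<close>

lemma lr_bound_herz_outer:
  assumes r: "1 \<le> r" and a: "\<And>k. 0 \<le> a k" and fin: "herz_outer_finite \<alpha> r a"
  shows "lr_bound r (\<lambda>k. 2 powr (real_of_int k * \<alpha>) * a k) (herz_outer \<alpha> r a)"
proof (cases "r = \<infinity>")
  case True
  have bdd: "bdd_above (range (\<lambda>k. 2 powr (real_of_int k * \<alpha>) * a k))"
    using fin True by (simp add: herz_outer_finite_def)
  have le: "2 powr (real_of_int k * \<alpha>) * a k \<le> herz_outer \<alpha> r a" for k
    using cSUP_upper[OF _ bdd, of k] True by (simp add: herz_outer_def)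
  have "0 \<le> 2 powr (real_of_int 0 * \<alpha>) * a 0" using a by simp
  also note le[of 0]
  finally show ?thesis using True a le by (simp add: lr_bound_def)
next
  case False
  define q where "q = enn2real r"
  have q: "q \<ge> 1" using enn2real_ge_1[OF r False] by (simp add: q_def)
  let ?b = "\<lambda>k. 2 powr (real_of_int k * \<alpha>) * a k"
  have sm: "(\<lambda>k. ?b k powr q) summable_on UNIV" using fin False by (simp add: herz_outer_finite_def q_def)
  let ?S = "\<Sum>\<^sub>\<infinity>k. ?b k powr q"
  have S: "?S \<ge> 0" by (intro infsum_nonneg) auto
  have eq: "herz_outer \<alpha> r a powr q = ?S" using S q False by (simp add: herz_outer_def q_def[symmetric] powr_powr)
  have "(\<Sum>k\<in>F. ?b k powr q) \<le> ?S" if "finite F" for F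
    by (rule finite_sum_le_infsum[OF sm that]) auto
  then show ?thesis using a False eq by (auto simp: lr_bound_def q_def[symmetric]) (simp add: herz_outer_def)
qed

lemma herz_outer_le:
  assumes r: "1 \<le> r" and b: "lr_bound r (\<lambda>k. 2 powr (real_of_int k * \<alpha>) * a k) M"
  shows "herz_outer_finite \<alpha> r a" "herz_outer \<alpha> r a \<le> M"
proof -
  let ?b = "\<lambda>k. 2 powr (real_of_int k * \<alpha>) * a k"
  have "herz_outer_finite \<alpha> r a \<and> herz_outer \<alpha> r a \<le> M"
  proof (cases "r = \<infinity>")
    case True
    have le: "?b k \<le> M" for k using b True by (simp add: lr_bound_def)
    then have "herz_outer_finite \<alpha> r a" using True by (auto simp: herz_outer_finite_def intro!: bdd_aboveI[of _ M])
    moreover have "herz_outer \<alpha> r a \<le> M" using True le by (auto simp: herz_outer_def intro!: cSUP_least)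
    ultimately show ?thesis by simp
  next
    case False
    define q where "q = enn2real r"
    have q: "q \<ge> 1" using enn2real_ge_1[OF r False] by (simp add: q_def)
    have M: "M \<ge> 0" and F: "(\<Sum>k\<in>F. ?b k powr q) \<le> M powr q" if "finite F" for F
      using b that False by (auto simp: lr_bound_def q_def)
    have sm: "(\<lambda>k. ?b k powr q) summable_on UNIV"
      by (rule nonneg_bdd_above_summable_on) (auto intro!: bdd_aboveI[of _ "M powr q"] F)
    have "(\<Sum>\<^sub>\<infinity>k. ?b k powr q) \<le> M powr q" by (rule infsum_le_finite_sums[OF sm]) (use F in auto)
    then have "(\<Sum>\<^sub>\<infinity>k. ?b k powr q) powr (1 / q) \<le> (M powr q) powr (1 / q)"
      using q by (intro powr_mono2 infsum_nonneg) auto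
    also have "\<dots> = M" using q M[of "{}"] by (simp add: powr_powr)
    finally show ?thesis using sm False by (simp add: herz_outer_def herz_outer_finite_def q_def)
  qed
  then show "herz_outer_finite \<alpha> r a" "herz_outer \<alpha> r a \<le> M" by auto
qed

subsection \<open>The estimate for weak derivatives\<close>

text \<open>After division by x + y both numbers lie in [0, 1], where z is at most z^e. With e = 1/p
  this extracts the p-th root of the recursion.\<close>

lemma powr_add_subadditive:
  fixes x y e :: real
  assumes "0 \<le> x" "0 \<le> y" "0 < e" "e \<le> 1"
  shows "(x + y) powr e \<le> x powr e + y powr e"
proof (cases "x + y = 0")
  case False
  then have s: "x + y > 0" using assms by linarith
  have *: "z / (x + y) \<le> (z / (x + y)) powr e" if "0 \<le> z" "z \<le> x + y" for z
    using powr_mono'[of e 1 "z / (x + y)"] that s assms by auto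
  have "1 = x / (x + y) + y / (x + y)" using s by (simp add: add_divide_distrib[symmetric])
  also have "\<dots> \<le> (x / (x + y)) powr e + (y / (x + y)) powr e" using assms by (intro add_mono *) auto
  also have "\<dots> = (x powr e + y powr e) / (x + y) powr e" using assms by (simp add: powr_divide add_divide_distrib)
  finally show ?thesis using s by (simp add: field_simps)
qed (use assms in auto)

lemma powr_sum_subadditive:
  fixes f :: "'b \<Rightarrow> real"
  assumes "finite I" "\<And>i. i \<in> I \<Longrightarrow> 0 \<le> f i" "0 < e" "e \<le> 1"
  shows "(\<Sum>i\<in>I. f i) powr e \<le> (\<Sum>i\<in>I. f i powr e)"
  using assms
proof (induction I rule: finite_induct)
  case (insert i I)
  have "(\<Sum>j\<in>insert i I. f j) powr e \<le> f i powr e + (\<Sum>j\<in>I. f j) powr e"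
    using insert by (simp add: powr_add_subadditive sum_nonneg)
  also have "\<dots> \<le> f i powr e + (\<Sum>j\<in>I. f j powr e)" using insert by simp
  finally show ?case using insert by simp
qed simp

section \<open>Borel representatives and integrals over annuli\<close>

lemma annulus_cover:
  assumes "x \<noteq> 0"
  shows "\<exists>k. x \<in> annulus k"
proof -
  define k where "k = \<lfloor>log 2 (norm x)\<rfloor> + 1"
  have "real_of_int k - 1 \<le> log 2 (norm x)" "log 2 (norm x) < real_of_int k"
    using floor_correct[of "log 2 (norm x)"] by (auto simp: k_def)
  then have "x \<in> annulus k" using assms by (simp add: annulus_def le_log_iff log_less_iff)
  then show ?thesis by blast
qed

lemma Lp_norm_nonneg: "0 \<le> Lp_norm p S f"
  by (simp add: Lp_norm_def)

text \<open>Measurability is given on each annulus separately; the annuli and {0} form a countable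
  cover, so the pieces glue together. A Borel representative is wanted because it composes with (c,
  x) -> x / c to a function measurable on the product, as Tonelli requires.\<close>

lemma borel_version:
  fixes g :: "'a::euclidean_space \<Rightarrow> real"
  assumes \<Omega>: "\<Omega> \<in> sets borel" and g: "\<And>k. g \<in> borel_measurable (lebesgue_on (annulus k \<inter> \<Omega>))"
  shows "g \<in> borel_measurable (lebesgue_on \<Omega>)"
    and "\<exists>h\<in>borel_measurable borel. AE x in lborel. x \<in> \<Omega> \<longrightarrow> g x = h x"
proof -
  have [measurable]: "\<Omega> \<in> sets borel" by (rule \<Omega>)
  define h where "h x = (if x \<in> \<Omega> then g x else 0)" for x
  have A_leb: "annulus k \<in> sets lebesgue" for k :: int by auto
  have h: "h \<in> borel_measurable lebesgue"
  proof (rule measurable_piecewise_restrict)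
    let ?C = "insert {0} (range annulus) :: 'a set set"
    show "countable ?C" by auto
    show "space lebesgue \<subseteq> \<Union> ?C" using annulus_cover by auto
    fix A :: "'a set" assume A: "A \<in> ?C"
    show "A \<inter> space lebesgue \<in> sets lebesgue" using A by auto
    show "h \<in> borel_measurable (restrict_space lebesgue A)"
    proof (cases "A = {0}")
      case True
      have "(\<lambda>x. h 0) \<in> borel_measurable (lebesgue_on A)" by simp
      moreover have "\<And>x. x \<in> space (lebesgue_on A) \<Longrightarrow> h x = h 0" using True by simp
      ultimately show ?thesis using measurable_cong[of "lebesgue_on A" h "\<lambda>x. h 0"] by blast
    next
      case False
      then obtain k where k: "A = annulus k" using A by auto
      have "(\<lambda>x. if x \<in> annulus k \<inter> \<Omega> then g x else 0) \<in> borel_measurable lebesgue"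
        using g[of k] by (subst borel_measurable_if) auto
      also have "(\<lambda>x. if x \<in> annulus k \<inter> \<Omega> then g x else 0) = (\<lambda>x. if x \<in> A then h x else 0)"
        by (auto simp: h_def k)
      finally show ?thesis using A_leb[of k] k by (subst (asm) borel_measurable_if) auto
    qed
  qed
  show "g \<in> borel_measurable (lebesgue_on \<Omega>)"
    using h unfolding h_def by (subst (asm) borel_measurable_if) auto
  obtain h' where h': "h' \<in> borel_measurable lborel" "AE x in lborel. h x = h' x"
    using completion_ex_borel_measurable_real[OF h] by blast
  show "\<exists>h\<in>borel_measurable borel. AE x in lborel. x \<in> \<Omega> \<longrightarrow> g x = h x"
  proof
    show "AE x in lborel. x \<in> \<Omega> \<longrightarrow> g x = h' x" using h'(2) by eventually_elim (auto simp: h_def)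
  qed (use h'(1) in simp)
qed

lemma integral_lebesgue_on_eq_lborel:
  fixes g :: "'a::euclidean_space \<Rightarrow> real"
  assumes \<Omega>: "\<Omega> \<in> sets borel" and g: "g \<in> borel_measurable (lebesgue_on \<Omega>)"
    and h [measurable]: "h \<in> borel_measurable borel" and ae: "AE x in lborel. x \<in> \<Omega> \<longrightarrow> g x = h x"
    and \<phi> [measurable]: "\<phi> \<in> borel_measurable borel" and zero: "\<And>x. x \<notin> \<Omega> \<Longrightarrow> \<phi> x = 0"
  shows "integral\<^sup>L (lebesgue_on \<Omega>) (\<lambda>x. g x * \<phi> x) = (\<integral>x. h x * \<phi> x \<partial>lborel)"
proof -
  have "(\<lambda>x. if x \<in> \<Omega> then g x else 0) \<in> borel_measurable lebesgue"
    using g \<Omega> by (subst borel_measurable_if) auto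
  moreover have \<phi>': "\<phi> \<in> borel_measurable lebesgue" "h \<in> borel_measurable lebesgue"
    by (auto intro: measurable_completion)
  ultimately have m: "(\<lambda>x. (if x \<in> \<Omega> then g x else 0) * \<phi> x) \<in> borel_measurable lebesgue"
    by (intro borel_measurable_times)
  have "integral\<^sup>L (lebesgue_on \<Omega>) (\<lambda>x. g x * \<phi> x) = (\<integral>x. indicator \<Omega> x *\<^sub>R (g x * \<phi> x) \<partial>lebesgue)"
    using \<Omega> by (intro integral_restrict_space) auto
  also have "\<dots> = (\<integral>x. (if x \<in> \<Omega> then g x else 0) * \<phi> x \<partial>lebesgue)"
    by (intro Bochner_Integration.integral_cong) (auto simp: indicator_def)
  also have "\<dots> = (\<integral>x. h x * \<phi> x \<partial>lebesgue)"
  proof (rule integral_cong_AE[OF m])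
    show "(\<lambda>x. h x * \<phi> x) \<in> borel_measurable lebesgue" using \<phi>' by (intro borel_measurable_times)
    show "AE x in lebesgue. (if x \<in> \<Omega> then g x else 0) * \<phi> x = h x * \<phi> x"
      using AE_completion[OF ae] by eventually_elim (auto simp: zero)
  qed
  also have "\<dots> = (\<integral>x. h x * \<phi> x \<partial>lborel)" by (rule integral_completion) auto
  finally show ?thesis .
qed

lemma nn_integral_Lp_norm:
  fixes g :: "'a::euclidean_space \<Rightarrow> real"
  assumes p: "p > 0" and A: "A \<in> sets borel" and sub: "A \<subseteq> \<Omega>" and g: "Lp_on p A g"
    and h [measurable]: "h \<in> borel_measurable borel" and ae: "AE x in lborel. x \<in> \<Omega> \<longrightarrow> g x = h x"
  shows "(\<integral>\<^sup>+x. indicator A x * ennreal (\<bar>h x\<bar> powr p) \<partial>lborel) = ennreal (Lp_norm p A g powr p)"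
proof -
  have int: "integrable (lebesgue_on A) (\<lambda>x. \<bar>g x\<bar> powr p)" using g by (simp add: Lp_on_def)
  have "0 \<le> integral\<^sup>L (lebesgue_on A) (\<lambda>x. \<bar>g x\<bar> powr p)" by (intro integral_nonneg_AE) auto
  then have "Lp_norm p A g powr p = integral\<^sup>L (lebesgue_on A) (\<lambda>x. \<bar>g x\<bar> powr p)"
    using p by (simp add: Lp_norm_def powr_powr)
  then have "ennreal (Lp_norm p A g powr p) = (\<integral>\<^sup>+x. ennreal (\<bar>g x\<bar> powr p) \<partial>lebesgue_on A)"
    using nn_integral_eq_integral[OF int] by simp
  also have "\<dots> = (\<integral>\<^sup>+x. ennreal (\<bar>g x\<bar> powr p) * indicator A x \<partial>lebesgue)"
    using A by (intro nn_integral_restrict_space) auto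
  also have "\<dots> = (\<integral>\<^sup>+x. indicator A x * ennreal (\<bar>h x\<bar> powr p) \<partial>lebesgue)"
  proof (rule nn_integral_cong_AE)
    show "AE x in lebesgue. ennreal (\<bar>g x\<bar> powr p) * indicator A x = indicator A x * ennreal (\<bar>h x\<bar> powr p)"
      using AE_completion[OF ae] by eventually_elim (use sub in \<open>auto simp: indicator_def\<close>)
  qed
  also have "\<dots> = (\<integral>\<^sup>+x. indicator A x * ennreal (\<bar>h x\<bar> powr p) \<partial>lborel)"
    by (rule nn_integral_completion)
  finally show ?thesis by simp
qed

lemma annulus_subset_shell:
  "annulus k \<subseteq> {x::'a::euclidean_space. 2 powr (real_of_int k - 2) < norm x \<and> norm x < 2 powr (real_of_int k + 1)}"
  "annulus (k + 1) \<subseteq> {x::'a. 2 powr (real_of_int k - 2) < norm x \<and> norm x < 2 powr (real_of_int k + 1)}"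
proof -
  have *: "2 powr (real_of_int k - 2) < 2 powr (real_of_int k - 1)" "2 powr (real_of_int k - 2) < 2 powr (real_of_int k)"
    "2 powr (real_of_int k) < 2 powr (real_of_int k + 1)" by auto
  then show "annulus k \<subseteq> {x::'a. 2 powr (real_of_int k - 2) < norm x \<and> norm x < 2 powr (real_of_int k + 1)}"
    "annulus (k + 1) \<subseteq> {x::'a. 2 powr (real_of_int k - 2) < norm x \<and> norm x < 2 powr (real_of_int k + 1)}"
    by (auto simp: annulus_def simp del: powr_less_cancel_iff)
qed

lemma norm_shell_in_annuli:
  assumes "2 powr (real_of_int k - 2) < norm x" "norm x < 2 powr (real_of_int k + 1)"
  shows "x \<in> annulus (k - 1) \<union> annulus k \<union> annulus (k + 1)"
proof -
  have "real_of_int (k - 1) - 1 = real_of_int k - 2" "real_of_int (k + 1) - 1 = real_of_int k"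
    "real_of_int (k - 1) = real_of_int k - 1" "real_of_int (k + 1) = real_of_int k + 1" by auto
  then show ?thesis using assms unfolding annulus_def Un_iff mem_Collect_eq by (simp only:) argo
qed

text \<open>The shell has finite measure and meets only three annuli, and |h| is at most 1 + |h|^p.
  This turns p-integrability into the plain integrability that the dilation formula needs.\<close>

lemma shell_integrable:
  fixes h :: "'a::euclidean_space \<Rightarrow> real"
  assumes p: "p \<ge> 1" and h [measurable]: "h \<in> borel_measurable borel"
    and fin: "\<And>j. j \<le> k + 1 \<Longrightarrow> (\<integral>\<^sup>+x. indicator (annulus j) x * ennreal (\<bar>h x\<bar> powr p) \<partial>lborel) < \<infinity>"
  shows "integrable lborel (\<lambda>x. indicator {x. 2 powr (real_of_int k - 2) < norm x \<and> norm x < 2 powr (real_of_int k + 1)} x * h x)"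
proof (rule integrableI_bounded)
  let ?S = "{x::'a. 2 powr (real_of_int k - 2) < norm x \<and> norm x < 2 powr (real_of_int k + 1)}"
  have [measurable]: "?S \<in> sets borel" using open_shell by (intro borel_open)
  show "(\<lambda>x. indicator ?S x * h x) \<in> borel_measurable lborel" by measurable
  let ?N = "\<lambda>j x. indicator (annulus j) x * ennreal (\<bar>h x\<bar> powr p)"
  have "(\<integral>\<^sup>+x. ennreal (norm (indicator ?S x * h x)) \<partial>lborel) \<le> (\<integral>\<^sup>+x. indicator ?S x + (?N (k - 1) x + ?N k x + ?N (k + 1) x) \<partial>lborel)"
  proof (rule nn_integral_mono)
    fix x :: 'a
    show "ennreal (norm (indicator ?S x * h x)) \<le> indicator ?S x + (?N (k - 1) x + ?N k x + ?N (k + 1) x)"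
    proof (cases "x \<in> ?S")
      case True
      have "\<bar>h x\<bar> \<le> 1 + \<bar>h x\<bar> powr p"
      proof (cases "\<bar>h x\<bar> \<le> 1")
        case False
        then have "\<bar>h x\<bar> powr 1 \<le> \<bar>h x\<bar> powr p" using p by (intro powr_mono) auto
        then show ?thesis using False by simp
      qed (simp add: add_increasing2)
      then have "ennreal \<bar>h x\<bar> \<le> ennreal (1 + \<bar>h x\<bar> powr p)" by (rule ennreal_leI)
      then have "ennreal \<bar>h x\<bar> \<le> 1 + ennreal (\<bar>h x\<bar> powr p)" by simp
      moreover have "ennreal (\<bar>h x\<bar> powr p) \<le> ?N (k - 1) x + ?N k x + ?N (k + 1) x"
        using norm_shell_in_annuli[of k x] True by (auto simp: indicator_def add_increasing add_increasing2)
      ultimately show ?thesis using True by (auto intro: order_trans add_left_mono)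
    qed simp
  qed
  also have "\<dots> = emeasure lborel ?S + ((\<integral>\<^sup>+x. ?N (k - 1) x \<partial>lborel) + (\<integral>\<^sup>+x. ?N k x \<partial>lborel) + (\<integral>\<^sup>+x. ?N (k + 1) x \<partial>lborel))"
    by (simp add: nn_integral_add)
  also have "\<dots> < \<infinity>"
  proof -
    have "?S \<subseteq> ball 0 (2 powr (real_of_int k + 1))" by auto
    then have "bounded ?S" using bounded_ball bounded_subset by blast
    then have "emeasure lborel ?S < \<infinity>" by (rule emeasure_bounded_finite)
    then show ?thesis using fin[of "k - 1"] fin[of k] fin[of "k + 1"] by auto
  qed
  finally show "(\<integral>\<^sup>+x. ennreal (norm (indicator ?S x * h x)) \<partial>lborel) < \<infinity>" .
qed

text \<open>The functions are replaced by Borel representatives cut off to an open shell inside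
  \<Omega>, so that they become integrable on the whole space. The weak derivative relation persists
  for test functions supported in that shell.\<close>

lemma Lp_norm_powr_step:
  fixes g :: "'a::euclidean_space \<Rightarrow> real" and g' :: "'a \<Rightarrow> 'a \<Rightarrow> real"
  assumes p: "p > 1" and t: "0 < t" "t < 1" and "open \<Omega>" and ball: "\<And>x. norm x < 2 powr (real_of_int k + 1) \<Longrightarrow> x \<in> \<Omega>"
    and g: "\<And>j. Lp_on p (annulus j \<inter> \<Omega>) g" and g': "\<And>i j. i \<in> Basis \<Longrightarrow> Lp_on p (annulus j \<inter> \<Omega>) (g' i)"
    and weak: "\<And>i \<phi>. i \<in> Basis \<Longrightarrow> test_fun \<Omega> \<phi> \<Longrightarrow>
      integral\<^sup>L (lebesgue_on \<Omega>) (\<lambda>x. g x * pdir i \<phi> x) = - integral\<^sup>L (lebesgue_on \<Omega>) (\<lambda>x. g' i x * \<phi> x)"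
  shows "Lp_norm p (annulus k \<inter> \<Omega>) g powr p \<le>
      (1 - t) powr (1 - p) / 2 ^ DIM('a) * Lp_norm p (annulus (k + 1) \<inter> \<Omega>) g powr p +
      t powr (1 - p) * (4 * 2 powr k * DIM('a)) powr p *
        (\<Sum>i\<in>Basis. Lp_norm p (annulus k \<inter> \<Omega>) (g' i) powr p + Lp_norm p (annulus (k + 1) \<inter> \<Omega>) (g' i) powr p)"
proof -
  have \<Omega>: "\<Omega> \<in> sets borel" using \<open>open \<Omega>\<close> by simp
  have sub: "annulus j \<subseteq> \<Omega>" if "j \<le> k + 1" for j
  proof
    fix x :: 'a assume "x \<in> annulus j"
    then have "norm x < 2 powr real_of_int j" by (simp add: annulus_def)
    also have "\<dots> \<le> 2 powr (real_of_int k + 1)" using that by (intro powr_mono) auto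
    finally show "x \<in> \<Omega>" by (rule ball)
  qed
  have gm: "\<And>j. g \<in> borel_measurable (lebesgue_on (annulus j \<inter> \<Omega>))"
    and g'm: "\<And>i j. i \<in> Basis \<Longrightarrow> g' i \<in> borel_measurable (lebesgue_on (annulus j \<inter> \<Omega>))"
    using g g' by (auto simp: Lp_on_def)
  obtain h where h [measurable]: "h \<in> borel_measurable borel" and hae: "AE x in lborel. x \<in> \<Omega> \<longrightarrow> g x = h x"
    using borel_version(2)[OF \<Omega> gm] by blast
  have "\<forall>i\<in>Basis. \<exists>h\<in>borel_measurable borel. AE x in lborel. x \<in> \<Omega> \<longrightarrow> g' i x = h x"
    using borel_version(2)[OF \<Omega> g'm] by blast
  then obtain h' where h': "\<And>i. i \<in> Basis \<Longrightarrow> h' i \<in> borel_measurable borel"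
    and h'ae: "\<And>i. i \<in> Basis \<Longrightarrow> AE x in lborel. x \<in> \<Omega> \<longrightarrow> g' i x = h' i x"
    by metis
  note [measurable] = h'
  \<comment> \<open>The inner radius 2^(k - 2) lies strictly below \<open>annulus k\<close>, so the
    annulus, inner boundary included, sits in the open set where the dilation formula holds. The
    outer radius 2^(k + 1) halves to 2^k.\<close>
  define S where "S = {x::'a. 2 powr (real_of_int k - 2) < norm x \<and> norm x < 2 powr (real_of_int k + 1)}"
  have S_borel [measurable]: "S \<in> sets borel" unfolding S_def using open_shell by (intro borel_open)
  have S\<Omega>: "S \<subseteq> \<Omega>" unfolding S_def using ball by auto
  define u where "u x = indicator S x * h x" for x
  define v where "v i x = indicator S x * h' i x" for i x
  have N: "(\<integral>\<^sup>+x. indicator (annulus j) x * ennreal (\<bar>h x\<bar> powr p) \<partial>lborel) = ennreal (Lp_norm p (annulus j \<inter> \<Omega>) g powr p)"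
    if "j \<le> k + 1" for j
    using nn_integral_Lp_norm[of p "annulus j \<inter> \<Omega>", OF _ _ _ g h hae] p \<Omega> sub[OF that] by (simp add: inf.absorb1)
  have N': "(\<integral>\<^sup>+x. indicator (annulus j) x * ennreal (\<bar>h' i x\<bar> powr p) \<partial>lborel) = ennreal (Lp_norm p (annulus j \<inter> \<Omega>) (g' i) powr p)"
    if "j \<le> k + 1" "i \<in> Basis" for j i
    using nn_integral_Lp_norm[of p "annulus j \<inter> \<Omega>", OF _ _ _ g'[OF that(2)] h'[OF that(2)] h'ae[OF that(2)]] p \<Omega> sub[OF that(1)]
    by (simp add: inf.absorb1)
  have u_int: "integrable lborel u"
    unfolding u_def S_def by (rule shell_integrable[of p]) (use p N in auto)
  have v_int: "integrable lborel (v i)" if "i \<in> Basis" for i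
    unfolding v_def S_def by (rule shell_integrable[of p]) (use p N' that in auto)
  have step: "AE x in lborel. 2 powr (real_of_int k - 2) < norm x \<and> norm x < 2 powr (real_of_int k + 1) / 2 \<longrightarrow>
      u (2 *\<^sub>R x) - u x = dilation_mean v x"
  proof (rule dilation_difference)
    fix i :: 'a and \<phi> :: "'a \<Rightarrow> real"
    assume i: "i \<in> Basis" and "test_fun {x. 2 powr (real_of_int k - 2) < norm x \<and> norm x < 2 powr (real_of_int k + 1)} \<phi>"
    then have \<phi>: "test_fun S \<phi>" by (simp add: S_def)
    have \<phi>': "test_fun S (pdir i \<phi>)" by (rule test_fun_pdir[OF \<phi> i])
    note \<phi>\<Omega> = test_fun_mono[OF \<phi> S\<Omega>] test_fun_mono[OF \<phi>' S\<Omega>]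
    have "(\<integral>x. u x * pdir i \<phi> x \<partial>lborel) = (\<integral>x. h x * pdir i \<phi> x \<partial>lborel)"
      using test_fun_eq_0[OF \<phi>'] by (intro Bochner_Integration.integral_cong) (auto simp: u_def indicator_def)
    also have "\<dots> = integral\<^sup>L (lebesgue_on \<Omega>) (\<lambda>x. g x * pdir i \<phi> x)"
      by (rule integral_lebesgue_on_eq_lborel[symmetric, OF \<Omega> borel_version(1)[OF \<Omega> gm] h hae test_fun_borel[OF \<phi>']])
        (use test_fun_eq_0[OF \<phi>\<Omega>(2)] in auto)
    also have "\<dots> = - integral\<^sup>L (lebesgue_on \<Omega>) (\<lambda>x. g' i x * \<phi> x)" by (rule weak[OF i \<phi>\<Omega>(1)])
    also have "integral\<^sup>L (lebesgue_on \<Omega>) (\<lambda>x. g' i x * \<phi> x) = (\<integral>x. h' i x * \<phi> x \<partial>lborel)"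
      by (rule integral_lebesgue_on_eq_lborel[OF \<Omega> borel_version(1)[OF \<Omega> g'm[OF i]] h'[OF i] h'ae[OF i] test_fun_borel[OF \<phi>]])
        (use test_fun_eq_0[OF \<phi>\<Omega>(1)] in auto)
    also have "\<dots> = (\<integral>x. v i x * \<phi> x \<partial>lborel)"
      using test_fun_eq_0[OF \<phi>] by (intro Bochner_Integration.integral_cong) (auto simp: v_def indicator_def)
    finally show "(\<integral>x. u x * pdir i \<phi> x \<partial>lborel) = - (\<integral>x. v i x * \<phi> x \<partial>lborel)" .
  qed (use u_int v_int in auto)
  have shell: "2 powr (real_of_int k - 2) < norm x \<and> norm x < 2 powr (real_of_int k + 1) / 2" if "x \<in> annulus k" for x :: 'a
  proof -
    have "2 powr (real_of_int k - 2) < 2 powr (real_of_int k - 1)" by simp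
    moreover have "2 powr (real_of_int k + 1) / 2 = 2 powr real_of_int k" by (simp add: powr_add)
    ultimately show ?thesis using that by (auto simp: annulus_def simp del: powr_less_cancel_iff)
  qed
  have AS: "annulus k \<subseteq> S" "annulus (k + 1) \<subseteq> S"
    unfolding S_def by (rule annulus_subset_shell)+
  have eqN: "(\<integral>\<^sup>+x. indicator (annulus j) x * ennreal (\<bar>indicator S x * w x\<bar> powr p) \<partial>lborel) = (\<integral>\<^sup>+x. indicator (annulus j) x * ennreal (\<bar>w x\<bar> powr p) \<partial>lborel)"
    if "j = k \<or> j = k + 1" for j and w :: "'a \<Rightarrow> real"
    using AS that by (intro nn_integral_cong) (auto simp: indicator_def)
  have um: "u \<in> borel_measurable borel" unfolding u_def by measurable
  have vm: "v i \<in> borel_measurable borel" if "i \<in> Basis" for i unfolding v_def using that by measurable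
  have "AE x in lborel. x \<in> annulus k \<longrightarrow> u (2 *\<^sub>R x) - u x = dilation_mean v x"
    using step by eventually_elim (use shell in blast)
  from annulus_step[OF less_imp_le[OF p] t um vm this]
  have main: "ennreal (Lp_norm p (annulus k \<inter> \<Omega>) g powr p) \<le>
    ennreal ((1 - t) powr (1 - p) / 2 ^ DIM('a)) * ennreal (Lp_norm p (annulus (k + 1) \<inter> \<Omega>) g powr p) +
    ennreal (t powr (1 - p) * (4 * 2 powr k * DIM('a)) powr p) *
    (\<Sum>i\<in>Basis. \<integral>\<^sup>+x. indicator (annulus k \<union> annulus (k + 1)) x * ennreal (\<bar>v i x\<bar> powr p) \<partial>lborel)"
    unfolding u_def by (simp add: eqN N)
  have sum_le: "(\<Sum>i\<in>Basis. \<integral>\<^sup>+x. indicator (annulus k \<union> annulus (k + 1)) x * ennreal (\<bar>v i x\<bar> powr p) \<partial>lborel)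
    \<le> (\<Sum>i\<in>Basis. ennreal (Lp_norm p (annulus k \<inter> \<Omega>) (g' i) powr p + Lp_norm p (annulus (k + 1) \<inter> \<Omega>) (g' i) powr p))"
  proof (rule sum_mono)
    fix i :: 'a assume i: "i \<in> Basis"
    note [measurable] = vm[OF i]
    have "(\<integral>\<^sup>+x. indicator (annulus k \<union> annulus (k + 1)) x * ennreal (\<bar>v i x\<bar> powr p) \<partial>lborel) \<le>
      (\<integral>\<^sup>+x. indicator (annulus k) x * ennreal (\<bar>v i x\<bar> powr p) + indicator (annulus (k + 1)) x * ennreal (\<bar>v i x\<bar> powr p) \<partial>lborel)"
      by (intro nn_integral_mono) (auto simp: indicator_def)
    also have "\<dots> = (\<integral>\<^sup>+x. indicator (annulus k) x * ennreal (\<bar>v i x\<bar> powr p) \<partial>lborel) + (\<integral>\<^sup>+x. indicator (annulus (k + 1)) x * ennreal (\<bar>v i x\<bar> powr p) \<partial>lborel)"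
      by (rule nn_integral_add) measurable
    also have "\<dots> = ennreal (Lp_norm p (annulus k \<inter> \<Omega>) (g' i) powr p + Lp_norm p (annulus (k + 1) \<inter> \<Omega>) (g' i) powr p)"
      unfolding v_def using i by (simp add: eqN N')
    finally show "(\<integral>\<^sup>+x. indicator (annulus k \<union> annulus (k + 1)) x * ennreal (\<bar>v i x\<bar> powr p) \<partial>lborel) \<le> ennreal (Lp_norm p (annulus k \<inter> \<Omega>) (g' i) powr p + Lp_norm p (annulus (k + 1) \<inter> \<Omega>) (g' i) powr p)" .
  qed
  have gen: "ennreal (c * a + y * z) = ennreal c * ennreal a + ennreal y * ennreal z"
    if "0 \<le> c" "0 \<le> a" "0 \<le> y" "0 \<le> z" for c a y z :: real
    using that by (simp add: ennreal_mult)
  have "(\<Sum>i\<in>Basis. ennreal (Lp_norm p (annulus k \<inter> \<Omega>) (g' i) powr p + Lp_norm p (annulus (k + 1) \<inter> \<Omega>) (g' i) powr p))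
     = ennreal (\<Sum>i\<in>Basis. Lp_norm p (annulus k \<inter> \<Omega>) (g' i) powr p + Lp_norm p (annulus (k + 1) \<inter> \<Omega>) (g' i) powr p)"
    by (rule sum_ennreal) auto
  with order_trans[OF main add_left_mono[OF mult_left_mono[OF sum_le]]]
  have "ennreal (Lp_norm p (annulus k \<inter> \<Omega>) g powr p) \<le>
    ennreal ((1 - t) powr (1 - p) / 2 ^ DIM('a) * Lp_norm p (annulus (k + 1) \<inter> \<Omega>) g powr p +
    t powr (1 - p) * (4 * 2 powr k * DIM('a)) powr p *
    (\<Sum>i\<in>Basis. Lp_norm p (annulus k \<inter> \<Omega>) (g' i) powr p + Lp_norm p (annulus (k + 1) \<inter> \<Omega>) (g' i) powr p))"
    by (subst gen) (auto intro!: sum_nonneg mult_nonneg_nonneg)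
  then show ?thesis by (subst (asm) ennreal_le_iff) (auto intro!: add_nonneg_nonneg mult_nonneg_nonneg sum_nonneg)
qed

text \<open>Taking p-th roots, which are subadditive, makes the recursion linear in the norms; the
  factor 2^(k p) becomes 2^k.\<close>

lemma Lp_norm_step:
  fixes g :: "'a::euclidean_space \<Rightarrow> real" and g' :: "'a \<Rightarrow> 'a \<Rightarrow> real"
  assumes p: "p > 1" and t: "0 < t" "t < 1" and "open \<Omega>" and ball: "\<And>x. norm x < 2 powr (real_of_int k + 1) \<Longrightarrow> x \<in> \<Omega>"
    and g: "\<And>j. Lp_on p (annulus j \<inter> \<Omega>) g" and g': "\<And>i j. i \<in> Basis \<Longrightarrow> Lp_on p (annulus j \<inter> \<Omega>) (g' i)"
    and weak: "\<And>i \<phi>. i \<in> Basis \<Longrightarrow> test_fun \<Omega> \<phi> \<Longrightarrow>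
      integral\<^sup>L (lebesgue_on \<Omega>) (\<lambda>x. g x * pdir i \<phi> x) = - integral\<^sup>L (lebesgue_on \<Omega>) (\<lambda>x. g' i x * \<phi> x)"
  shows "Lp_norm p (annulus k \<inter> \<Omega>) g \<le>
      ((1 - t) powr (1 - p) / 2 ^ DIM('a)) powr (1 / p) * Lp_norm p (annulus (k + 1) \<inter> \<Omega>) g +
      (t powr (1 - p)) powr (1 / p) * (4 * 2 powr k * DIM('a)) *
        (\<Sum>i\<in>Basis. Lp_norm p (annulus k \<inter> \<Omega>) (g' i) + Lp_norm p (annulus (k + 1) \<inter> \<Omega>) (g' i))"
proof -
  let ?a = "\<lambda>j w. Lp_norm p (annulus j \<inter> \<Omega>) w"
  have root: "(?a j w powr p) powr (1 / p) = ?a j w" for j w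
    using p by (simp add: powr_powr Lp_norm_nonneg)
  have e: "0 < 1 / p" "1 / p \<le> 1" using p by auto
  let ?X = "(1 - t) powr (1 - p) / 2 ^ DIM('a) * ?a (k + 1) g powr p"
  let ?Y = "t powr (1 - p) * (4 * 2 powr k * DIM('a)) powr p"
  let ?Z = "\<Sum>i\<in>Basis. ?a k (g' i) powr p + ?a (k + 1) (g' i) powr p"
  have nn: "0 \<le> ?X" "0 \<le> ?Y" "0 \<le> ?Z" by (auto intro: sum_nonneg)
  have "?a k g = (?a k g powr p) powr (1 / p)" by (simp add: root)
  also have "\<dots> \<le> (?X + ?Y * ?Z) powr (1 / p)"
    using e Lp_norm_powr_step[OF p t \<open>open \<Omega>\<close> ball g g' weak] by (intro powr_mono2) auto
  also have "\<dots> \<le> ?X powr (1 / p) + (?Y * ?Z) powr (1 / p)"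
    by (intro powr_add_subadditive mult_nonneg_nonneg[OF nn(2,3)] nn(1) e)
  also have "?X powr (1 / p) = ((1 - t) powr (1 - p) / 2 ^ DIM('a)) powr (1 / p) * ?a (k + 1) g"
    by (simp only: powr_mult root)
  also have "(?Y * ?Z) powr (1 / p) = (t powr (1 - p)) powr (1 / p) * (4 * 2 powr k * DIM('a)) * ?Z powr (1 / p)"
    using p by (simp only: powr_mult) (simp add: powr_powr)
  also have "?Z powr (1 / p) \<le> (\<Sum>i\<in>Basis. ?a k (g' i) + ?a (k + 1) (g' i))"
  proof -
    have "?Z powr (1 / p) \<le> (\<Sum>i\<in>Basis. (?a k (g' i) powr p + ?a (k + 1) (g' i) powr p) powr (1 / p))"
      by (rule powr_sum_subadditive) (use e in auto)
    also have "\<dots> \<le> (\<Sum>i\<in>Basis. (?a k (g' i) powr p) powr (1 / p) + (?a (k + 1) (g' i) powr p) powr (1 / p))"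
      by (intro sum_mono powr_add_subadditive e) auto
    finally show ?thesis by (simp add: root)
  qed
  finally show ?thesis by (simp add: mult_left_mono)
qed

text \<open>Order \<beta> is tested with the partial derivative of \<phi>, order \<beta> + e_i with
  \<phi> itself. Both integrate f against the same function, and the orders differ by one
  sign.\<close>

lemma weak_deriv_pdir:
  assumes w: "weak_deriv \<Omega> \<beta> f g" "weak_deriv \<Omega> (\<beta>(i := Suc (\<beta> i))) f g'"
    and i: "i \<in> Basis" and \<phi>: "test_fun \<Omega> \<phi>"
  shows "integral\<^sup>L (lebesgue_on \<Omega>) (\<lambda>x. g x * pdir i \<phi> x) = - integral\<^sup>L (lebesgue_on \<Omega>) (\<lambda>x. g' x * \<phi> x)"
proof -
  let ?\<beta> = "\<beta>(i := Suc (\<beta> i))"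
  have "mi_order ?\<beta> = (\<Sum>b\<in>Basis. \<beta> b + (if b = i then 1 else 0))"
    unfolding mi_order_def by (intro sum.cong) auto
  also have "\<dots> = Suc (mi_order \<beta>)" using i by (simp add: mi_order_def sum.distrib)
  finally have o: "mi_order ?\<beta> = Suc (mi_order \<beta>)" .
  have sm: "smooth_fun \<phi>" using \<phi> by (simp add: test_fun_def)
  have "integral\<^sup>L (lebesgue_on \<Omega>) (\<lambda>x. f x * Dmi \<beta> (pdir i \<phi>) x)
      = (-1) ^ mi_order \<beta> * integral\<^sup>L (lebesgue_on \<Omega>) (\<lambda>x. g x * pdir i \<phi> x)"
    using w(1) test_fun_pdir[OF \<phi> i] unfolding weak_deriv_def by blast
  moreover have "integral\<^sup>L (lebesgue_on \<Omega>) (\<lambda>x. f x * Dmi ?\<beta> \<phi> x)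
      = (-1) ^ Suc (mi_order \<beta>) * integral\<^sup>L (lebesgue_on \<Omega>) (\<lambda>x. g' x * \<phi> x)"
    using w(2) \<phi> unfolding weak_deriv_def o[symmetric] by blast
  ultimately have "(-1) ^ mi_order \<beta> * integral\<^sup>L (lebesgue_on \<Omega>) (\<lambda>x. g x * pdir i \<phi> x)
    = (-1) ^ mi_order \<beta> * (- integral\<^sup>L (lebesgue_on \<Omega>) (\<lambda>x. g' x * \<phi> x))"
    using Dmi_pdir[OF sm i, of \<beta>] by simp
  then show ?thesis by (subst (asm) mult_cancel_left) simp
qed

subsection \<open>Iteration over the order of differentiation\<close>

lemma finite_multi_indices: "finite (multi_indices m :: ('a::euclidean_space \<Rightarrow> nat) set)"
proof (rule finite_subset)
  show "multi_indices m \<subseteq> {\<beta>. \<forall>x::'a. (x \<in> Basis \<longrightarrow> \<beta> x \<in> {..m}) \<and> (x \<notin> Basis \<longrightarrow> \<beta> x = 0)}"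
  proof
    fix \<beta> :: "'a \<Rightarrow> nat" assume \<beta>: "\<beta> \<in> multi_indices m"
    have "\<beta> x \<le> m" if "x \<in> Basis" for x
      using member_le_sum[OF that, of \<beta>] \<beta> by (simp add: multi_indices_def)
    then show "\<beta> \<in> {\<beta>. \<forall>x. (x \<in> Basis \<longrightarrow> \<beta> x \<in> {..m}) \<and> (x \<notin> Basis \<longrightarrow> \<beta> x = 0)}"
      using \<beta> by (simp add: multi_indices_def)
  qed
  show "finite {\<beta>. \<forall>x::'a. (x \<in> Basis \<longrightarrow> \<beta> x \<in> {..m}) \<and> (x \<notin> Basis \<longrightarrow> \<beta> x = 0)}"
    by (rule finite_set_of_finite_funs) auto
qed

lemma zero_in_multi_indices: "(\<lambda>_. 0) \<in> multi_indices m"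
  by (simp add: multi_indices_def)

lemma multi_indices_0: "multi_indices 0 = {\<lambda>_. 0}"
  by (auto simp: multi_indices_def fun_eq_iff)

lemma multi_indices_mono: "l \<le> m \<Longrightarrow> multi_indices l \<subseteq> multi_indices m"
  by (auto simp: multi_indices_def)

lemma multi_indices_Suc:
  assumes "\<beta> \<in> multi_indices l" "i \<in> Basis"
  shows "\<beta>(i := Suc (\<beta> i)) \<in> multi_indices (Suc l)"
proof -
  have "sum (\<beta>(i := Suc (\<beta> i))) Basis = (\<Sum>b\<in>Basis. \<beta> b + (if b = i then 1 else 0))"
    by (intro sum.cong) auto
  also have "\<dots> = Suc (sum \<beta> Basis)" using assms(2) by (simp add: sum.distrib)
  finally show ?thesis using assms by (auto simp: multi_indices_def)
qed

text \<open>A witness ties its zeroth member to f only through the weak identity of order 0. The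
  fundamental lemma upgrades this to equality almost everywhere, so bounds on the family apply to f
  itself.\<close>

lemma Lp_norm_weak_deriv_zero:
  fixes f g :: "'a::euclidean_space \<Rightarrow> real"
  assumes p: "p \<ge> 1" and "open \<Omega>" and f: "\<And>j. Lp_on p (annulus j \<inter> \<Omega>) f" and g: "\<And>j. Lp_on p (annulus j \<inter> \<Omega>) g"
    and weak: "weak_deriv \<Omega> (\<lambda>_. 0) f g"
  shows "Lp_norm p (annulus k \<inter> \<Omega>) f = Lp_norm p (annulus k \<inter> \<Omega>) g"
proof -
  have \<Omega> [measurable]: "\<Omega> \<in> sets borel" using \<open>open \<Omega>\<close> by simp
  have A: "annulus j \<inter> \<Omega> \<in> sets borel" for j by measurable
  define S where "S = {x::'a. 2 powr (real_of_int k - 2) < norm x \<and> norm x < 2 powr (real_of_int k + 1)}"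
  have "open S" unfolding S_def by (rule open_shell)
  have version: "\<exists>h. h \<in> borel_measurable borel \<and> (AE x in lborel. x \<in> \<Omega> \<longrightarrow> w x = h x) \<and>
      w \<in> borel_measurable (lebesgue_on \<Omega>) \<and> integrable lborel (\<lambda>x. indicator S x * (indicator \<Omega> x * h x))"
    if w: "\<And>j. Lp_on p (annulus j \<inter> \<Omega>) w" for w :: "'a \<Rightarrow> real"
  proof -
    have wm: "\<And>j. w \<in> borel_measurable (lebesgue_on (annulus j \<inter> \<Omega>))" using w by (auto simp: Lp_on_def)
    obtain h where h [measurable]: "h \<in> borel_measurable borel" and ae: "AE x in lborel. x \<in> \<Omega> \<longrightarrow> w x = h x"
      using borel_version(2)[OF \<Omega> wm] by blast
    have "integrable lborel (\<lambda>x. indicator S x * (indicator \<Omega> x * h x))"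
      unfolding S_def
    proof (rule shell_integrable[OF p])
      fix j
      have "(\<integral>\<^sup>+x. indicator (annulus j) x * ennreal (\<bar>indicator \<Omega> x * h x\<bar> powr p) \<partial>lborel) =
        (\<integral>\<^sup>+x. indicator (annulus j \<inter> \<Omega>) x * ennreal (\<bar>h x\<bar> powr p) \<partial>lborel)"
        by (intro nn_integral_cong) (auto simp: indicator_def)
      also have "\<dots> = ennreal (Lp_norm p (annulus j \<inter> \<Omega>) w powr p)"
        by (rule nn_integral_Lp_norm[OF _ A _ w h ae]) (use p in auto)
      finally show "(\<integral>\<^sup>+x. indicator (annulus j) x * ennreal (\<bar>indicator \<Omega> x * h x\<bar> powr p) \<partial>lborel) < \<infinity>" by simp
    qed measurable
    then show ?thesis using h ae borel_version(1)[OF \<Omega> wm] by blast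
  qed
  obtain f' where f' [measurable]: "f' \<in> borel_measurable borel" and aef: "AE x in lborel. x \<in> \<Omega> \<longrightarrow> f x = f' x"
    and fm: "f \<in> borel_measurable (lebesgue_on \<Omega>)" and intf: "integrable lborel (\<lambda>x. indicator S x * (indicator \<Omega> x * f' x))"
    using version[OF f] by blast
  obtain g' where g' [measurable]: "g' \<in> borel_measurable borel" and aeg: "AE x in lborel. x \<in> \<Omega> \<longrightarrow> g x = g' x"
    and gm: "g \<in> borel_measurable (lebesgue_on \<Omega>)" and intg: "integrable lborel (\<lambda>x. indicator S x * (indicator \<Omega> x * g' x))"
    using version[OF g] by blast
  define F where "F x = indicator S x * (indicator \<Omega> x * f' x)" for x
  define G where "G x = indicator S x * (indicator \<Omega> x * g' x)" for x
  have F: "integrable lborel F" and G: "integrable lborel G" using intf intg by (simp_all add: F_def[abs_def] G_def[abs_def])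
  have "AE x in lborel. x \<in> S \<inter> \<Omega> \<longrightarrow> F x - G x = 0"
  proof (rule fundamental_lemma)
    show "integrable lborel (\<lambda>x. F x - G x)" using F G by simp
    show "open (S \<inter> \<Omega>)" using \<open>open S\<close> \<open>open \<Omega>\<close> by auto
    fix \<phi> assume \<phi>: "test_fun (S \<inter> \<Omega>) \<phi>"
    have \<phi>\<Omega>: "test_fun \<Omega> \<phi>" by (rule test_fun_mono[OF \<phi>]) auto
    have zero: "\<phi> x = 0" if "x \<notin> S \<or> x \<notin> \<Omega>" for x using test_fun_eq_0[OF \<phi>] that by auto
    have \<phi>m [measurable]: "\<phi> \<in> borel_measurable borel" by (rule test_fun_borel[OF \<phi>])
    obtain C where C: "\<And>x. \<bar>\<phi> x\<bar> \<le> C" using test_fun_bounded[OF \<phi>] by blast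
    have prod: "integrable lborel (\<lambda>x. H x * \<phi> x)" if H: "integrable lborel H" for H
    proof (rule Bochner_Integration.integrable_bound[of _ "\<lambda>x. H x * C"])
      show "AE x in lborel. norm (H x * \<phi> x) \<le> norm (H x * C)"
        using C by (intro AE_I2) (auto simp: abs_mult intro!: mult_left_mono intro: order_trans[OF _ abs_ge_self])
    qed (use H in auto)
    have "(\<integral>x. F x * \<phi> x \<partial>lborel) = (\<integral>x. f' x * \<phi> x \<partial>lborel)"
      using zero by (intro Bochner_Integration.integral_cong) (auto simp: F_def indicator_def)
    also have "\<dots> = integral\<^sup>L (lebesgue_on \<Omega>) (\<lambda>x. f x * \<phi> x)"
      by (rule integral_lebesgue_on_eq_lborel[symmetric, OF \<Omega> fm f' aef \<phi>m]) (use zero in auto)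
    also have "\<dots> = integral\<^sup>L (lebesgue_on \<Omega>) (\<lambda>x. g x * \<phi> x)"
      using weak \<phi>\<Omega> by (auto simp: weak_deriv_def Dmi_zero mi_order_def)
    also have "\<dots> = (\<integral>x. g' x * \<phi> x \<partial>lborel)"
      by (rule integral_lebesgue_on_eq_lborel[OF \<Omega> gm g' aeg \<phi>m]) (use zero in auto)
    also have "\<dots> = (\<integral>x. G x * \<phi> x \<partial>lborel)"
      using zero by (intro Bochner_Integration.integral_cong) (auto simp: G_def indicator_def)
    finally show "(\<integral>x. (F x - G x) * \<phi> x \<partial>lborel) = 0"
      using prod[OF F] prod[OF G] by (simp add: left_diff_distrib)
  qed
  then have "AE x in lborel. indicator (annulus k \<inter> \<Omega>) x * ennreal (\<bar>f' x\<bar> powr p) = indicator (annulus k \<inter> \<Omega>) x * ennreal (\<bar>g' x\<bar> powr p)"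
  proof eventually_elim
    case (elim x)
    have "annulus k \<subseteq> S" unfolding S_def by (rule annulus_subset_shell)
    then show ?case using elim by (auto simp: indicator_def F_def G_def)
  qed
  then have "(\<integral>\<^sup>+x. indicator (annulus k \<inter> \<Omega>) x * ennreal (\<bar>f' x\<bar> powr p) \<partial>lborel) = (\<integral>\<^sup>+x. indicator (annulus k \<inter> \<Omega>) x * ennreal (\<bar>g' x\<bar> powr p) \<partial>lborel)"
    by (rule nn_integral_cong_AE)
  moreover have "(\<integral>\<^sup>+x. indicator (annulus k \<inter> \<Omega>) x * ennreal (\<bar>f' x\<bar> powr p) \<partial>lborel) = ennreal (Lp_norm p (annulus k \<inter> \<Omega>) f powr p)"
    by (rule nn_integral_Lp_norm[OF _ A _ f f' aef]) (use p in auto)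
  moreover have "(\<integral>\<^sup>+x. indicator (annulus k \<inter> \<Omega>) x * ennreal (\<bar>g' x\<bar> powr p) \<partial>lborel) = ennreal (Lp_norm p (annulus k \<inter> \<Omega>) g powr p)"
    by (rule nn_integral_Lp_norm[OF _ A _ g g' aeg]) (use p in auto)
  ultimately have "Lp_norm p (annulus k \<inter> \<Omega>) f powr p = Lp_norm p (annulus k \<inter> \<Omega>) g powr p" by simp
  then have "(Lp_norm p (annulus k \<inter> \<Omega>) f powr p) powr (1 / p) = (Lp_norm p (annulus k \<inter> \<Omega>) g powr p) powr (1 / p)" by simp
  then show ?thesis using p by (simp add: powr_powr Lp_norm_nonneg)
qed

section \<open>Sums of derivative norms over multi-indices\<close>

text \<open>A plain sum over the multi-indices replaces the l^p sum of
  \<open>herz_sobolev_norm\<close>, because the recursions for the individual derivatives are linear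
  in the norms and can then simply be added.\<close>

definition deriv_norm_sum ::
  "real \<Rightarrow> 'a::euclidean_space set \<Rightarrow> nat \<Rightarrow> (('a \<Rightarrow> nat) \<Rightarrow> 'a \<Rightarrow> real) \<Rightarrow> int \<Rightarrow> real" where
  "deriv_norm_sum p \<Omega> l G k = (\<Sum>\<beta>\<in>multi_indices l. Lp_norm p (annulus k \<inter> \<Omega>) (G \<beta>))"

lemma deriv_norm_sum_nonneg: "0 \<le> deriv_norm_sum p \<Omega> l G k"
  unfolding deriv_norm_sum_def by (intro sum_nonneg Lp_norm_nonneg)

lemma deriv_norm_sum_ge:
  "\<beta> \<in> multi_indices l \<Longrightarrow> Lp_norm p (annulus k \<inter> \<Omega>) (G \<beta>) \<le> deriv_norm_sum p \<Omega> l G k"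
  unfolding deriv_norm_sum_def by (intro member_le_sum Lp_norm_nonneg finite_multi_indices) auto

lemma deriv_norm_sum_mono: "l \<le> m \<Longrightarrow> deriv_norm_sum p \<Omega> l G k \<le> deriv_norm_sum p \<Omega> m G k"
  unfolding deriv_norm_sum_def by (intro sum_mono2 multi_indices_mono finite_multi_indices Lp_norm_nonneg)

lemma witness_Lp_on:
  assumes "herz_sobolev_witness \<alpha> p r m \<Omega> f G" "\<beta> \<in> multi_indices m"
  shows "Lp_on p (annulus k \<inter> \<Omega>) (G \<beta>)"
  using assms by (auto simp: herz_sobolev_witness_def herz_space_def)

text \<open>The gradient of a derivative of order at most l consists of derivatives of order at most
  l + 1. The cardinality and the second factor \<open>DIM('a)\<close> count how often the larger sum
  is used.\<close>

lemma deriv_norm_sum_step: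
  fixes \<Omega> :: "'a::euclidean_space set"
  assumes p: "p > 1" and t: "0 < t" "t < 1" and "open \<Omega>" and ball: "\<And>x. norm x < 2 powr (real_of_int k + 1) \<Longrightarrow> x \<in> \<Omega>"
    and w: "herz_sobolev_witness \<alpha> p r m \<Omega> f G" and l: "Suc l \<le> m"
  shows "deriv_norm_sum p \<Omega> l G k \<le>
      ((1 - t) powr (1 - p) / 2 ^ DIM('a)) powr (1 / p) * deriv_norm_sum p \<Omega> l G (k + 1) +
      (t powr (1 - p)) powr (1 / p) * (4 * DIM('a)) * (card (multi_indices l :: ('a \<Rightarrow> nat) set) * DIM('a)) *
       (2 powr k * (deriv_norm_sum p \<Omega> (Suc l) G k + deriv_norm_sum p \<Omega> (Suc l) G (k + 1)))"
proof -
  let ?M = "multi_indices l :: ('a \<Rightarrow> nat) set" and ?S = "deriv_norm_sum p \<Omega>" and ?a = "\<lambda>j \<beta>. Lp_norm p (annulus j \<inter> \<Omega>) (G \<beta>)"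
  let ?\<theta> = "((1 - t) powr (1 - p) / 2 ^ DIM('a)) powr (1 / p)" and ?c = "(t powr (1 - p)) powr (1 / p) * (4 * 2 powr k * DIM('a))"
  have "?a k \<beta> \<le> ?\<theta> * ?a (k + 1) \<beta> + ?c * (DIM('a) * (?S (Suc l) G k + ?S (Suc l) G (k + 1)))" if \<beta>: "\<beta> \<in> ?M" for \<beta>
  proof -
    have sub: "\<beta> \<in> multi_indices m" "\<And>i. i \<in> Basis \<Longrightarrow> \<beta>(i := Suc (\<beta> i)) \<in> multi_indices m"
      using \<beta> multi_indices_Suc[OF \<beta>] l multi_indices_mono[of l m] multi_indices_mono[of "Suc l" m] by auto
    have "?a k \<beta> \<le> ?\<theta> * ?a (k + 1) \<beta> + ?c * (\<Sum>i\<in>Basis. ?a k (\<beta>(i := Suc (\<beta> i))) + ?a (k + 1) (\<beta>(i := Suc (\<beta> i))))"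
    proof (rule Lp_norm_step[OF p t \<open>open \<Omega>\<close> ball])
      fix i :: 'a and \<phi> assume i: "i \<in> Basis" and \<phi>: "test_fun \<Omega> \<phi>"
      show "integral\<^sup>L (lebesgue_on \<Omega>) (\<lambda>x. G \<beta> x * pdir i \<phi> x) = - integral\<^sup>L (lebesgue_on \<Omega>) (\<lambda>x. G (\<beta>(i := Suc (\<beta> i))) x * \<phi> x)"
        by (rule weak_deriv_pdir[OF _ _ i \<phi>, where f = f and \<beta> = \<beta>])
          (use w sub i in \<open>auto simp: herz_sobolev_witness_def\<close>)
    qed (use witness_Lp_on[OF w] sub in auto)
    also have "(\<Sum>i\<in>Basis. ?a k (\<beta>(i := Suc (\<beta> i))) + ?a (k + 1) (\<beta>(i := Suc (\<beta> i)))) \<le> (\<Sum>i\<in>(Basis::'a set). ?S (Suc l) G k + ?S (Suc l) G (k + 1))"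
      by (intro sum_mono add_mono deriv_norm_sum_ge multi_indices_Suc \<beta>)
    finally show ?thesis by (simp add: mult_left_mono)
  qed
  then have "?S l G k \<le> (\<Sum>\<beta>\<in>?M. ?\<theta> * ?a (k + 1) \<beta> + ?c * (DIM('a) * (?S (Suc l) G k + ?S (Suc l) G (k + 1))))"
    unfolding deriv_norm_sum_def[of p \<Omega> l G k] by (rule sum_mono)
  also have "\<dots> = ?\<theta> * ?S l G (k + 1) + card ?M * (?c * (DIM('a) * (?S (Suc l) G k + ?S (Suc l) G (k + 1))))"
    by (simp only: sum.distrib sum_constant deriv_norm_sum_def[of p \<Omega> l G "k + 1"] sum_distrib_left[of ?\<theta>])
  finally show ?thesis by (simp only: mult_ac of_nat_mult)
qed

text \<open>Each norm is at most the l^p sum \<open>s\<close>, hence the plain sum is at most the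
  number of multi-indices times \<open>s\<close>. Finiteness for \<open>s\<close> is first derived
  from the members of the family, for only then does \<open>herz_sobolev_norm\<close> bound the
  sequence.\<close>

lemma witness_base_bound:
  fixes \<Omega> :: "'a::euclidean_space set"
  assumes p: "p > 1" and r: "1 \<le> r" and w: "herz_sobolev_witness \<alpha> p r m \<Omega> f G"
  shows "lr_bound r (\<lambda>k. 2 powr (real_of_int k * \<alpha>) * deriv_norm_sum p \<Omega> m G k)
    (card (multi_indices m :: ('a \<Rightarrow> nat) set) * herz_sobolev_norm \<alpha> p r m \<Omega> G)"
proof -
  let ?M = "multi_indices m :: ('a \<Rightarrow> nat) set" and ?a = "\<lambda>k \<beta>. Lp_norm p (annulus k \<inter> \<Omega>) (G \<beta>)"
  define s where "s k = (\<Sum>\<beta>\<in>?M. ?a k \<beta> powr p) powr (1 / p)" for k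
  have root: "(?a k \<beta> powr p) powr (1 / p) = ?a k \<beta>" for k \<beta> using p by (simp add: powr_powr Lp_norm_nonneg)
  have s_le: "s k \<le> deriv_norm_sum p \<Omega> m G k" for k
    using powr_sum_subadditive[OF finite_multi_indices, of m "\<lambda>\<beta>. ?a k \<beta> powr p" "1 / p"] p
    by (simp add: s_def deriv_norm_sum_def root)
  have s_ge: "?a k \<beta> \<le> s k" if "\<beta> \<in> ?M" for k \<beta>
  proof -
    have "?a k \<beta> powr p \<le> (\<Sum>\<beta>\<in>?M. ?a k \<beta> powr p)" using that by (intro member_le_sum finite_multi_indices) auto
    then have "(?a k \<beta> powr p) powr (1 / p) \<le> s k" unfolding s_def using p by (intro powr_mono2) auto
    then show ?thesis by (simp add: root)
  qed
  have "\<exists>M. lr_bound r (\<lambda>k. \<Sum>\<beta>\<in>?M. 2 powr (real_of_int k * \<alpha>) * ?a k \<beta>) M"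
  proof (rule lr_bound_sum[OF finite_multi_indices r])
    fix \<beta> assume "\<beta> \<in> ?M"
    then have "herz_outer_finite \<alpha> r (\<lambda>k. ?a k \<beta>)" using w by (auto simp: herz_sobolev_witness_def herz_space_def)
    from lr_bound_herz_outer[OF r Lp_norm_nonneg this] show "\<exists>M. lr_bound r (\<lambda>k. 2 powr (real_of_int k * \<alpha>) * ?a k \<beta>) M" by blast
  qed
  then obtain M where "lr_bound r (\<lambda>k. \<Sum>\<beta>\<in>?M. 2 powr (real_of_int k * \<alpha>) * ?a k \<beta>) M" by blast
  then have "lr_bound r (\<lambda>k. 2 powr (real_of_int k * \<alpha>) * s k) M"
    by (rule lr_bound_mono) (use s_le in \<open>auto simp: s_def deriv_norm_sum_def sum_distrib_left[symmetric]\<close>)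
  then have "herz_outer_finite \<alpha> r s" by (rule herz_outer_le(1)[OF r])
  then have "lr_bound r (\<lambda>k. 2 powr (real_of_int k * \<alpha>) * s k) (herz_outer \<alpha> r s)"
    by (rule lr_bound_herz_outer[OF r, rotated]) (simp add: s_def)
  then have "lr_bound r (\<lambda>k. card ?M * (2 powr (real_of_int k * \<alpha>) * s k)) (card ?M * herz_outer \<alpha> r s)"
    by (rule lr_bound_cmult) simp
  moreover have "herz_outer \<alpha> r s = herz_sobolev_norm \<alpha> p r m \<Omega> G"
    by (simp add: herz_sobolev_norm_def s_def[abs_def])
  ultimately have "lr_bound r (\<lambda>k. card ?M * (2 powr (real_of_int k * \<alpha>) * s k)) (card ?M * herz_sobolev_norm \<alpha> p r m \<Omega> G)" by simp
  then show ?thesis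
  proof (rule lr_bound_mono)
    fix k
    have "deriv_norm_sum p \<Omega> m G k \<le> card ?M * s k"
      unfolding deriv_norm_sum_def using sum_bounded_above[of ?M "\<lambda>\<beta>. ?a k \<beta>" "s k"] s_ge by simp
    then show "2 powr (real_of_int k * \<alpha>) * deriv_norm_sum p \<Omega> m G k \<le> card ?M * (2 powr (real_of_int k * \<alpha>) * s k)"
      by (simp add: mult.left_commute mult_left_mono)
  qed (simp add: deriv_norm_sum_nonneg)
qed

text \<open>The available room is d = e p + n. With (1 - t)^(1 - p) = 2^(d/2) half of it is spent,
  and the product equals 2^(-d / (2 p)), still below 1.\<close>

lemma exists_contraction_parameter:
  fixes p e :: real
  assumes p: "p > 1" and e: "e + real n / p > 0"
  obtains t where "0 < t" "t < 1" "((1 - t) powr (1 - p) / 2 ^ n) powr (1 / p) * 2 powr (- e) < 1"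
proof -
  define d where "d = e * p + real n"
  have d: "d > 0" using e p by (simp add: d_def field_simps)
  define t where "t = 1 - 2 powr (- d / (2 * (p - 1)))"
  have "2 powr (- d / (2 * (p - 1))) < (1::real)"
    using powr_less_mono[of "- d / (2 * (p - 1))" 0 "2::real"] d p by simp
  then have t: "0 < t" "t < 1" by (auto simp: t_def)
  have "(1 - t) powr (1 - p) = 2 powr (d / 2)"
  proof -
    have "- d / (2 * (p - 1)) * (1 - p) = d / 2" using p by (simp add: divide_simps) (simp add: algebra_simps)
    then show ?thesis by (simp only: t_def powr_powr diff_diff_eq2 add_diff_cancel_left')
  qed
  then have "((1 - t) powr (1 - p) / 2 ^ n) powr (1 / p) * 2 powr (- e) = (2 powr (d / 2 - real n)) powr (1 / p) * 2 powr (- e)"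
    by (simp add: powr_diff powr_realpow)
  also have "\<dots> = 2 powr ((d / 2 - real n) * (1 / p) + - e)" by (simp only: powr_powr powr_add)
  also have "(d / 2 - real n) * (1 / p) + - e = - (d / (2 * p))" using p by (simp add: d_def field_simps)
  also have "2 powr (- (d / (2 * p))) < (1::real)"
    using powr_less_mono[of "- (d / (2 * p))" 0 "2::real"] d p by simp
  finally show ?thesis using that t by blast
qed

text \<open>Each derivative that is given up improves the weight exponent by one, until it reaches \<open>\<alpha>1\<close>;
  the recursion contracts because \<open>\<alpha>1 > - n / p\<close>.\<close>

lemma herz_iteration:
  fixes \<Omega> :: "'a::euclidean_space set"
  assumes p: "p > 1" and r: "1 \<le> r" and "open \<Omega>" "0 \<in> \<Omega>"
    and \<alpha>1: "\<alpha>1 + real DIM('a) / p > 0" and "\<alpha>1 \<le> \<alpha>2" and "j \<le> m"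
  shows "\<exists>C>0. \<forall>f G. herz_sobolev_witness \<alpha>2 p r m \<Omega> f G \<longrightarrow>
    lr_bound r (\<lambda>k. 2 powr (real_of_int k * max (\<alpha>2 - real j) \<alpha>1) * deriv_norm_sum p \<Omega> (m - j) G k)
      (C * herz_sobolev_norm \<alpha>2 p r m \<Omega> G)"
  using \<open>j \<le> m\<close>
proof (induction j)
  case 0
  let ?N = "real (card (multi_indices m :: ('a \<Rightarrow> nat) set))"
  have "card (multi_indices m :: ('a \<Rightarrow> nat) set) > 0"
    using finite_multi_indices zero_in_multi_indices by (metis card_gt_0_iff empty_iff)
  then have "?N > 0" by simp
  moreover have "lr_bound r (\<lambda>k. 2 powr (real_of_int k * max (\<alpha>2 - real 0) \<alpha>1) * deriv_norm_sum p \<Omega> (m - 0) G k)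
      (?N * herz_sobolev_norm \<alpha>2 p r m \<Omega> G)" if "herz_sobolev_witness \<alpha>2 p r m \<Omega> f G" for f G
    using witness_base_bound[OF p r that] \<open>\<alpha>1 \<le> \<alpha>2\<close> by (simp add: max_absorb1)
  ultimately show ?case by blast
next
  case (Suc j)
  define l where "l = m - Suc j"
  have l: "m - j = Suc l" "Suc l \<le> m" using Suc.prems by (auto simp: l_def)
  define \<gamma> where "\<gamma> = max (\<alpha>2 - real j) \<alpha>1"
  define \<gamma>' where "\<gamma>' = max (\<alpha>2 - real (Suc j)) \<alpha>1"
  \<comment> \<open>The second inequality bounds the source term as k decreases, the first bounds
    the tail above K, and the third keeps the contraction factor below 1.\<close>
  have \<gamma>: "\<gamma>' \<le> \<gamma>" "\<gamma> \<le> \<gamma>' + 1" "\<alpha>1 \<le> \<gamma>'" by (auto simp: \<gamma>_def \<gamma>'_def)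
  obtain C where C: "C > 0" and IH: "\<And>f G. herz_sobolev_witness \<alpha>2 p r m \<Omega> f G \<Longrightarrow>
      lr_bound r (\<lambda>k. 2 powr (real_of_int k * \<gamma>) * deriv_norm_sum p \<Omega> (Suc l) G k) (C * herz_sobolev_norm \<alpha>2 p r m \<Omega> G)"
    using Suc unfolding l(1) \<gamma>_def by fastforce
  obtain \<delta> where \<delta>: "\<delta> > 0" "ball 0 \<delta> \<subseteq> \<Omega>" using \<open>open \<Omega>\<close> \<open>0 \<in> \<Omega>\<close> open_contains_ball by blast
  \<comment> \<open>For k < K both \<open>annulus k\<close> and \<open>annulus (k + 1)\<close> lie
    in a ball around 0 contained in \<Omega>.\<close>
  define K where "K = \<lfloor>log 2 \<delta>\<rfloor>"
  have "2 powr real_of_int K \<le> 2 powr log 2 \<delta>" unfolding K_def by (intro powr_mono) auto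
  then have K: "2 powr real_of_int K \<le> \<delta>" using \<delta>(1) by simp
  have inball: "x \<in> \<Omega>" if "k < K" "norm x < 2 powr (real_of_int k + 1)" for k and x :: 'a
  proof -
    have "2 powr (real_of_int k + 1) \<le> 2 powr real_of_int K" using that(1) by (intro powr_mono) auto
    from less_le_trans[OF that(2) order_trans[OF this K]] have "x \<in> ball 0 \<delta>" by simp
    then show ?thesis using \<delta>(2) by blast
  qed
  obtain t where t: "0 < t" "t < 1" and contr: "((1 - t) powr (1 - p) / 2 ^ DIM('a)) powr (1 / p) * 2 powr (- \<alpha>1) < 1"
    using exists_contraction_parameter[OF p \<alpha>1] by blast
  define \<theta>0 where "\<theta>0 = ((1 - t) powr (1 - p) / 2 ^ DIM('a)) powr (1 / p)"
  \<comment> \<open>Built with \<alpha>1 and not with \<gamma>': since \<gamma>' is at least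
    \<alpha>1, the same factor works at every stage.\<close>
  define \<theta> where "\<theta> = \<theta>0 * 2 powr (- \<alpha>1)"
  have \<theta>0: "\<theta>0 > 0" using t by (simp add: \<theta>0_def)
  then have \<theta>: "0 < \<theta>" "\<theta> < 1" using contr by (auto simp: \<theta>_def \<theta>0_def)
  define c where "c = (t powr (1 - p)) powr (1 / p) * (4 * DIM('a)) * (card (multi_indices l :: ('a \<Rightarrow> nat) set) * DIM('a))"
  have c: "c \<ge> 0" by (simp add: c_def)
  \<comment> \<open>For k below K the power 2^(k (\<gamma>' + 1 - \<gamma>)) is largest at K, since
    its exponent factor is nonnegative. The 2^(-\<gamma>) compensates the index shift in the weight.
    In \<open>E\<close> the factor \<gamma>' - \<gamma> is nonpositive, so K is again the worst
    index, now for k at or above K.\<close>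
  define D where "D = c * 2 powr (K * (\<gamma>' + 1 - \<gamma>)) * (1 + 2 powr (- \<gamma>))"
  define E where "E = 2 powr (K * (\<gamma>' - \<gamma>))"
  have D: "D \<ge> 0" and E: "E > 0" using c by (auto simp: D_def E_def)
  obtain B where B: "B > 0" and rec: "\<And>b h M0 M1. \<lbrakk>\<And>k. 0 \<le> b k; \<And>k. k < K \<Longrightarrow> b k \<le> \<theta> * b (k + 1) + h k; lr_bound r h M1;
        lr_bound r (\<lambda>k. if K \<le> k then b k else 0) M0\<rbrakk> \<Longrightarrow> lr_bound r b (B * (M0 + M1))"
  proof (rule lr_bound_recursion[OF r \<theta>, of K])
    fix B assume "B > 0" and "\<And>b h M0 M1. \<lbrakk>\<And>k. 0 \<le> b k; \<And>k. k < K \<Longrightarrow> b k \<le> \<theta> * b (k + 1) + h k; lr_bound r h M1;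
        lr_bound r (\<lambda>k. if K \<le> k then b k else 0) M0\<rbrakk> \<Longrightarrow> lr_bound r b (B * (M0 + M1))"
    then show thesis by (rule that)
  qed
  have "lr_bound r (\<lambda>k. 2 powr (real_of_int k * \<gamma>') * deriv_norm_sum p \<Omega> l G k) (B * (E + 8 * D) * C * herz_sobolev_norm \<alpha>2 p r m \<Omega> G)"
    if w: "herz_sobolev_witness \<alpha>2 p r m \<Omega> f G" for f G
  proof -
    define N where "N = C * herz_sobolev_norm \<alpha>2 p r m \<Omega> G"
    let ?S = "deriv_norm_sum p \<Omega> l G" and ?S' = "deriv_norm_sum p \<Omega> (Suc l) G"
    let ?a = "\<lambda>k. 2 powr (real_of_int k * \<gamma>) * ?S' k"
    \<comment> \<open>The source is cut off at K because its weight 2^(k (\<gamma>' + 1)) is only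
      controlled by the previous weight below K.\<close>
    let ?h = "\<lambda>k. if k < K then c * (2 powr (real_of_int k * (\<gamma>' + 1)) * (?S' k + ?S' (k + 1))) else 0"
    have a: "lr_bound r ?a N" unfolding N_def by (rule IH[OF w])
    have nn: "0 \<le> ?S k" "0 \<le> ?S' k" for k by (rule deriv_norm_sum_nonneg)+
    \<comment> \<open>The 4 (N + N) is the crude triangle inequality for the two neighbouring
      gradient terms; it becomes the 8 D of the claimed constant.\<close>
    have "lr_bound r (\<lambda>k. 2 powr (real_of_int k * \<gamma>') * ?S k) (B * (E * N + D * (4 * (N + N))))"
    proof (rule rec)
      show "0 \<le> 2 powr (real_of_int k * \<gamma>') * ?S k" for k using nn by simp
    next
      fix k assume k: "k < K"
      have "?S k \<le> \<theta>0 * ?S (k + 1) + c * (2 powr k * (?S' k + ?S' (k + 1)))"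
        unfolding \<theta>0_def c_def by (rule deriv_norm_sum_step[OF p t \<open>open \<Omega>\<close> inball[OF k] w l(2)])
      then have "2 powr (real_of_int k * \<gamma>') * ?S k \<le> 2 powr (real_of_int k * \<gamma>') * (\<theta>0 * ?S (k + 1) + c * (2 powr k * (?S' k + ?S' (k + 1))))"
        by (rule mult_left_mono) simp
      also have "\<dots> = \<theta>0 * (2 powr (real_of_int k * \<gamma>') * ?S (k + 1)) + c * ((2 powr (real_of_int k * \<gamma>') * 2 powr k) * (?S' k + ?S' (k + 1)))"
        by (simp add: algebra_simps)
      also have "2 powr (real_of_int k * \<gamma>') * 2 powr k = 2 powr (real_of_int k * (\<gamma>' + 1))"
        by (simp add: powr_add[symmetric] algebra_simps)
      also have "\<theta>0 * (2 powr (real_of_int k * \<gamma>') * ?S (k + 1)) \<le> \<theta> * (2 powr (real_of_int (k + 1) * \<gamma>') * ?S (k + 1))"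
      proof -
        have "2 powr (real_of_int k * \<gamma>') = 2 powr (- \<gamma>') * 2 powr (real_of_int (k + 1) * \<gamma>')"
          by (simp add: powr_add[symmetric] algebra_simps)
        also have "\<dots> \<le> 2 powr (- \<alpha>1) * 2 powr (real_of_int (k + 1) * \<gamma>')"
          using \<gamma> by (intro mult_right_mono powr_mono) auto
        finally have "\<theta>0 * (2 powr (real_of_int k * \<gamma>') * ?S (k + 1)) \<le> \<theta>0 * (2 powr (- \<alpha>1) * 2 powr (real_of_int (k + 1) * \<gamma>') * ?S (k + 1))"
          using \<theta>0 nn by (intro mult_left_mono mult_right_mono) auto
        then show ?thesis by (simp only: \<theta>_def mult_ac)
      qed
      finally show "2 powr (real_of_int k * \<gamma>') * ?S k \<le> \<theta> * (2 powr (real_of_int (k + 1) * \<gamma>') * ?S (k + 1)) + ?h k"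
        using k by simp
    next
      have "lr_bound r (\<lambda>k. D * (?a k + ?a (k + 1))) (D * (4 * (N + N)))"
        by (intro lr_bound_cmult lr_bound_add a lr_bound_shift[OF a] r D)
      then show "lr_bound r ?h (D * (4 * (N + N)))"
      proof (rule lr_bound_mono)
        fix k
        show "0 \<le> ?h k" using nn c by simp
        show "?h k \<le> D * (?a k + ?a (k + 1))"
        proof (cases "k < K")
          case True
          define P where "P = 2 powr (real_of_int K * (\<gamma>' + 1 - \<gamma>))"
          have "2 powr (real_of_int k * (\<gamma>' + 1)) = 2 powr (real_of_int k * (\<gamma>' + 1 - \<gamma>)) * 2 powr (real_of_int k * \<gamma>)"
            by (simp add: powr_add[symmetric] algebra_simps)
          also have "\<dots> \<le> P * 2 powr (real_of_int k * \<gamma>)"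
            unfolding P_def using True \<gamma> by (intro mult_right_mono powr_mono) auto
          finally have 1: "2 powr (real_of_int k * (\<gamma>' + 1)) \<le> P * 2 powr (real_of_int k * \<gamma>)" .
          have 2: "2 powr (real_of_int k * \<gamma>) = 2 powr (- \<gamma>) * 2 powr (real_of_int (k + 1) * \<gamma>)"
            by (simp add: powr_add[symmetric] algebra_simps)
          have "2 powr (real_of_int k * (\<gamma>' + 1)) * (?S' k + ?S' (k + 1)) \<le> (P * 2 powr (real_of_int k * \<gamma>)) * (?S' k + ?S' (k + 1))"
            using 1 nn by (intro mult_right_mono add_nonneg_nonneg) auto
          also have "\<dots> = P * (2 powr (real_of_int k * \<gamma>) * ?S' k + 2 powr (real_of_int k * \<gamma>) * ?S' (k + 1))"
            by (simp add: algebra_simps)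
          also have "\<dots> = P * (?a k + 2 powr (- \<gamma>) * ?a (k + 1))"
            by (subst (2) 2) (simp only: mult.assoc)
          also have "\<dots> \<le> P * ((1 + 2 powr (- \<gamma>)) * (?a k + ?a (k + 1)))"
          proof (rule mult_left_mono)
            have "0 \<le> ?a (k + 1)" "0 \<le> 2 powr (- \<gamma>) * ?a k" using nn by auto
            then show "?a k + 2 powr (- \<gamma>) * ?a (k + 1) \<le> (1 + 2 powr (- \<gamma>)) * (?a k + ?a (k + 1))"
              unfolding distrib_right distrib_left by linarith
          qed (simp add: P_def)
          finally have "c * (2 powr (real_of_int k * (\<gamma>' + 1)) * (?S' k + ?S' (k + 1))) \<le> c * (P * ((1 + 2 powr (- \<gamma>)) * (?a k + ?a (k + 1))))"
            using c by (rule mult_left_mono)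
          also have "\<dots> = D * (?a k + ?a (k + 1))" by (simp only: D_def P_def mult.assoc)
          finally show ?thesis using True by simp
        qed (use D nn in auto)
      qed
    next
      have "lr_bound r (\<lambda>k. E * ?a k) (E * N)" using a E by (intro lr_bound_cmult) auto
      then show "lr_bound r (\<lambda>k. if K \<le> k then 2 powr (real_of_int k * \<gamma>') * ?S k else 0) (E * N)"
      proof (rule lr_bound_mono)
        fix k
        show "(if K \<le> k then 2 powr (real_of_int k * \<gamma>') * ?S k else 0) \<le> E * ?a k"
        proof (cases "K \<le> k")
          case True
          have "2 powr (real_of_int k * \<gamma>') = 2 powr (real_of_int k * (\<gamma>' - \<gamma>)) * 2 powr (real_of_int k * \<gamma>)"
            by (simp add: powr_add[symmetric] algebra_simps)
          also have "\<dots> \<le> E * 2 powr (real_of_int k * \<gamma>)"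
            unfolding E_def using True \<gamma> by (intro mult_right_mono powr_mono mult_right_mono_neg) auto
          finally have "2 powr (real_of_int k * \<gamma>') * ?S k \<le> (E * 2 powr (real_of_int k * \<gamma>)) * ?S' k"
            using nn E by (intro mult_mono deriv_norm_sum_mono) auto
          then show ?thesis using True by (simp add: mult.assoc)
        qed (use E nn in auto)
      qed (use nn in auto)
    qed
    then show ?thesis by (simp add: N_def algebra_simps)
  qed
  moreover have "B * (E + 8 * D) * C > 0" using B C D E by (intro mult_pos_pos add_pos_nonneg) auto
  ultimately show ?case unfolding \<gamma>'_def l_def by blast
qed

theorem theorem3p14:
  fixes \<Omega> :: "'a::euclidean_space set"
    and m :: nat and p :: real and r :: ennreal and \<alpha>1 \<alpha>2 :: real
  assumes "is_domain \<Omega>" and "has_cone_property \<Omega>" and "0 \<in> \<Omega>"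
    and "1 < p" and "1 \<le> r"
    and "in_V DIM('a) \<alpha>2 (ennreal p) r"
    and "\<alpha>2 \<ge> \<alpha>1"
    and "\<alpha>1 + real DIM('a) / p > 0"
    and "max (real DIM('a) / p + \<alpha>2) (real DIM('a) / p + \<alpha>2 - \<alpha>1) < real m"
    and "m < DIM('a)"
  shows "herz_sobolev_space \<alpha>2 p r m \<Omega> \<subseteq> herz_space \<alpha>1 p r \<Omega>
    \<and> (\<exists>C>0. \<forall>f G. herz_sobolev_witness \<alpha>2 p r m \<Omega> f G \<longrightarrow>
          herz_norm \<alpha>1 p r \<Omega> f \<le> C * herz_sobolev_norm \<alpha>2 p r m \<Omega> G)"
proof -
  have "open \<Omega>" using assms(1) by (simp add: is_domain_def)
  \<comment> \<open>From \<alpha>2 + n/p < m and \<alpha>1 > -n/p it follows that \<alpha>2 - m <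
    -n/p < \<alpha>1.\<close>
  have \<gamma>: "max (\<alpha>2 - real m) \<alpha>1 = \<alpha>1" using assms(8,9) by auto
  obtain C where C: "C > 0" and bound: "\<And>f G. herz_sobolev_witness \<alpha>2 p r m \<Omega> f G \<Longrightarrow>
    lr_bound r (\<lambda>k. 2 powr (real_of_int k * \<alpha>1) * deriv_norm_sum p \<Omega> 0 G k) (C * herz_sobolev_norm \<alpha>2 p r m \<Omega> G)"
    using herz_iteration[OF assms(4,5) \<open>open \<Omega>\<close> assms(3,8,7) order_refl, of m] unfolding \<gamma> by auto
  \<comment> \<open>After m steps only the zero multi-index is left in the sum, and its norms on the
    annuli are those of f.\<close>
  have bound_f: "lr_bound r (\<lambda>k. 2 powr (real_of_int k * \<alpha>1) * Lp_norm p (annulus k \<inter> \<Omega>) f) (C * herz_sobolev_norm \<alpha>2 p r m \<Omega> G)"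
    if w: "herz_sobolev_witness \<alpha>2 p r m \<Omega> f G" for f G
  proof -
    have "weak_deriv \<Omega> (\<lambda>_. 0) f (G (\<lambda>_. 0))" "\<And>j. Lp_on p (annulus j \<inter> \<Omega>) f"
      using w zero_in_multi_indices[of m] by (auto simp: herz_sobolev_witness_def herz_space_def)
    then have "Lp_norm p (annulus k \<inter> \<Omega>) f = Lp_norm p (annulus k \<inter> \<Omega>) (G (\<lambda>_. 0))" for k
      using assms(4) \<open>open \<Omega>\<close> witness_Lp_on[OF w zero_in_multi_indices] by (intro Lp_norm_weak_deriv_zero) auto
    then have "deriv_norm_sum p \<Omega> 0 G k = Lp_norm p (annulus k \<inter> \<Omega>) f" for k
      by (simp add: deriv_norm_sum_def multi_indices_0)
    then show ?thesis using bound[OF w] by simp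
  qed
  show ?thesis
  proof (intro conjI subsetI)
    fix f assume "f \<in> herz_sobolev_space \<alpha>2 p r m \<Omega>"
    then obtain G where w: "herz_sobolev_witness \<alpha>2 p r m \<Omega> f G" by (auto simp: herz_sobolev_space_def)
    have "herz_outer_finite \<alpha>1 r (\<lambda>k. Lp_norm p (annulus k \<inter> \<Omega>) f)"
      by (rule herz_outer_le(1)[OF assms(5) bound_f[OF w]])
    then show "f \<in> herz_space \<alpha>1 p r \<Omega>" using w by (auto simp: herz_sobolev_witness_def herz_space_def)
  next
    have "herz_norm \<alpha>1 p r \<Omega> f \<le> C * herz_sobolev_norm \<alpha>2 p r m \<Omega> G"
      if w: "herz_sobolev_witness \<alpha>2 p r m \<Omega> f G" for f G
      unfolding herz_norm_def by (rule herz_outer_le(2)[OF assms(5) bound_f[OF w]])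
    with C show "\<exists>C>0. \<forall>f G. herz_sobolev_witness \<alpha>2 p r m \<Omega> f G \<longrightarrow>
          herz_norm \<alpha>1 p r \<Omega> f \<le> C * herz_sobolev_norm \<alpha>2 p r m \<Omega> G" by blast
  qed
qed

end
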